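(* Let $n\ge 3$ be an integer. There is a constant $k=k(n)>0$, depending only on $n$, such that the following holds. Let $d>\frac{2(n-1)}{2n-3}$ be a real number, let $f\in\mathscr{H}_d^{\mathbf 0}(\mathbb{R}^{n-1})$, and let $\varepsilon>0$ be small in terms of $d$ and $n$. (i) If $\frac{2(n-1)}{2n-3}<d\le 2(n-1)$, then $$\mathrm{N}_f(\delta,Q)\asymp\delta Q^n\qquad\text{for } Q\ge 1\text{ and }\delta\in(Q^{\varepsilon-1},1/2).$$ (ii) If $d>2(n-1)$, then $$\Big(\frac{\delta}{Q}\Big)^{\frac{n-1}{d}}Q^n\ll \mathrm{N}_f(\delta,Q)\ll\Big(\frac{\delta}{Q}\Big)^{\frac{n-1}{d}}Q^{n}Q^{k\varepsilon}\qquad\text{for }Q\ge1\text{ and }\delta\in\Big(Q^{\varepsilon-1},\,Q^{-\frac{n-1-k\varepsilon d}{d-(n-1)}}\Big),$$ while $$\mathrm{N}_f(\delta,Q)\asymp\delta Q^n\qquad\text{for }Q\ge 1\text{ and }\delta\in\Big[Q^{-\frac{n-1-k\varepsilon d}{d-(n-1)}},\,1/2\Big).$$ All implied constants may depend on $\varepsilon,f,n,d$, but not on $\delta$ or $Q$.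
   Context: $\mathscr{H}_d(\mathbb{R}^{n-1})$ is the set of functions $f:\mathbb{R}^{n-1}\to\mathbb{R}$ with $f(\lambda\mathbf{x})=\lambda^d f(\mathbf{x})$ for all $\mathbf{x}\in\mathbb{R}^{n-1}$ and $\lambda\ge 0$. For $d\ne 0$, $\mathscr{H}_d^{\mathbf 0}(\mathbb{R}^{n-1})$ is the set of $f\in\mathscr{H}_d(\mathbb{R}^{n-1})$ that are smooth ($C^\infty$) on $\mathbb{R}^{n-1}\setminus\{\mathbf 0\}$ and whose Hessian matrix $H_f(\mathbf{x})$ satisfies $\det H_f(\mathbf{x})\ne 0$ for all $\mathbf{x}\ne\mathbf 0$. $\mathrm{N}_f(\delta,Q)$ is the number of pairs $(q,\mathbf{a})\in\mathbb{Z}\times\mathbb{Z}^{n-1}$ such that $q/Q\in[1,2)$, $\lVert \mathbf{a}/q\rVert_2<1$ and $\lVert q f(\mathbf{a}/q)\rVert\le\delta$, where $\lVert\cdot\rVert_2$ is the Euclidean norm and $\lVert x\rVert=\min_{z\in\mathbb{Z}}|x-z|$ for real $x$. $A\ll B$ means $|A|\le C|B|$ for some constant $C>0$, uniformly in the indicated parameters; $A\asymp B$ means $A\ll B$ and $B\ll A$. *)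

theory Defs
  imports "HOL-Analysis.Analysis"
begin

text \<open>On an open set, \<open>C_on k\<close> is the usual class of $k$ times continuously differentiable
  functions; derivatives are taken in all directions.\<close>

fun C_on :: "nat \<Rightarrow> 'a::real_normed_vector set \<Rightarrow> ('a \<Rightarrow> 'b::real_normed_vector) \<Rightarrow> bool" where
  "C_on 0 S f \<longleftrightarrow> continuous_on S f"
| "C_on (Suc k) S f \<longleftrightarrow>
     (\<forall>x\<in>S. f differentiable (at x)) \<and> (\<forall>v. C_on k S (\<lambda>x. frechet_derivative f (at x) v))"

definition smooth_on :: "'a::real_normed_vector set \<Rightarrow> ('a \<Rightarrow> 'b::real_normed_vector) \<Rightarrow> bool" where
  "smooth_on S f \<longleftrightarrow> (\<forall>k. C_on k S f)"

definition partial_deriv :: "'m \<Rightarrow> (real ^ 'm \<Rightarrow> real) \<Rightarrow> real ^ 'm::finite \<Rightarrow> real" where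
  "partial_deriv i f x = deriv (\<lambda>t. f (x + t *\<^sub>R axis i 1)) 0"

definition hessian :: "(real ^ 'm \<Rightarrow> real) \<Rightarrow> real ^ 'm \<Rightarrow> real ^ 'm ^ 'm::finite" where
  "hessian f x = (\<chi> i j. partial_deriv i (partial_deriv j f) x)"

text \<open>Meant for $d > 0$: there \<open>0 powr d = 0\<close> is the usual value of $0^d$.\<close>

definition homogeneous :: "real \<Rightarrow> (real ^ 'm::finite \<Rightarrow> real) set" where
  "homogeneous d = {f. \<forall>x. \<forall>l\<ge>0. f (l *\<^sub>R x) = l powr d * f x}"

definition homogeneous_nondeg :: "real \<Rightarrow> (real ^ 'm::finite \<Rightarrow> real) set" where
  "homogeneous_nondeg d =
     {f \<in> homogeneous d. smooth_on (UNIV - {0}) f \<and> (\<forall>x. x \<noteq> 0 \<longrightarrow> det (hessian f x) \<noteq> 0)}"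

definition int_dist :: "real \<Rightarrow> real" where
  "int_dist x = (INF z::int. \<bar>x - of_int z\<bar>)"

lemma int_dist_attained: "\<exists>z::int. int_dist x = \<bar>x - of_int z\<bar>"
proof
  have "\<bar>x - of_int (round x)\<bar> \<le> \<bar>x - of_int z\<bar>" for z
    using round_diff_minimal[of x z] by (simp add: abs_minus_commute)
  then show "int_dist x = \<bar>x - of_int (round x)\<bar>"
    unfolding int_dist_def by (intro cInf_eq_minimum) auto
qed

definition rational_points ::
  "(real ^ 'm::finite \<Rightarrow> real) \<Rightarrow> real \<Rightarrow> real \<Rightarrow> (int \<times> (int ^ 'm)) set" where
  "rational_points f \<delta> Q =
     {(q, a). real_of_int q / Q \<in> {1..<2} \<and>
              norm (\<chi> i. real_of_int (a $ i) / real_of_int q) < 1 \<and>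
              int_dist (real_of_int q * f (\<chi> i. real_of_int (a $ i) / real_of_int q)) \<le> \<delta>}"

definition N :: "(real ^ 'm::finite \<Rightarrow> real) \<Rightarrow> real \<Rightarrow> real \<Rightarrow> nat" where
  "N f \<delta> Q = card (rational_points f \<delta> Q)"

lemma finite_rational_points:
  assumes "Q > 0"
  shows "finite (rational_points f \<delta> Q)"
proof -
  have "rational_points f \<delta> Q \<subseteq> {0..\<lceil>2 * Q\<rceil>} \<times> vec_lambda ` (UNIV \<rightarrow>\<^sub>E {- \<lceil>2 * Q\<rceil>..\<lceil>2 * Q\<rceil>})"
  proof clarify
    fix q a assume "(q, a) \<in> rational_points f \<delta> Q"
    then have q: "Q \<le> real_of_int q" "real_of_int q < 2 * Q"
      and a: "norm (\<chi> i. real_of_int (a $ i) / real_of_int q) < 1"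
      using assms by (auto simp: rational_points_def field_simps)
    have "a $ i \<in> {- \<lceil>2 * Q\<rceil>..\<lceil>2 * Q\<rceil>}" for i
    proof -
      have "\<bar>real_of_int (a $ i) / real_of_int q\<bar> < 1"
        using component_le_norm_cart[of "\<chi> i. real_of_int (a $ i) / real_of_int q" i] a by simp
      then have "\<bar>real_of_int (a $ i)\<bar> < 2 * Q"
        using q assms by (simp add: divide_simps)
      then show ?thesis by simp linarith
    qed
    then have "vec_nth a \<in> UNIV \<rightarrow>\<^sub>E {- \<lceil>2 * Q\<rceil>..\<lceil>2 * Q\<rceil>}" by auto
    then have "a \<in> vec_lambda ` (UNIV \<rightarrow>\<^sub>E {- \<lceil>2 * Q\<rceil>..\<lceil>2 * Q\<rceil>})"
      by (metis image_eqI vec_nth_inverse)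
    moreover have "q \<in> {0..\<lceil>2 * Q\<rceil>}" using q assms by simp linarith
    ultimately show "q \<in> {0..\<lceil>2 * Q\<rceil>} \<and> a \<in> vec_lambda ` (UNIV \<rightarrow>\<^sub>E {- \<lceil>2 * Q\<rceil>..\<lceil>2 * Q\<rceil>})"
      by blast
  qed
  moreover have "finite ({0..\<lceil>2 * Q\<rceil>} \<times>
      (vec_lambda ` (UNIV \<rightarrow>\<^sub>E {- \<lceil>2 * Q\<rceil>..\<lceil>2 * Q\<rceil>}) :: (int ^ 'm::finite) set))"
    by (intro finite_cartesian_product finite_imageI finite_PiE) auto
  ultimately show ?thesis by (rule finite_subset)
qed

text \<open>$A \ll B$ and $A \asymp B$, uniformly over the parameter set \<open>S\<close>.\<close>

definition dominated_on :: "'p set \<Rightarrow> ('p \<Rightarrow> real) \<Rightarrow> ('p \<Rightarrow> real) \<Rightarrow> bool" where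
  "dominated_on S A B \<longleftrightarrow> (\<exists>C>0. \<forall>p\<in>S. \<bar>A p\<bar> \<le> C * \<bar>B p\<bar>)"

definition comparable_on :: "'p set \<Rightarrow> ('p \<Rightarrow> real) \<Rightarrow> ('p \<Rightarrow> real) \<Rightarrow> bool" where
  "comparable_on S A B \<longleftrightarrow> dominated_on S A B \<and> dominated_on S B A"

end

theory Submission
  imports Defs
begin

text \<open>The whole argument is lattice point geometry; no oscillatory integrals are needed.

Near a point of the hypersurface, the integer points \<open>(q, a, b)\<close> with \<open>b / q\<close> close to
\<open>f (a / q)\<close> lie in a thin box. Bessel's inequality bounds the number of integer points in
a box by its volume times the number of integer points in a multiple of the polar box. Integer
points in the polar box are integer points close to the hypersurface given by the Legendre
transform, so after summing over the points of a net, a counting bound for a hypersurface follows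
from a weaker one for its dual. As dualizing twice gives back the original hypersurface, this
improvement can be iterated: an error exponent \<open>t\<close> becomes \<open>t / (1 + t)\<close>, starting from the
trivial \<open>t = 1\<close>. Homogeneity rescales dyadic shells around the origin to one fixed annulus, the
scales \<open>s\<close> of the domain and \<open>s * \<sigma>\<close> of the range being carried along through the bootstrap.

For the lower bound, the pigeonhole principle gives many integer points in every box, and the
upper bound applied to a smaller box shows that most of them have a denominator of size
comparable to \<open>Q\<close>. Below the threshold for \<open>\<delta>\<close>, the points with \<open>a / q\<close> so close to the origin
that \<open>\<bar>q * f (a / q)\<bar> \<le> \<delta>\<close> suffice. The upper bound obtained is a constant times
\<open>Q ^ n * (\<delta> + (\<delta> / Q) powr ((n - 1) / d))\<close> for large \<open>d\<close>, so that \<open>k = 1\<close> is possible.\<close>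

section \<open>Integer points in boxes\<close>

text \<open>The cell size is forced. Put \<open>m = n - 1\<close>, \<open>V = Q * s\<close> and
  \<open>U = V * \<sigma>\<close>. Up to constants, a tangent plane serves all denominators up to
  \<open>2 * Q\<close> with error \<open>\<delta>\<close> over a distance
  \<open>\<tau> = sqrt (\<delta> / U)\<close>. For this \<open>\<tau>\<close> a dual point of height
  \<open>j\<close> occurs in at most a constant times \<open>(1 / (\<delta> * j)) ^ m\<close> cells,
  which cancels the growth \<open>j ^ m\<close> of the dual count. Only positive powers of
  \<open>j\<close> survive, so the top height \<open>1 / \<delta>\<close> dominates and no logarithm
  is lost. Balance at the smallest useful \<open>\<delta>\<close> asks for
  \<open>(1 - t') * t = t'\<close>, hence \<open>t' = t / (1 + t)\<close>; finitely many rounds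
  reach any \<open>\<epsilon>\<close>, and the constants depend on it.

  The obstacle is uniformity in both scales. Shells near the origin are flat and have small slopes,
  so dual points with vanishing middle coordinate appear. They cause the term
  \<open>sqrt (\<delta> / (Q * s * \<sigma>))\<close>. Capped at \<open>1\<close> and summed over
  the shells, it is absorbed by \<open>\<delta>\<close> or becomes the second main term.\<close>

lemma card_vec_set:
  "card {v :: int ^ 'm::finite. \<forall>i. v $ i \<in> A i} = (\<Prod>i\<in>UNIV. card (A i))"
  (is "card ?S = _")
proof -
  have "bij_betw vec_nth ?S (PiE UNIV A)"
    by (rule bij_betwI[where g = vec_lambda]) (auto simp: PiE_def extensional_def)
  then show ?thesis
    using bij_betw_same_card card_PiE[of UNIV A] by fastforce
qed

lemma finite_vec_set:
  assumes "\<And>i. finite (A i)"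
  shows "finite {v :: int ^ 'm::finite. \<forall>i. v $ i \<in> A i}"
proof -
  have "{v :: int ^ 'm. \<forall>i. v $ i \<in> A i} \<subseteq> vec_lambda ` (PiE UNIV A)"
  proof
    fix v :: "int ^ 'm" assume "v \<in> {v. \<forall>i. v $ i \<in> A i}"
    then have "v = vec_lambda (vec_nth v)" "vec_nth v \<in> PiE UNIV A" by auto
    then show "v \<in> vec_lambda ` (PiE UNIV A)" by blast
  qed
  moreover have "finite (vec_lambda ` (PiE UNIV A) :: (int ^ 'm) set)"
    using assms by (simp add: finite_PiE)
  ultimately show ?thesis by (rule finite_subset)
qed

lemma sum_vec_prod:
  fixes F :: "'m::finite \<Rightarrow> int \<Rightarrow> complex"
  assumes "\<And>i. finite (A i)"
  shows "(\<Sum>v | \<forall>i. v $ i \<in> A i. \<Prod>i\<in>UNIV. F i (v $ i)) = (\<Prod>i\<in>UNIV. \<Sum>x\<in>A i. F i x)"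
proof -
  have b: "bij_betw vec_nth {v :: int ^ 'm. \<forall>i. v $ i \<in> A i} (PiE UNIV A)"
    by (rule bij_betwI[where g = vec_lambda]) (auto simp: PiE_def extensional_def)
  have "(\<Sum>v | \<forall>i. v $ i \<in> A i. \<Prod>i\<in>UNIV. F i (v $ i)) = (\<Sum>g\<in>PiE UNIV A. \<Prod>i\<in>UNIV. F i (g i))"
    by (rule sum.reindex_bij_betw[OF b, of "\<lambda>g. \<Prod>i\<in>UNIV. F i (g i)"])
  also have "\<dots> = (\<Prod>i\<in>UNIV. \<Sum>x\<in>A i. F i x)"
    by (rule prod_sum_PiE[symmetric]) (use assms in auto)
  finally show ?thesis .
qed

section \<open>Sheared lattice boxes and elementary counts\<close>

definition rvec :: "int ^ 'm \<Rightarrow> real ^ 'm::finite" where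
  "rvec a = (\<chi> i. real_of_int (a $ i))"

lemma rvec_nth [simp]: "rvec a $ i = real_of_int (a $ i)"
  by (simp add: rvec_def)

lemma rvec_diff: "rvec (a - b) = rvec a - rvec b"
  and rvec_minus: "rvec (- a) = - rvec a"
  and rvec_0 [simp]: "rvec 0 = 0"
  by (simp_all add: vec_eq_iff)

lemma norm_le_card_bound:
  fixes x :: "real ^ 'm::finite"
  assumes "\<And>i. \<bar>x $ i\<bar> \<le> r"
  shows "norm x \<le> real CARD('m) * r"
proof -
  have "norm x \<le> (\<Sum>i\<in>UNIV. \<bar>x $ i\<bar>)" by (rule norm_le_l1_cart)
  also have "\<dots> \<le> (\<Sum>i\<in>(UNIV :: 'm set). r)" by (intro sum_mono assms)
  finally show ?thesis by simp
qed

lemma norm_rvec_ge_1: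
  assumes "a \<noteq> 0"
  shows "1 \<le> norm (rvec a)"
proof -
  obtain i where i: "a $ i \<noteq> 0" using assms by (auto simp: vec_eq_iff)
  then have "1 \<le> \<bar>rvec a $ i\<bar>" by simp
  also have "\<dots> \<le> norm (rvec a)" by (rule component_le_norm_cart)
  finally show ?thesis .
qed

text \<open>In the coordinates \<open>q\<close>, \<open>a - q * \<xi>\<close>,
  \<open>b - q * \<omega> - \<eta> \<bullet> (a - q * \<xi>)\<close>, which arise from a shear of
  determinant one, this is a product of an interval, a ball and an interval. Geometrically it is a
  piece of the cone over a neighbourhood of the tangent plane with slope \<open>\<eta>\<close> at
  the point \<open>(\<xi>, \<omega>)\<close>.\<close>

definition lbox ::
  "real ^ 'm \<Rightarrow> real ^ 'm \<Rightarrow> real \<Rightarrow> real \<Rightarrow> real \<Rightarrow> real \<Rightarrow> (int \<times> (int ^ 'm::finite) \<times> int) set" where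
  "lbox \<xi> \<eta> \<omega> X \<rho> \<delta> = {(q, a, b). \<bar>real_of_int q\<bar> \<le> X \<and> norm (rvec a - real_of_int q *\<^sub>R \<xi>) \<le> \<rho> \<and>
     \<bar>real_of_int b - real_of_int q * \<omega> - \<eta> \<bullet> (rvec a - real_of_int q *\<^sub>R \<xi>)\<bar> \<le> \<delta>}"

lemma lbox_mono:
  "X \<le> X' \<Longrightarrow> \<rho> \<le> \<rho>' \<Longrightarrow> \<delta> \<le> \<delta>' \<Longrightarrow> lbox \<xi> \<eta> \<omega> X \<rho> \<delta> \<subseteq> lbox \<xi> \<eta> \<omega> X' \<rho>' \<delta>'"
  by (auto simp: lbox_def)

lemma lbox_uminus:
  assumes "(q, a, b) \<in> lbox \<xi> \<eta> \<omega> X \<rho> \<delta>"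
  shows "(- q, - a, - b) \<in> lbox \<xi> \<eta> \<omega> X \<rho> \<delta>"
proof -
  have 1: "rvec (- a) - real_of_int (- q) *\<^sub>R \<xi> = - (rvec a - real_of_int q *\<^sub>R \<xi>)"
    by (simp add: rvec_minus)
  have 2: "real_of_int (- b) - real_of_int (- q) * \<omega> - \<eta> \<bullet> - (rvec a - real_of_int q *\<^sub>R \<xi>)
      = - (real_of_int b - real_of_int q * \<omega> - \<eta> \<bullet> (rvec a - real_of_int q *\<^sub>R \<xi>))"
    by (simp add: algebra_simps)
  show ?thesis using assms unfolding lbox_def mem_Collect_eq prod.case 1 2 norm_minus_cancel abs_minus_cancel
    by simp
qed

lemma int_interval_bounds:
  fixes z r :: real
  assumes "r \<ge> 0"
  shows "finite {j :: int. \<bar>real_of_int j - z\<bar> \<le> r}"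
    and "real (card {j :: int. \<bar>real_of_int j - z\<bar> \<le> r}) \<le> 2 * r + 1"
    and "real (card {j :: int. \<bar>real_of_int j - z\<bar> \<le> r}) \<ge> 2 * r - 1"
proof -
  have e: "{j :: int. \<bar>real_of_int j - z\<bar> \<le> r} = {\<lceil>z - r\<rceil>..\<lfloor>z + r\<rfloor>}"
    by (auto simp: abs_le_iff ceiling_le_iff le_floor_iff)
  then show "finite {j :: int. \<bar>real_of_int j - z\<bar> \<le> r}" by simp
  have "\<lfloor>z + r\<rfloor> - \<lceil>z - r\<rceil> + 1 \<ge> 0" using assms by linarith
  then have c: "real (card {j :: int. \<bar>real_of_int j - z\<bar> \<le> r}) = real_of_int (\<lfloor>z + r\<rfloor> - \<lceil>z - r\<rceil> + 1)"
    unfolding e by (simp add: algebra_simps)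
  show "real (card {j :: int. \<bar>real_of_int j - z\<bar> \<le> r}) \<le> 2 * r + 1"
    "real (card {j :: int. \<bar>real_of_int j - z\<bar> \<le> r}) \<ge> 2 * r - 1"
    unfolding c by linarith+
qed

text \<open>The conditions are triangular: \<open>q\<close> determines the window for
  \<open>a\<close>, and both determine the window for \<open>b\<close>. So the bound is uniform in
  \<open>\<xi>\<close>, \<open>\<eta>\<close> and \<open>\<omega>\<close>. For a thin box the
  summands \<open>1\<close> dominate; that loss is what transference avoids.\<close>

lemma lbox_trivial:
  fixes \<xi> \<eta> :: "real ^ 'm::finite" and X \<rho> \<delta> \<omega> :: real
  assumes "X \<ge> 0" "\<rho> \<ge> 0" "\<delta> \<ge> 0"
  shows "finite (lbox \<xi> \<eta> \<omega> X \<rho> \<delta>)"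
    and "real (card (lbox \<xi> \<eta> \<omega> X \<rho> \<delta>)) \<le> (2 * X + 1) * (2 * \<rho> + 1) ^ CARD('m) * (2 * \<delta> + 1)"
proof -
  let ?J = "\<lambda>z r. {j :: int. \<bar>real_of_int j - z\<bar> \<le> r}"
  let ?A = "\<lambda>q. {a :: int ^ 'm. \<forall>i. a $ i \<in> ?J (real_of_int q * \<xi> $ i) \<rho>}"
  let ?B = "\<lambda>q a. ?J (real_of_int q * \<omega> + \<eta> \<bullet> (rvec a - real_of_int q *\<^sub>R \<xi>)) \<delta>"
  let ?S = "SIGMA q : ?J 0 X. SIGMA a : ?A q. ?B q a"
  have fin: "finite (?J 0 X)" "finite (?A q)" "finite (?B q a)" for q a
    by (intro finite_vec_set int_interval_bounds(1) assms)+
  have sub: "lbox \<xi> \<eta> \<omega> X \<rho> \<delta> \<subseteq> ?S"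
  proof
    fix \<mu> assume \<mu>: "\<mu> \<in> lbox \<xi> \<eta> \<omega> X \<rho> \<delta>"
    obtain q a b where e: "\<mu> = (q, a, b)" by (cases \<mu>)
    note h = \<mu>[unfolded e]
    have "\<bar>(rvec a - real_of_int q *\<^sub>R \<xi>) $ i\<bar> \<le> \<rho>" for i
      using component_le_norm_cart[of "rvec a - real_of_int q *\<^sub>R \<xi>" i] h by (auto simp: lbox_def)
    then show "\<mu> \<in> ?S" using h unfolding e by (auto simp: lbox_def algebra_simps)
  qed
  show f: "finite (lbox \<xi> \<eta> \<omega> X \<rho> \<delta>)"
    by (rule finite_subset[OF sub]) (use fin in auto)
  have cA: "real (card (?A q)) \<le> (2 * \<rho> + 1) ^ CARD('m)" for q
  proof -
    have "real (card (?A q)) = (\<Prod>i\<in>UNIV. real (card (?J (real_of_int q * \<xi> $ i) \<rho>)))"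
      by (subst card_vec_set) simp
    also have "\<dots> \<le> (\<Prod>i\<in>(UNIV :: 'm set). 2 * \<rho> + 1)"
      by (intro prod_mono conjI int_interval_bounds(2) assms) auto
    finally show ?thesis by simp
  qed
  have "real (card (lbox \<xi> \<eta> \<omega> X \<rho> \<delta>)) \<le> real (card ?S)"
    using fin by (intro of_nat_mono card_mono sub) auto
  also have "\<dots> = (\<Sum>q\<in>?J 0 X. \<Sum>a\<in>?A q. real (card (?B q a)))"
    using fin by (subst card_SigmaI) (auto simp: card_SigmaI)
  also have "\<dots> \<le> (\<Sum>q\<in>?J 0 X. \<Sum>a\<in>?A q. 2 * \<delta> + 1)"
    by (intro sum_mono int_interval_bounds(2) assms)
  also have "\<dots> = (\<Sum>q\<in>?J 0 X. real (card (?A q)) * (2 * \<delta> + 1))" by simp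
  also have "\<dots> \<le> (\<Sum>q\<in>?J 0 X. (2 * \<rho> + 1) ^ CARD('m) * (2 * \<delta> + 1))"
    by (intro sum_mono mult_right_mono cA) (use assms in auto)
  also have "\<dots> = real (card (?J 0 X)) * ((2 * \<rho> + 1) ^ CARD('m) * (2 * \<delta> + 1))" by simp
  also have "\<dots> \<le> (2 * X + 1) * ((2 * \<rho> + 1) ^ CARD('m) * (2 * \<delta> + 1))"
    by (intro mult_right_mono int_interval_bounds(2) assms) (use assms in auto)
  finally show "real (card (lbox \<xi> \<eta> \<omega> X \<rho> \<delta>)) \<le> (2 * X + 1) * (2 * \<rho> + 1) ^ CARD('m) * (2 * \<delta> + 1)"
    by (simp only: mult.assoc)
qed

text \<open>Round off one coordinate after the other.\<close>

lemma lbox_card_ge: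
  fixes \<xi> \<eta> :: "real ^ 'm::finite" and X \<rho> \<delta> \<omega> :: real
  assumes "X \<ge> 3" "\<rho> \<ge> 3 * CARD('m)" "\<delta> \<ge> 3"
  shows "X * (\<rho> / CARD('m)) ^ CARD('m) * \<delta> \<le> real (card (lbox \<xi> \<eta> \<omega> X \<rho> \<delta>))"
proof -
  let ?J = "\<lambda>z r. {j :: int. \<bar>real_of_int j - z\<bar> \<le> r}"
  \<comment> \<open>A cube of this half-side fits into the Euclidean ball of radius
    \<open>\<rho>\<close>.\<close>
  let ?r = "\<rho> / CARD('m)"
  let ?A = "\<lambda>q. {a :: int ^ 'm. \<forall>i. a $ i \<in> ?J (real_of_int q * \<xi> $ i) ?r}"
  let ?B = "\<lambda>q a. ?J (real_of_int q * \<omega> + \<eta> \<bullet> (rvec a - real_of_int q *\<^sub>R \<xi>)) \<delta>"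
  let ?S = "SIGMA q : ?J 0 X. SIGMA a : ?A q. ?B q a"
  have r: "?r \<ge> 3" using assms by (simp add: field_simps)
  have "X \<ge> 0" "?r \<ge> 0" "\<delta> \<ge> 0" using assms r by linarith+
  note fin0 = int_interval_bounds(1)[OF this(1)] int_interval_bounds(1)[OF this(2)] int_interval_bounds(1)[OF this(3)]
  have fin: "finite (?J 0 X)" "finite (?A q)" "finite (?B q a)" for q a
    by (intro finite_vec_set fin0)+
  have sub: "?S \<subseteq> lbox \<xi> \<eta> \<omega> X \<rho> \<delta>"
  proof
    fix \<mu> assume "\<mu> \<in> ?S"
    then obtain q a b where e: "\<mu> = (q, a, b)"
      and h: "q \<in> ?J 0 X" "\<forall>i. a $ i \<in> ?J (real_of_int q * \<xi> $ i) ?r" "b \<in> ?B q a" by auto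
    have "norm (rvec a - real_of_int q *\<^sub>R \<xi>) \<le> CARD('m) * ?r"
      by (rule norm_le_card_bound) (use h in auto)
    then show "\<mu> \<in> lbox \<xi> \<eta> \<omega> X \<rho> \<delta>" using h unfolding e by (auto simp: lbox_def algebra_simps)
  qed
  have J: "r \<le> real (card (?J z r))" if "r \<ge> 3" for r z
    using int_interval_bounds(3)[of r z] that by linarith
  have cA: "?r ^ CARD('m) \<le> real (card (?A q))" for q
  proof -
    have "?r ^ CARD('m) = (\<Prod>i\<in>(UNIV :: 'm set). ?r)" by simp
    also have "\<dots> \<le> (\<Prod>i\<in>UNIV. real (card (?J (real_of_int q * \<xi> $ i) ?r)))"
      by (intro prod_mono conjI J) (use r assms in auto)
    finally show ?thesis by (subst card_vec_set) simp
  qed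
  have "X * ?r ^ CARD('m) * \<delta> \<le> real (card (?J 0 X)) * (?r ^ CARD('m) * \<delta>)"
    unfolding mult.assoc by (intro mult_right_mono J) (use assms r in auto)
  also have "\<dots> = (\<Sum>q\<in>?J 0 X. ?r ^ CARD('m) * \<delta>)" by simp
  also have "\<dots> \<le> (\<Sum>q\<in>?J 0 X. real (card (?A q)) * \<delta>)"
    by (intro sum_mono mult_right_mono cA) (use assms in auto)
  also have "\<dots> = (\<Sum>q\<in>?J 0 X. \<Sum>a\<in>?A q. \<delta>)" by simp
  also have "\<dots> \<le> (\<Sum>q\<in>?J 0 X. \<Sum>a\<in>?A q. real (card (?B q a)))"
    by (intro sum_mono J assms)
  also have "\<dots> = real (card ?S)"
    using fin by (subst card_SigmaI) (auto simp: card_SigmaI)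
  also have "\<dots> \<le> real (card (lbox \<xi> \<eta> \<omega> X \<rho> \<delta>))"
    using assms by (intro of_nat_mono card_mono sub lbox_trivial) auto
  finally show ?thesis .
qed

section \<open>Bessel's inequality and transference\<close>

text \<open>Orthogonality of the characters modulo \<open>M\<close>. The modulus is odd so that the
  symmetric interval is a complete residue system.\<close>

lemma sum_cis_period:
  fixes K :: nat and h :: int
  defines "M \<equiv> 2 * int K + 1"
  shows "(\<Sum>x\<in>{- int K..int K}. cis (2 * pi * (real_of_int (x * h) / real_of_int M)))
    = (if M dvd h then of_int M else 0)"
proof -
  define z where "z = cis (2 * pi * (real_of_int h / real_of_int M))"
  define w where "w = cis (2 * pi * (- real K * (real_of_int h / real_of_int M)))"
  have M: "M > 0" by (simp add: M_def)
  have bij: "bij_betw (\<lambda>i. int i - int K) {..<nat M} {- int K..int K}"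
    by (rule bij_betwI[where g = "\<lambda>x. nat (x + int K)"]) (auto simp: M_def)
  have "(\<Sum>x\<in>{- int K..int K}. cis (2 * pi * (real_of_int (x * h) / real_of_int M)))
     = (\<Sum>i<nat M. cis (2 * pi * (real_of_int ((int i - int K) * h) / real_of_int M)))"
    by (rule sum.reindex_bij_betw[OF bij, symmetric])
  also have "\<dots> = (\<Sum>i<nat M. w * z ^ i)"
    by (intro sum.cong refl) (simp add: w_def z_def Complex.DeMoivre cis_mult algebra_simps diff_divide_distrib)
  also have "\<dots> = w * (\<Sum>i<nat M. z ^ i)" by (simp add: sum_distrib_left)
  also have "\<dots> = (if M dvd h then of_int M else 0)"
  proof (cases "M dvd h")
    case True
    then obtain c where c: "h = M * c" by blast
    have hc: "real_of_int h / real_of_int M = real_of_int c" using M c by simp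
    have z: "z = 1" unfolding z_def hc using cis_multiple_2pi[of "real_of_int c"] by simp
    have w: "w = 1" unfolding w_def hc using cis_multiple_2pi[of "- real K * real_of_int c"] by simp
    show ?thesis using True M by (simp add: z w)
  next
    case False
    have "z \<noteq> 1"
    proof
      assume "z = 1"
      then obtain n :: int where "2 * pi * (real_of_int h / real_of_int M) = real_of_int (2 * n) * pi"
        unfolding z_def cis_conv_exp exp_eq_1 by auto
      then have "real_of_int h = real_of_int (M * n)" using M by (simp add: field_simps)
      then have "h = M * n" by linarith
      then show False using False by simp
    qed
    moreover have "z ^ nat M = 1"
    proof -
      have "z ^ nat M = cis (2 * pi * real_of_int h)"
        using M by (simp add: z_def Complex.DeMoivre)
      then show ?thesis using cis_multiple_2pi[of "real_of_int h"] by simp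
    qed
    ultimately have "(\<Sum>i<nat M. z ^ i) = 0" by (simp add: geometric_sum)
    then show ?thesis using False by simp
  qed
  finally show ?thesis .
qed

text \<open>With this sign the polar of a box \<open>lbox\<close> is again such a box, see \<open>pairing_eq\<close>.\<close>

fun pairing :: "int \<times> (int ^ 'm::finite) \<times> int \<Rightarrow> int \<times> (int ^ 'm) \<times> int \<Rightarrow> int" where
  "pairing (q, a, b) (j, k, l) = q * l - (\<Sum>i\<in>UNIV. a $ i * k $ i) + b * j"

definition cube :: "nat \<Rightarrow> (int \<times> (int ^ 'm::finite) \<times> int) set" where
  "cube K = {- int K..int K} \<times> {a. \<forall>i. a $ i \<in> {- int K..int K}} \<times> {- int K..int K}"

lemma finite_cube: "finite (cube K)"
  unfolding cube_def by (intro finite_cartesian_product finite_vec_set) auto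

text \<open>The character is a product over the coordinates. The negative sign in the middle of
  \<open>pairing\<close> is harmless, as divisibility by \<open>M\<close> ignores signs.\<close>

lemma sum_cube_character:
  fixes K :: nat and r :: "int \<times> (int ^ 'm::finite) \<times> int"
  defines "M \<equiv> 2 * int K + 1"
  shows "(\<Sum>\<mu>\<in>cube K. cis (2 * pi * (real_of_int (pairing \<mu> r) / real_of_int M)))
    = (if M dvd fst r \<and> (\<forall>i. M dvd fst (snd r) $ i) \<and> M dvd snd (snd r)
       then of_int M ^ (CARD('m) + 2) else 0)"
proof -
  obtain j k l where r: "r = (j, k, l)" by (cases r)
  let ?I = "{- int K..int K}"
  let ?e = "\<lambda>x. cis (2 * pi * (real_of_int x / real_of_int M))"
  have s: "?e (pairing (q, a, b) r) = ?e (q * l) * ((\<Prod>i\<in>UNIV. ?e (a $ i * - k $ i)) * ?e (b * j))" for q a b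
  proof -
    have "(\<Prod>i\<in>UNIV. ?e (a $ i * - k $ i)) = cis (\<Sum>i\<in>UNIV. 2 * pi * (real_of_int (a $ i * - k $ i) / real_of_int M))"
      by (simp add: cis_conv_exp exp_sum sum_distrib_left)
    also have "(\<Sum>i\<in>UNIV. 2 * pi * (real_of_int (a $ i * - k $ i) / real_of_int M))
       = 2 * pi * (- (\<Sum>i\<in>UNIV. real_of_int (a $ i * k $ i)) / real_of_int M)"
      by (simp add: sum_distrib_left sum_divide_distrib sum_negf)
    finally show ?thesis
      by (simp add: r cis_mult algebra_simps add_divide_distrib diff_divide_distrib)
  qed
  have "(\<Sum>\<mu>\<in>cube K. ?e (pairing \<mu> r)) =
     (\<Sum>q\<in>?I. \<Sum>a | \<forall>i. a $ i \<in> ?I. \<Sum>b\<in>?I. ?e (q * l) * ((\<Prod>i\<in>UNIV. ?e (a $ i * - k $ i)) * ?e (b * j)))"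
    unfolding cube_def by (simp only: sum.cartesian_product' s)
  also have "\<dots> = (\<Sum>q\<in>?I. ?e (q * l)) * ((\<Sum>a | \<forall>i. a $ i \<in> ?I. \<Prod>i\<in>UNIV. ?e (a $ i * - k $ i)) * (\<Sum>b\<in>?I. ?e (b * j)))"
    by (simp only: sum_distrib_left[symmetric] sum_distrib_right[symmetric])
  also have "(\<Sum>a | \<forall>i. a $ i \<in> ?I. \<Prod>i\<in>UNIV. ?e (a $ i * - k $ i)) = (\<Prod>i\<in>UNIV. \<Sum>x\<in>?I. ?e (x * - k $ i))"
    by (rule sum_vec_prod) auto
  also have "\<dots> = (\<Prod>i\<in>UNIV. if M dvd k $ i then of_int M else 0)"
    by (simp only: sum_cis_period M_def dvd_minus_iff)
  also have "\<dots> = (if \<forall>i. M dvd k $ i then of_int M ^ CARD('m) else 0)"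
    by (auto intro!: prod_zero)
  finally show ?thesis
    unfolding M_def sum_cis_period by (auto simp: r)
qed

lemma cos_ge_half:
  assumes "\<bar>t\<bar> \<le> 1 / 6"
  shows "cos (2 * pi * t) \<ge> 1 / 2"
proof -
  have "cos (pi / 3) \<le> cos \<bar>2 * pi * t\<bar>"
    using assms by (intro cos_monotone_0_pi_le) (auto simp: abs_mult)
  then show ?thesis by (simp add: cos_60)
qed

text \<open>A large sieve argument on the group of residues modulo \<open>M\<close>. At each point
  of \<open>S\<close> the exponential sum over \<open>R\<close> has modulus at least
  \<open>card R / 2\<close>, because all its phases lie within a sixth of a turn from
  \<open>0\<close>. Its mean square over the whole cube counts the pairs of \<open>R\<close> that
  are congruent modulo \<open>M\<close>, and such a pair is recovered from its first member and a
  quotient in \<open>D\<close>.\<close>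

lemma bessel_cube:
  fixes K :: nat and S R D :: "(int \<times> (int ^ 'm::finite) \<times> int) set"
  defines "M \<equiv> 2 * int K + 1"
  assumes "finite R" "S \<subseteq> cube K" "finite D"
    and D: "\<And>j k l j' k' l' j0 k0 l0. (j, k, l) \<in> R \<Longrightarrow> (j', k', l') \<in> R \<Longrightarrow> j - j' = M * j0 \<Longrightarrow>
      (\<And>i. k $ i - k' $ i = M * k0 $ i) \<Longrightarrow> l - l' = M * l0 \<Longrightarrow> (j0, k0, l0) \<in> D"
    and small: "\<And>\<mu> r. \<mu> \<in> S \<Longrightarrow> r \<in> R \<Longrightarrow> 6 * \<bar>pairing \<mu> r\<bar> \<le> M"
  shows "real (card S) * real (card R) \<le> 4 * real_of_int M ^ (CARD('m) + 2) * real (card D)"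
proof -
  let ?e = "\<lambda>x. cis (2 * pi * (real_of_int x / real_of_int M))"
  define F where "F = (\<lambda>\<mu>. \<Sum>r\<in>R. ?e (pairing \<mu> r))"
  define P where "P = {(r, r') \<in> R \<times> R. M dvd fst r - fst r' \<and>
    (\<forall>i. M dvd fst (snd r) $ i - fst (snd r') $ i) \<and> M dvd snd (snd r) - snd (snd r')}"
  have M: "M > 0" by (simp add: M_def)
  have "F \<mu> * cnj (F \<mu>) = (\<Sum>r\<in>R. \<Sum>r'\<in>R. ?e (pairing \<mu> (r - r')))" for \<mu>
  proof -
    have "pairing \<mu> (r - r') = pairing \<mu> r - pairing \<mu> r'" for r r'
      by (cases \<mu>; cases r; cases r') (simp add: algebra_simps sum_subtractf)
    then show ?thesis
      by (simp add: F_def cnj_sum sum_product cis_cnj cis_mult diff_divide_distrib right_diff_distrib)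
  qed
  then have "(\<Sum>\<mu>\<in>cube K. F \<mu> * cnj (F \<mu>)) = (\<Sum>\<mu>\<in>cube K. \<Sum>r\<in>R. \<Sum>r'\<in>R. ?e (pairing \<mu> (r - r')))"
    by simp
  also have "\<dots> = (\<Sum>r\<in>R. \<Sum>\<mu>\<in>cube K. \<Sum>r'\<in>R. ?e (pairing \<mu> (r - r')))"
    by (rule sum.swap)
  also have "\<dots> = (\<Sum>r\<in>R. \<Sum>r'\<in>R. \<Sum>\<mu>\<in>cube K. ?e (pairing \<mu> (r - r')))"
    by (rule sum.cong[OF refl], rule sum.swap)
  also have "\<dots> = (\<Sum>r\<in>R. \<Sum>r'\<in>R. if (r, r') \<in> P then of_int M ^ (CARD('m) + 2) else 0)"
    unfolding M_def sum_cube_character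
    by (intro sum.cong refl if_cong) (auto simp: P_def M_def)
  also have "\<dots> = (\<Sum>p\<in>R \<times> R. if p \<in> P then of_int M ^ (CARD('m) + 2) else 0)"
    by (simp add: sum.cartesian_product case_prod_unfold)
  also have "\<dots> = (\<Sum>p\<in>P. of_int M ^ (CARD('m) + 2))"
    by (rule sum.mono_neutral_cong_right) (use \<open>finite R\<close> in \<open>auto simp: P_def\<close>)
  finally have "(\<Sum>\<mu>\<in>cube K. F \<mu> * cnj (F \<mu>)) = of_nat (card P) * of_int M ^ (CARD('m) + 2)"
    by simp
  moreover have "(\<Sum>\<mu>\<in>cube K. F \<mu> * cnj (F \<mu>)) = of_real (\<Sum>\<mu>\<in>cube K. (cmod (F \<mu>))\<^sup>2)"
    by (simp only: of_real_sum complex_norm_square)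
  ultimately have "of_real (\<Sum>\<mu>\<in>cube K. (cmod (F \<mu>))\<^sup>2) = (of_real (real (card P) * real_of_int M ^ (CARD('m) + 2)) :: complex)"
    by simp
  then have parseval: "(\<Sum>\<mu>\<in>cube K. (cmod (F \<mu>))\<^sup>2) = real (card P) * real_of_int M ^ (CARD('m) + 2)"
    using of_real_eq_iff by blast
  have "card P \<le> card (R \<times> D)"
  proof (rule card_inj_on_le[where f = "\<lambda>((j, k, l), (j', k', l')). ((j, k, l), ((j - j') div M, (\<chi> i. (k $ i - k' $ i) div M), (l - l') div M))"])
    show "inj_on (\<lambda>((j, k, l), (j', k', l')). ((j, k, l), ((j - j') div M, (\<chi> i. (k $ i - k' $ i) div M), (l - l') div M))) P"
    proof (rule inj_onI)
      fix s t assume st: "s \<in> P" "t \<in> P"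
        and eq: "(\<lambda>((j, k, l), (j', k', l')). ((j, k, l), ((j - j') div M, (\<chi> i. (k $ i - k' $ i) div M), (l - l') div M))) s
          = (\<lambda>((j, k, l), (j', k', l')). ((j, k, l), ((j - j') div M, (\<chi> i. (k $ i - k' $ i) div M), (l - l') div M))) t"
      obtain j k l j' k' l' where s: "s = ((j, k, l), (j', k', l'))" by (cases s) auto
      obtain j1 k1 l1 j2 k2 l2 where t: "t = ((j1, k1, l1), (j2, k2, l2))" by (cases t) auto
      have inj: "a = b" if "(c - a) div M = (c - b) div M" "M dvd c - a" "M dvd c - b" for a b c :: int
        using that M by (metis diff_left_imp_eq dvd_mult_div_cancel)
      have e1: "j1 = j" "k1 = k" "l1 = l" "(j - j') div M = (j - j2) div M" "(l - l') div M = (l - l2) div M"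
        using eq by (auto simp: s t)
      have e2: "(k $ i - k' $ i) div M = (k $ i - k2 $ i) div M" for i
        using eq by (auto simp: s t vec_eq_iff)
      have "j' = j2" "l' = l2" using inj[OF e1(4)] inj[OF e1(5)] st e1(1,3) by (auto simp: s t P_def)
      moreover have "k' = k2"
        unfolding vec_eq_iff using inj[OF e2] st e1(2) by (auto simp: s t P_def)
      ultimately show "s = t" using e1 by (simp add: s t)
    qed
    show "(\<lambda>((j, k, l), (j', k', l')). ((j, k, l), ((j - j') div M, (\<chi> i. (k $ i - k' $ i) div M), (l - l') div M))) ` P \<subseteq> R \<times> D"
    proof
      fix s assume "s \<in> (\<lambda>((j, k, l), (j', k', l')). ((j, k, l), ((j - j') div M, (\<chi> i. (k $ i - k' $ i) div M), (l - l') div M))) ` P"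
      then obtain j k l j' k' l' where p: "((j, k, l), (j', k', l')) \<in> P"
        and s: "s = ((j, k, l), ((j - j') div M, (\<chi> i. (k $ i - k' $ i) div M), (l - l') div M))" by auto
      show "s \<in> R \<times> D"
        unfolding s using p by (auto simp: P_def intro!: D[of j k l j' k' l'])
    qed
    show "finite (R \<times> D)" using assms by simp
  qed
  then have cP: "real (card P) \<le> real (card R) * real (card D)"
    by (metis card_cartesian_product of_nat_le_iff of_nat_mult)
  have big: "real (card R) / 2 \<le> cmod (F \<mu>)" if "\<mu> \<in> S" for \<mu>
  proof -
    have "real (card R) / 2 = (\<Sum>r\<in>R. 1 / 2)" by simp
    also have "\<dots> \<le> (\<Sum>r\<in>R. Re (?e (pairing \<mu> r)))"
    proof (intro sum_mono)
      fix r assume "r \<in> R"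
      then have "real_of_int (6 * \<bar>pairing \<mu> r\<bar>) \<le> real_of_int M" using small[OF that] by presburger
      then have "\<bar>real_of_int (pairing \<mu> r) / real_of_int M\<bar> \<le> 1 / 6" using M by (simp add: field_simps)
      then show "1 / 2 \<le> Re (?e (pairing \<mu> r))" using cos_ge_half[of "real_of_int (pairing \<mu> r) / real_of_int M"] by simp
    qed
    also have "\<dots> = Re (F \<mu>)" by (simp add: F_def)
    also have "\<dots> \<le> cmod (F \<mu>)" by (rule complex_Re_le_cmod)
    finally show ?thesis .
  qed
  have "real (card S) * (real (card R) / 2)\<^sup>2 = (\<Sum>\<mu>\<in>S. (real (card R) / 2)\<^sup>2)" by simp
  also have "\<dots> \<le> (\<Sum>\<mu>\<in>S. (cmod (F \<mu>))\<^sup>2)" by (intro sum_mono power_mono big) auto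
  also have "\<dots> \<le> (\<Sum>\<mu>\<in>cube K. (cmod (F \<mu>))\<^sup>2)" by (intro sum_mono2 finite_cube assms) auto
  also have "\<dots> \<le> real (card R) * real (card D) * real_of_int M ^ (CARD('m) + 2)"
    unfolding parseval by (intro mult_right_mono cP) (use M in auto)
  finally have "real (card R) * (real (card S) * real (card R)) \<le> real (card R) * (4 * real_of_int M ^ (CARD('m) + 2) * real (card D))"
    by (simp add: power2_eq_square algebra_simps)
  then show ?thesis
    by (cases "card R = 0") (use M in auto)
qed

section \<open>Polarity of sheared boxes\<close>

lemma finite_subset_cube:
  assumes "finite S"
  shows "\<exists>K0. \<forall>K\<ge>K0. S \<subseteq> cube K"
  using assms
proof (induction S)
  case (insert \<mu> S)
  obtain K0 where K0: "\<And>K. K \<ge> K0 \<Longrightarrow> S \<subseteq> cube K" using insert.IH by blast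
  obtain q a b where \<mu>: "\<mu> = (q, a, b)" by (cases \<mu>)
  define K1 where "K1 = nat (\<bar>q\<bar> + \<bar>b\<bar> + (\<Sum>i\<in>UNIV. \<bar>a $ i\<bar>))"
  have a: "\<bar>a $ i\<bar> \<le> (\<Sum>i\<in>UNIV. \<bar>a $ i\<bar>)" for i
    by (intro member_le_sum) auto
  have n: "(\<Sum>i\<in>UNIV. \<bar>a $ i\<bar>) \<ge> 0" by (intro sum_nonneg) auto
  have "\<mu> \<in> cube K" if "K \<ge> K1" for K
  proof -
    have K: "int K \<ge> \<bar>q\<bar> + \<bar>b\<bar> + (\<Sum>i\<in>UNIV. \<bar>a $ i\<bar>)" using that by (simp add: K1_def)
    have "a $ i \<in> {- int K..int K}" for i using K a[of i] by auto 
    moreover have "\<bar>q\<bar> \<le> int K" "\<bar>b\<bar> \<le> int K" using K n by linarith+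
    ultimately show ?thesis by (auto simp: cube_def \<mu> abs_le_iff)
  qed
  then show ?case using K0 by (intro exI[of _ "max K0 K1"]) auto
qed auto

text \<open>The sheared coordinates of the first point for \<open>(\<xi>, \<eta>, \<omega>)\<close>
  meet those of the second for \<open>(\<eta>, \<xi>, \<xi> \<bullet> \<eta> - \<omega>)\<close>.
  Point and slope are exchanged and the height undergoes the Legendre transform, which is why polar
  boxes belong to the dual hypersurface.\<close>

lemma pairing_eq:
  fixes \<xi> \<eta> :: "real ^ 'm::finite"
  shows "real_of_int (pairing (q, a, b) (j, k, l)) =
    real_of_int q * (real_of_int l - real_of_int j * (\<xi> \<bullet> \<eta> - \<omega>) - \<xi> \<bullet> (rvec k - real_of_int j *\<^sub>R \<eta>))
    - (rvec a - real_of_int q *\<^sub>R \<xi>) \<bullet> (rvec k - real_of_int j *\<^sub>R \<eta>)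
    + real_of_int j * (real_of_int b - real_of_int q * \<omega> - \<eta> \<bullet> (rvec a - real_of_int q *\<^sub>R \<xi>))"
proof -
  have "real_of_int (\<Sum>i\<in>UNIV. a $ i * k $ i) = rvec a \<bullet> rvec k"
    by (simp add: inner_vec_def)
  then show ?thesis
    by (simp add: inner_diff_left inner_diff_right inner_commute algebra_simps)
qed

text \<open>Provides the set \<open>D\<close> for \<open>bessel_cube\<close>: the defining forms are
  linear, so a difference of two points doubles the tolerances and the quotient by \<open>M\<close>
  divides them.\<close>

lemma lbox_diff:
  fixes \<xi> \<eta> :: "real ^ 'm::finite"
  assumes "(j, k, l) \<in> lbox \<xi> \<eta> \<omega> X \<rho> \<delta>" "(j', k', l') \<in> lbox \<xi> \<eta> \<omega> X \<rho> \<delta>"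
    and M: "M > 0"
    and eq: "j - j' = M * j0" "\<And>i. k $ i - k' $ i = M * k0 $ i" "l - l' = M * l0"
  shows "(j0, k0, l0) \<in> lbox \<xi> \<eta> \<omega> (2 * X / M) (2 * \<rho> / M) (2 * \<delta> / M)"
proof -
  let ?M = "real_of_int M"
  define v v' v0 where "v = rvec k - real_of_int j *\<^sub>R \<xi>" and "v' = rvec k' - real_of_int j' *\<^sub>R \<xi>"
    and "v0 = rvec k0 - real_of_int j0 *\<^sub>R \<xi>"
  have M': "?M > 0" using M by simp
  have j: "real_of_int j - real_of_int j' = ?M * real_of_int j0"
    and l: "real_of_int l - real_of_int l' = ?M * real_of_int l0"
    using arg_cong[OF eq(1), of real_of_int] arg_cong[OF eq(3), of real_of_int] by simp_all
  have "real_of_int (k $ i) - real_of_int (k' $ i) = ?M * real_of_int (k0 $ i)" for i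
    using arg_cong[OF eq(2), of real_of_int] by simp
  then have k: "rvec k - rvec k' = ?M *\<^sub>R rvec k0" by (simp add: vec_eq_iff)
  have v: "v - v' = ?M *\<^sub>R v0"
  proof -
    have "v - v' = (rvec k - rvec k') - (real_of_int j - real_of_int j') *\<^sub>R \<xi>"
      by (simp add: v_def v'_def algebra_simps)
    then show ?thesis unfolding j k by (simp add: v0_def algebra_simps)
  qed
  have h: "\<bar>real_of_int j\<bar> \<le> X" "norm v \<le> \<rho>" "\<bar>real_of_int l - real_of_int j * \<omega> - \<eta> \<bullet> v\<bar> \<le> \<delta>"
    "\<bar>real_of_int j'\<bar> \<le> X" "norm v' \<le> \<rho>" "\<bar>real_of_int l' - real_of_int j' * \<omega> - \<eta> \<bullet> v'\<bar> \<le> \<delta>"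
    using assms(1,2) by (auto simp: lbox_def v_def v'_def)
  have "?M * \<bar>real_of_int j0\<bar> \<le> 2 * X"
  proof -
    have "?M * \<bar>real_of_int j0\<bar> = \<bar>real_of_int j - real_of_int j'\<bar>"
      unfolding j using M' by (simp add: abs_mult)
    then show ?thesis using h(1,4) by linarith
  qed
  moreover have "?M * norm v0 \<le> 2 * \<rho>"
  proof -
    have "norm (?M *\<^sub>R v0) \<le> norm v + norm v'" unfolding v[symmetric] by (rule norm_triangle_ineq4)
    then show ?thesis using h M' by simp
  qed
  moreover have "?M * \<bar>real_of_int l0 - real_of_int j0 * \<omega> - \<eta> \<bullet> v0\<bar> \<le> 2 * \<delta>"
  proof -
    have "?M * (real_of_int l0 - real_of_int j0 * \<omega> - \<eta> \<bullet> v0)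
        = ?M * real_of_int l0 - (?M * real_of_int j0) * \<omega> - \<eta> \<bullet> (?M *\<^sub>R v0)"
      by (simp add: algebra_simps)
    also have "\<dots> = (real_of_int l - real_of_int j * \<omega> - \<eta> \<bullet> v) - (real_of_int l' - real_of_int j' * \<omega> - \<eta> \<bullet> v')"
      unfolding v[symmetric] j[symmetric] l[symmetric] by (simp add: algebra_simps)
    finally have "\<bar>?M * (real_of_int l0 - real_of_int j0 * \<omega> - \<eta> \<bullet> v0)\<bar> \<le> 2 * \<delta>"
      using h(3,6) by linarith
    then show ?thesis using M' by (simp add: abs_mult)
  qed
  ultimately show ?thesis
    using M' by (simp add: lbox_def v0_def field_simps)
qed

text \<open>Here \<open>R\<close> consists of the integer points of the polar box dilated by
  \<open>M / 18\<close>. As \<open>M\<close> is large, \<open>R\<close> has at least a constant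
  times as many points as its volume predicts, so the powers of \<open>M\<close> in
  \<open>bessel_cube\<close> cancel. Working with finite \<open>M\<close> replaces Poisson summation
  with a smooth weight.\<close>

lemma lbox_transference:
  fixes \<xi> \<eta> :: "real ^ 'm::finite" and X \<rho> \<delta> \<omega> :: real
  assumes pos: "X > 0" "\<rho> > 0" "\<delta> > 0"
  shows "real (card (lbox \<xi> \<eta> \<omega> X \<rho> \<delta>)) \<le> 4 * 18 ^ (CARD('m) + 2) * real CARD('m) ^ CARD('m) *
    (X * \<rho> ^ CARD('m) * \<delta>) *
    real (card (lbox \<eta> \<xi> (\<xi> \<bullet> \<eta> - \<omega>) (1 / (9 * \<delta>)) (1 / (9 * \<rho>)) (1 / (9 * X))))"
proof -
  let ?S = "lbox \<xi> \<eta> \<omega> X \<rho> \<delta>"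
  let ?D = "lbox \<eta> \<xi> (\<xi> \<bullet> \<eta> - \<omega>) (1 / (9 * \<delta>)) (1 / (9 * \<rho>)) (1 / (9 * X))"
  define m where "m = real CARD('m)"
  have m: "m \<ge> 1" by (simp add: m_def Suc_le_eq)
  have finS: "finite ?S" using pos by (intro lbox_trivial) auto
  obtain K0 where K0: "\<And>K. K \<ge> K0 \<Longrightarrow> ?S \<subseteq> cube K" using finite_subset_cube[OF finS] by blast
  \<comment> \<open>Since \<open>54 = 3 * 18\<close>, the sides of the dilated polar box reach the
    lower limits \<open>3\<close> and \<open>3 * CARD('m)\<close> of
    \<open>lbox_card_ge\<close>.\<close>
  obtain K1 :: nat where K1: "real K1 \<ge> 54 * (X + m * \<rho> + \<delta>)" using real_arch_simple by blast
  define K where "K = max K0 K1"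
  define M where "M = real_of_int (2 * int K + 1)"
  have M: "M \<ge> 54 * (X + m * \<rho> + \<delta>)" "M > 0" using K1 by (auto simp: M_def K_def)
  let ?R = "lbox \<eta> \<xi> (\<xi> \<bullet> \<eta> - \<omega>) (M / (18 * \<delta>)) (M / (18 * \<rho>)) (M / (18 * X))"
  have mp: "m * \<rho> > 0" using m pos by simp
  have b1: "M / (18 * \<delta>) \<ge> 3" "M / (18 * X) \<ge> 3" using M pos mp by (simp_all add: field_simps)
  have b2: "M / (18 * \<rho>) \<ge> 3 * CARD('m)" using M pos mp by (simp add: field_simps m_def)
  have cR: "M / (18 * \<delta>) * (M / (18 * \<rho>) / m) ^ CARD('m) * (M / (18 * X)) \<le> real (card ?R)"
    unfolding m_def by (rule lbox_card_ge) (use b1 b2 in auto)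
  have "real (card ?S) * real (card ?R) \<le> 4 * M ^ (CARD('m) + 2) * real (card ?D)"
    unfolding M_def
  proof (rule bessel_cube)
    show "finite (lbox \<eta> \<xi> (\<xi> \<bullet> \<eta> - \<omega>) (real_of_int (2 * int K + 1) / (18 * \<delta>)) (real_of_int (2 * int K + 1) / (18 * \<rho>))
       (real_of_int (2 * int K + 1) / (18 * X)))" using pos by (intro lbox_trivial) auto
    show "finite ?D" using pos by (intro lbox_trivial) auto
    show "?S \<subseteq> cube K" by (rule K0) (simp add: K_def)
  next
    fix j k l j' k' l' j0 k0 l0
    assume h: "(j, k, l) \<in> lbox \<eta> \<xi> (\<xi> \<bullet> \<eta> - \<omega>) (real_of_int (2 * int K + 1) / (18 * \<delta>)) (real_of_int (2 * int K + 1) / (18 * \<rho>))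
         (real_of_int (2 * int K + 1) / (18 * X))"
       "(j', k', l') \<in> lbox \<eta> \<xi> (\<xi> \<bullet> \<eta> - \<omega>) (real_of_int (2 * int K + 1) / (18 * \<delta>)) (real_of_int (2 * int K + 1) / (18 * \<rho>))
         (real_of_int (2 * int K + 1) / (18 * X))"
       "j - j' = (2 * int K + 1) * j0" "\<And>i. k $ i - k' $ i = (2 * int K + 1) * k0 $ i" "l - l' = (2 * int K + 1) * l0"
    \<comment> \<open>The \<open>9\<close> is half of \<open>18\<close>, because differences double
      the tolerances.\<close>
    have e: "2 * (M / (18 * z)) / M = 1 / (9 * z)" for z using M by (simp add: field_simps)
    show "(j0, k0, l0) \<in> ?D"
      using lbox_diff[OF h(1,2) _ h(3-5)] unfolding M_def[symmetric] e by simp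
  next
    fix \<mu> r assume \<mu>r: "\<mu> \<in> ?S" "r \<in> lbox \<eta> \<xi> (\<xi> \<bullet> \<eta> - \<omega>) (real_of_int (2 * int K + 1) / (18 * \<delta>))
        (real_of_int (2 * int K + 1) / (18 * \<rho>)) (real_of_int (2 * int K + 1) / (18 * X))"
    obtain q a b j k l where e: "\<mu> = (q, a, b)" "r = (j, k, l)" by (cases \<mu>; cases r)
    define A B C where "A = real_of_int l - real_of_int j * (\<xi> \<bullet> \<eta> - \<omega>) - \<xi> \<bullet> (rvec k - real_of_int j *\<^sub>R \<eta>)"
      and "B = (rvec a - real_of_int q *\<^sub>R \<xi>) \<bullet> (rvec k - real_of_int j *\<^sub>R \<eta>)"
      and "C = real_of_int b - real_of_int q * \<omega> - \<eta> \<bullet> (rvec a - real_of_int q *\<^sub>R \<xi>)"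
    have h: "\<bar>real_of_int q\<bar> \<le> X" "norm (rvec a - real_of_int q *\<^sub>R \<xi>) \<le> \<rho>" "\<bar>C\<bar> \<le> \<delta>"
        "\<bar>real_of_int j\<bar> \<le> M / (18 * \<delta>)" "norm (rvec k - real_of_int j *\<^sub>R \<eta>) \<le> M / (18 * \<rho>)" "\<bar>A\<bar> \<le> M / (18 * X)"
      using \<mu>r unfolding e A_def C_def M_def[symmetric] by (auto simp: lbox_def)
    \<comment> \<open>Each of the three terms of \<open>pairing_eq\<close> is at most
      \<open>M / 18\<close>; together they stay below the \<open>M / 6\<close> that
      \<open>bessel_cube\<close> allows.\<close>
    have "\<bar>real_of_int q * A\<bar> \<le> X * (M / (18 * X))"
      unfolding abs_mult by (intro mult_mono h) (use pos in auto)
    moreover have "\<bar>B\<bar> \<le> \<rho> * (M / (18 * \<rho>))"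
      unfolding B_def by (rule order_trans[OF Cauchy_Schwarz_ineq2], intro mult_mono h) (use pos in auto)
    moreover have "\<bar>real_of_int j * C\<bar> \<le> M / (18 * \<delta>) * \<delta>"
      unfolding abs_mult by (intro mult_mono h) (use pos M in auto)
    moreover have "real_of_int (pairing \<mu> r) = real_of_int q * A - B + real_of_int j * C"
      unfolding e pairing_eq[of q a b j k l \<xi> \<eta> \<omega>] A_def B_def C_def ..
    moreover have "X * (M / (18 * X)) = M / 18" "\<rho> * (M / (18 * \<rho>)) = M / 18" "M / (18 * \<delta>) * \<delta> = M / 18"
      using pos by simp_all
    ultimately have "6 * \<bar>real_of_int (pairing \<mu> r)\<bar> \<le> M" by linarith
    then have "real_of_int (6 * \<bar>pairing \<mu> r\<bar>) \<le> real_of_int (2 * int K + 1)" unfolding M_def by simp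
    then show "6 * \<bar>pairing \<mu> r\<bar> \<le> 2 * int K + 1" by linarith
  qed
  moreover have "real (card ?S) * (M / (18 * \<delta>) * (M / (18 * \<rho>) / m) ^ CARD('m) * (M / (18 * X))) \<le> real (card ?S) * real (card ?R)"
    by (rule mult_left_mono[OF cR]) simp
  ultimately have "real (card ?S) * (M / (18 * \<delta>) * (M / (18 * \<rho>) / m) ^ CARD('m) * (M / (18 * X))) \<le> 4 * M ^ (CARD('m) + 2) * real (card ?D)"
    by linarith
  moreover have "M / (18 * \<delta>) * (M / (18 * \<rho>) / m) ^ CARD('m) * (M / (18 * X))
     = M ^ (CARD('m) + 2) / (18 ^ (CARD('m) + 2) * m ^ CARD('m) * (X * \<rho> ^ CARD('m) * \<delta>))"
    by (simp add: power_divide power_mult_distrib power_add power2_eq_square field_simps)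
  ultimately have "M ^ (CARD('m) + 2) * real (card ?S) \<le> M ^ (CARD('m) + 2) * (4 * 18 ^ (CARD('m) + 2) * m ^ CARD('m) *
    (X * \<rho> ^ CARD('m) * \<delta>) * real (card ?D))"
    using pos m by (simp add: field_simps)
  then show ?thesis using M unfolding m_def by simp
qed

section \<open>Hypersurfaces and their Legendre transforms\<close>

definition cell :: "real \<Rightarrow> real ^ 'm \<Rightarrow> int ^ 'm::finite" where
  "cell \<tau> x = (\<chi> i. \<lfloor>x $ i / \<tau>\<rfloor>)"

lemma card_cells_ball:
  fixes z :: "real ^ 'm::finite"
  assumes "\<tau> > 0" "r \<ge> 0" "\<And>x. x \<in> S \<Longrightarrow> norm (x - z) \<le> r"
  shows "finite (cell \<tau> ` S)" and "real (card (cell \<tau> ` S)) \<le> (2 * r / \<tau> + 2) ^ CARD('m)"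
proof -
  let ?I = "\<lambda>i. {\<lfloor>(z $ i - r) / \<tau>\<rfloor>..\<lfloor>(z $ i + r) / \<tau>\<rfloor>}"
  let ?B = "{c :: int ^ 'm. \<forall>i. c $ i \<in> ?I i}"
  have sub: "cell \<tau> ` S \<subseteq> ?B"
  proof
    fix c assume "c \<in> cell \<tau> ` S"
    then obtain x where x: "x \<in> S" "c = cell \<tau> x" by auto
    have "c $ i \<in> ?I i" for i
    proof -
      have "\<bar>(x - z) $ i\<bar> \<le> r" using component_le_norm_cart[of "x - z" i] assms(3)[OF x(1)] by linarith
      then have "(z $ i - r) / \<tau> \<le> x $ i / \<tau>" "x $ i / \<tau> \<le> (z $ i + r) / \<tau>"
        using assms(1) by (auto intro!: divide_right_mono)
      then show ?thesis using floor_mono by (auto simp: x(2) cell_def)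
    qed
    then show "c \<in> ?B" by simp
  qed
  have fB: "finite ?B" by (rule finite_vec_set) auto
  show "finite (cell \<tau> ` S)" by (rule finite_subset[OF sub fB])
  have I: "real (card (?I i)) \<le> 2 * r / \<tau> + 2" for i
  proof -
    have "(z $ i + r) / \<tau> = (z $ i - r) / \<tau> + 2 * r / \<tau>" using assms(1) by (simp add: field_simps)
    moreover have "2 * r / \<tau> \<ge> 0" using assms by simp
    ultimately show ?thesis by simp linarith
  qed
  have "real (card (cell \<tau> ` S)) \<le> real (card ?B)" by (intro of_nat_mono card_mono fB sub)
  also have "\<dots> = (\<Prod>i\<in>UNIV. real (card (?I i)))" by (subst card_vec_set) simp
  also have "\<dots> \<le> (\<Prod>i\<in>(UNIV :: 'm set). 2 * r / \<tau> + 2)" by (intro prod_mono conjI I) auto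
  finally show "real (card (cell \<tau> ` S)) \<le> (2 * r / \<tau> + 2) ^ CARD('m)" by simp
qed

lemma cell_eq_dist:
  fixes x y :: "real ^ 'm::finite"
  assumes "\<tau> > 0" "cell \<tau> x = cell \<tau> y"
  shows "norm (x - y) \<le> real CARD('m) * \<tau>"
proof (rule norm_le_card_bound)
  fix i
  have "\<lfloor>x $ i / \<tau>\<rfloor> = \<lfloor>y $ i / \<tau>\<rfloor>" using assms(2) by (simp add: cell_def vec_eq_iff)
  then have "\<bar>x $ i / \<tau> - y $ i / \<tau>\<bar> \<le> 1" by linarith
  then show "\<bar>(x - y) $ i\<bar> \<le> \<tau>"
    using assms(1) by (simp add: diff_divide_distrib[symmetric] field_simps)
qed

text \<open>Double counting of incidences, with \<open>K\<close> bounding the multiplicity of the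
  overlap.\<close>

lemma sum_card_le:
  assumes "finite I" "finite B" "\<And>c. c \<in> I \<Longrightarrow> E c \<subseteq> B"
    and "\<And>\<mu>. \<mu> \<in> B \<Longrightarrow> real (card {c \<in> I. \<mu> \<in> E c}) \<le> K"
  shows "(\<Sum>c\<in>I. real (card (E c))) \<le> K * real (card B)"
proof -
  have "(\<Sum>c\<in>I. real (card (E c))) = (\<Sum>c\<in>I. \<Sum>\<mu>\<in>B. if \<mu> \<in> E c then 1 else 0)"
  proof (rule sum.cong[OF refl])
    fix c assume "c \<in> I"
    then have "E c = {\<mu> \<in> B. \<mu> \<in> E c}" using assms(3) by auto
    then have "real (card (E c)) = (\<Sum>\<mu>\<in>{\<mu> \<in> B. \<mu> \<in> E c}. 1)" by simp
    then show "real (card (E c)) = (\<Sum>\<mu>\<in>B. if \<mu> \<in> E c then 1 else 0)"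
      by (simp add: sum.inter_filter[symmetric, OF assms(2)])
  qed
  also have "\<dots> = (\<Sum>\<mu>\<in>B. \<Sum>c\<in>I. if \<mu> \<in> E c then 1 else 0)" by (rule sum.swap)
  also have "\<dots> = (\<Sum>\<mu>\<in>B. real (card {c \<in> I. \<mu> \<in> E c}))"
    using assms(1) by (simp add: sum.inter_filter[symmetric])
  also have "\<dots> \<le> (\<Sum>\<mu>\<in>B. K)" by (intro sum_mono assms(4))
  finally show ?thesis by (simp add: mult.commute)
qed

text \<open>A set of contact elements: \<open>y\<close> is the gradient of the hypersurface \<open>x \<mapsto> u\<close>, and
  \<open>v\<close> is its Legendre transform, so that exchanging \<open>(x, u)\<close> with \<open>(y, v)\<close> gives the dual
  hypersurface.\<close>

locale legendre =
  fixes L :: real and T :: "'a set" and x y :: "'a \<Rightarrow> real ^ 'm::finite" and u v :: "'a \<Rightarrow> real"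
  assumes L: "L \<ge> 1"
    and norm_x: "p \<in> T \<Longrightarrow> norm (x p) \<le> L" and norm_y: "p \<in> T \<Longrightarrow> norm (y p) \<le> L"
    and x_ge: "p \<in> T \<Longrightarrow> 1 \<le> L * norm (x p)" and y_ge: "p \<in> T \<Longrightarrow> 1 \<le> L * norm (y p)"
    and transform: "p \<in> T \<Longrightarrow> u p + v p = x p \<bullet> y p"
    and lip_x: "p \<in> T \<Longrightarrow> p' \<in> T \<Longrightarrow> norm (x p - x p') \<le> L * norm (y p - y p')"
    and lip_y: "p \<in> T \<Longrightarrow> p' \<in> T \<Longrightarrow> norm (y p - y p') \<le> L * norm (x p - x p')"
    and taylor_u: "p \<in> T \<Longrightarrow> p' \<in> T \<Longrightarrow> \<bar>u p - u p' - y p' \<bullet> (x p - x p')\<bar> \<le> L * (norm (x p - x p'))\<^sup>2"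
    and taylor_v: "p \<in> T \<Longrightarrow> p' \<in> T \<Longrightarrow> \<bar>v p - v p' - x p' \<bullet> (y p - y p')\<bar> \<le> L * (norm (y p - y p'))\<^sup>2"
begin

text \<open>The conditions of the locale are stated in pairs that this exchange permutes. Both
  hypersurfaces are parametrised by the same set \<open>T\<close>, so the gradient map never has to
  be inverted.\<close>

lemma dual: "legendre L T y x v u"
  using L norm_x norm_y x_ge y_ge transform lip_x lip_y taylor_u taylor_v
  by unfold_locales (auto simp: inner_commute add.commute)

end

text \<open>Rescaling the domain by \<open>s\<close> and the range by \<open>s * \<sigma>\<close>
  multiplies slopes by \<open>\<sigma>\<close>. For the dual box the roles of \<open>s\<close> and
  \<open>\<sigma>\<close> are exchanged and the product \<open>s * \<sigma>\<close> stays the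
  same.\<close>

definition tbox :: "('a \<Rightarrow> real ^ 'm) \<Rightarrow> ('a \<Rightarrow> real ^ 'm) \<Rightarrow> ('a \<Rightarrow> real) \<Rightarrow> real \<Rightarrow> real \<Rightarrow> real \<Rightarrow> real \<Rightarrow> real \<Rightarrow> 'a
    \<Rightarrow> (int \<times> (int ^ 'm::finite) \<times> int) set" where
  "tbox x y u s \<sigma> X \<rho> \<delta> p = lbox (s *\<^sub>R x p) (\<sigma> *\<^sub>R y p) (s * \<sigma> * u p) X \<rho> \<delta>"

lemma finite_tbox:
  "X \<ge> 0 \<Longrightarrow> \<rho> \<ge> 0 \<Longrightarrow> \<delta> \<ge> 0 \<Longrightarrow> finite (tbox x y u s \<sigma> X \<rho> \<delta> p)"
  unfolding tbox_def by (rule lbox_trivial)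

text \<open>Integer points near the hypersurface \<open>x \<mapsto> u\<close> rescaled by \<open>s\<close> in the domain and
  by \<open>s * \<sigma>\<close> in the range. The tolerance \<open>1 / 2\<close> makes the notion stable under duality, and
  \<open>a \<noteq> 0\<close> forces \<open>Q * s\<close> to be bounded away from \<open>0\<close>.\<close>

definition near_points :: "'a set \<Rightarrow> ('a \<Rightarrow> real ^ 'm) \<Rightarrow> ('a \<Rightarrow> real ^ 'm) \<Rightarrow> ('a \<Rightarrow> real) \<Rightarrow>
    real \<Rightarrow> real \<Rightarrow> real \<Rightarrow> real \<Rightarrow> (int \<times> (int ^ 'm::finite) \<times> int) set" where
  "near_points T x y u s \<sigma> \<delta> Q = {(q, a, b). Q \<le> real_of_int q \<and> real_of_int q < 2 * Q \<and> a \<noteq> 0 \<and>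
     (\<exists>p\<in>T. (q, a, b) \<in> tbox x y u s \<sigma> (2 * Q) (1 / 2) \<delta> p)}"

section \<open>Covering near points by tangent boxes\<close>

context legendre
begin

text \<open>The enlargements have three sources: the centre moves by
  \<open>q * s * (x p - x p')\<close>, the hypersurface curves away from its tangent plane, and the
  plane itself turns by at most \<open>\<sigma> * L * h\<close>, acting on an offset of size
  \<open>\<rho>\<close>.\<close>

lemma tbox_shift:
  assumes p: "p \<in> T" "p' \<in> T" and h: "norm (x p - x p') \<le> h" and "s \<ge> 0" "\<sigma> \<ge> 0" "X \<ge> 0" "\<rho> \<ge> 0"
    and \<mu>: "\<mu> \<in> tbox x y u s \<sigma> X \<rho> \<delta> p"
  shows "\<mu> \<in> tbox x y u s \<sigma> X (\<rho> + X * s * h) (\<delta> + X * s * \<sigma> * L * h\<^sup>2 + \<sigma> * L * h * \<rho>) p'"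
proof -
  obtain q a b where e: "\<mu> = (q, a, b)" by (cases \<mu>)
  define w w' where "w = rvec a - real_of_int q *\<^sub>R (s *\<^sub>R x p)" and "w' = rvec a - real_of_int q *\<^sub>R (s *\<^sub>R x p')"
  have q: "\<bar>real_of_int q\<bar> \<le> X" and w: "norm w \<le> \<rho>"
    and b: "\<bar>real_of_int b - real_of_int q * (s * \<sigma> * u p) - (\<sigma> *\<^sub>R y p) \<bullet> w\<bar> \<le> \<delta>"
    using \<mu> by (auto simp: e tbox_def lbox_def w_def)
  have h0: "h \<ge> 0" using h norm_ge_zero order_trans by blast
  have w': "w' = w + (real_of_int q * s) *\<^sub>R (x p - x p')" by (simp add: w_def w'_def algebra_simps)
  have "norm w' \<le> norm w + \<bar>real_of_int q\<bar> * s * norm (x p - x p')"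
    unfolding w' using norm_triangle_ineq[of w "(real_of_int q * s) *\<^sub>R (x p - x p')"] assms by (simp add: abs_mult)
  also have "\<dots> \<le> \<rho> + X * s * h"
    by (intro add_mono mult_mono w q h) (use assms in auto)
  finally have n: "norm w' \<le> \<rho> + X * s * h" .
  define A B where "A = u p - u p' - y p' \<bullet> (x p - x p')" and "B = (y p - y p') \<bullet> w"
  have A: "\<bar>A\<bar> \<le> L * h\<^sup>2"
  proof -
    have "\<bar>A\<bar> \<le> L * (norm (x p - x p'))\<^sup>2" unfolding A_def by (rule taylor_u[OF p])
    also have "\<dots> \<le> L * h\<^sup>2" by (intro mult_left_mono power_mono h) (use L in auto)
    finally show ?thesis .
  qed
  have B: "\<bar>B\<bar> \<le> L * h * \<rho>"
  proof -
    have "\<bar>B\<bar> \<le> norm (y p - y p') * norm w" unfolding B_def by (rule Cauchy_Schwarz_ineq2)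
    also have "norm (y p - y p') \<le> L * norm (x p - x p')" by (rule lip_y[OF p])
    also have "\<dots> \<le> L * h" by (intro mult_left_mono h) (use L in auto)
    finally show ?thesis using w h0 L mult_mono[of "L * h" "L * h" "norm w" \<rho>]
      by (smt (verit) mult_right_mono norm_ge_zero mult_nonneg_nonneg)
  qed
  have "real_of_int b - real_of_int q * (s * \<sigma> * u p') - (\<sigma> *\<^sub>R y p') \<bullet> w'
     = (real_of_int b - real_of_int q * (s * \<sigma> * u p) - (\<sigma> *\<^sub>R y p) \<bullet> w) + real_of_int q * (s * \<sigma>) * A + \<sigma> * B"
    unfolding w' A_def B_def by (simp add: algebra_simps)
  moreover have "\<bar>real_of_int q * (s * \<sigma>) * A\<bar> \<le> X * (s * \<sigma>) * (L * h\<^sup>2)"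
    unfolding abs_mult[of _ A] abs_mult[of _ "s * \<sigma>"] using assms
    by (intro mult_mono A q) auto
  moreover have "\<bar>\<sigma> * B\<bar> \<le> \<sigma> * (L * h * \<rho>)"
    unfolding abs_mult using assms B by (intro mult_mono) auto
  ultimately have "\<bar>real_of_int b - real_of_int q * (s * \<sigma> * u p') - (\<sigma> *\<^sub>R y p') \<bullet> w'\<bar>
      \<le> \<delta> + X * s * \<sigma> * L * h\<^sup>2 + \<sigma> * L * h * \<rho>"
    using b by (simp add: algebra_simps)
  then show ?thesis using n q by (simp add: e tbox_def lbox_def w'_def)
qed

lemma cell_representatives: "\<exists>r. \<forall>c\<in>cell \<tau> ` x ` T. r c \<in> T \<and> cell \<tau> (x (r c)) = c"
  by (rule bchoice) auto

lemma finite_cells: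
  assumes "\<tau> > 0"
  shows "finite (cell \<tau> ` x ` T)" and "real (card (cell \<tau> ` x ` T)) \<le> (2 * L / \<tau> + 2) ^ CARD('m)"
proof -
  have "norm (z - 0) \<le> L" if "z \<in> x ` T" for z using that norm_x by auto
  then show "finite (cell \<tau> ` x ` T)" and "real (card (cell \<tau> ` x ` T)) \<le> (2 * L / \<tau> + 2) ^ CARD('m)"
    using card_cells_ball[OF assms, of L "x ` T" 0] L by auto
qed

text \<open>One base point per grid cell is enough, because \<open>\<rho>'\<close> and
  \<open>\<delta>'\<close> are wide enough to absorb a shift by \<open>CARD('m) * \<tau>\<close>,
  which bounds the distance between two points of a cell.\<close>

lemma near_points_cover:
  assumes "\<tau> > 0" "s > 0" "\<sigma> > 0" "Q > 0" "\<delta> > 0"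
    and r: "\<And>c. c \<in> cell \<tau> ` x ` T \<Longrightarrow> r c \<in> T \<and> cell \<tau> (x (r c)) = c"
    and \<rho>: "1 / 2 + 2 * Q * s * (real CARD('m) * \<tau>) \<le> \<rho>'"
    and \<delta>: "\<delta> + 2 * Q * s * \<sigma> * L * (real CARD('m) * \<tau>)\<^sup>2 + \<sigma> * L * (real CARD('m) * \<tau>) * (1 / 2) \<le> \<delta>'"
  shows "near_points T x y u s \<sigma> \<delta> Q \<subseteq> (\<Union>c\<in>cell \<tau> ` x ` T. tbox x y u s \<sigma> (2 * Q) \<rho>' \<delta>' (r c))"
proof
  fix \<mu> assume "\<mu> \<in> near_points T x y u s \<sigma> \<delta> Q"
  then obtain p where p: "p \<in> T" "\<mu> \<in> tbox x y u s \<sigma> (2 * Q) (1 / 2) \<delta> p"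
    by (auto simp: near_points_def)
  let ?c = "cell \<tau> (x p)"
  have c: "?c \<in> cell \<tau> ` x ` T" using p by auto
  have "norm (x p - x (r ?c)) \<le> real CARD('m) * \<tau>"
    using r[OF c] by (intro cell_eq_dist assms) auto
  from tbox_shift[OF p(1) _ this _ _ _ _ p(2)] have
    "\<mu> \<in> tbox x y u s \<sigma> (2 * Q) (1 / 2 + 2 * Q * s * (real CARD('m) * \<tau>))
      (\<delta> + 2 * Q * s * \<sigma> * L * (real CARD('m) * \<tau>)\<^sup>2 + \<sigma> * L * (real CARD('m) * \<tau>) * (1 / 2)) (r ?c)"
    using r[OF c] assms by auto
  then have "\<mu> \<in> tbox x y u s \<sigma> (2 * Q) \<rho>' \<delta>' (r ?c)"
    using lbox_mono[OF order_refl \<rho> \<delta>] unfolding tbox_def by blast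
  then show "\<mu> \<in> (\<Union>c\<in>cell \<tau> ` x ` T. tbox x y u s \<sigma> (2 * Q) \<rho>' \<delta>' (r c))" using c by blast
qed

lemma finite_near_points:
  assumes "s > 0" "\<sigma> > 0" "Q > 0" "\<delta> > 0"
  shows "finite (near_points T x y u s \<sigma> \<delta> Q)"
proof -
  obtain r where r: "\<And>c. c \<in> cell 1 ` x ` T \<Longrightarrow> r c \<in> T \<and> cell 1 (x (r c)) = c"
    using cell_representatives by metis
  have f: "finite (cell 1 ` x ` T)" by (rule finite_cells) simp
  show ?thesis
    by (rule finite_subset[OF near_points_cover[OF zero_less_one assms r order_refl order_refl]])
      (use f assms L in \<open>auto simp del: UN_simps intro!: finite_UN_I[OF f] finite_tbox\<close>)
qed

text \<open>Here \<open>q * s * x p\<close> is shorter than \<open>1 / 2\<close>, and the tolerance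
  \<open>1 / 2\<close> leaves no room for a nonzero integer vector.\<close>

lemma near_points_empty:
  assumes "Q > 0" "s > 0" "4 * L * (Q * s) < 1"
  shows "near_points T x y u s \<sigma> \<delta> Q = {}"
proof (rule equals0I)
  fix \<mu> assume "\<mu> \<in> near_points T x y u s \<sigma> \<delta> Q"
  then obtain q a b p where h: "Q \<le> real_of_int q" "real_of_int q < 2 * Q" "a \<noteq> 0" "p \<in> T"
    "norm (rvec a - real_of_int q *\<^sub>R (s *\<^sub>R x p)) \<le> 1 / 2"
    by (auto simp: near_points_def tbox_def lbox_def)
  have "norm (real_of_int q *\<^sub>R (s *\<^sub>R x p)) = real_of_int q * s * norm (x p)" using h assms by simp
  also have "\<dots> \<le> 2 * Q * s * L"
    using h assms norm_x[OF h(4)] L by (intro mult_mono) auto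
  also have "\<dots> < 1 / 2" using assms by (simp add: algebra_simps)
  finally have "norm (rvec a) < 1"
    using norm_triangle_sub[of "rvec a" "real_of_int q *\<^sub>R (s *\<^sub>R x p)"] h(5) by linarith
  then show False using norm_rvec_ge_1[OF h(3)] by simp
qed

text \<open>Cells of side \<open>1 / (Q * s)\<close> give boxes of bounded width, each with at most
  a constant times \<open>Q * (1 + \<delta>)\<close> points, and there are at most a constant times
  \<open>(Q * s) ^ CARD('m)\<close> cells. This starts the bootstrap.\<close>

lemma near_points_trivial:
  "\<exists>C>0. \<forall>s \<sigma> \<delta> Q. 0 < s \<and> s \<le> 1 \<and> 0 < \<sigma> \<and> \<sigma> \<le> 1 \<and> 0 < \<delta> \<and> 1 \<le> Q \<longrightarrow>
     real (card (near_points T x y u s \<sigma> \<delta> Q)) \<le> C * (Q * (Q * s) ^ CARD('m) * (1 + \<delta>))"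
proof -
  define m where "m = real CARD('m)"
  have m: "m \<ge> 1" by (simp add: m_def Suc_le_eq)
  define C where "C = (10 * L) ^ CARD('m) * (5 * (4 * m + 2) ^ CARD('m) * (25 * L\<^sup>2 * m\<^sup>2))"
  have "C > 0" using m L by (simp add: C_def)
  moreover have "real (card (near_points T x y u s \<sigma> \<delta> Q)) \<le> C * (Q * (Q * s) ^ CARD('m) * (1 + \<delta>))"
    if h: "0 < s" "s \<le> 1" "0 < \<sigma>" "\<sigma> \<le> 1" "0 < \<delta>" "1 \<le> Q" for s \<sigma> \<delta> Q
  proof (cases "4 * L * (Q * s) < 1")
    case True
    then show ?thesis using near_points_empty h \<open>C > 0\<close> by simp
  next
    case False
    define V where "V = Q * s"
    have V: "V > 0" "4 * L * V \<ge> 1" using False h by (auto simp: V_def)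
    \<comment> \<open>The emptiness of the other case bounds \<open>V\<close> from below, which
      makes the curvature error over a cell, of order \<open>1 / V\<close>, bounded.\<close>
    have iV: "1 / V \<le> 4 * L" using V by (simp add: field_simps)
    define \<tau> where "\<tau> = 1 / V"
    have \<tau>: "\<tau> > 0" using V by (simp add: \<tau>_def)
    obtain r where r: "\<And>c. c \<in> cell \<tau> ` x ` T \<Longrightarrow> r c \<in> T \<and> cell \<tau> (x (r c)) = c"
      using cell_representatives by metis
    note f = finite_cells(1)[OF \<tau>] and cI = finite_cells(2)[OF \<tau>]
    let ?\<rho> = "1 / 2 + 2 * m" and ?\<delta> = "\<delta> + 12 * L\<^sup>2 * m\<^sup>2"
    have b1: "1 / 2 + 2 * Q * s * (real CARD('m) * \<tau>) \<le> ?\<rho>"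
      using h V by (simp add: m_def \<tau>_def V_def)
    have b2: "\<delta> + 2 * Q * s * \<sigma> * L * (real CARD('m) * \<tau>)\<^sup>2 + \<sigma> * L * (real CARD('m) * \<tau>) * (1 / 2) \<le> ?\<delta>"
    proof -
      have "2 * Q * s * \<sigma> * L * (real CARD('m) * \<tau>)\<^sup>2 = \<sigma> * (2 * L * m\<^sup>2 * (1 / V))"
        using V h by (simp add: m_def[symmetric] \<tau>_def V_def power2_eq_square field_simps)
      also have "\<dots> \<le> 1 * (2 * L * m\<^sup>2 * (4 * L))"
        using h L V iV m by (intro mult_mono) auto
      finally have a: "2 * Q * s * \<sigma> * L * (real CARD('m) * \<tau>)\<^sup>2 \<le> 8 * L\<^sup>2 * m\<^sup>2"
        by (simp add: power2_eq_square algebra_simps)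
      have "\<sigma> * L * (real CARD('m) * \<tau>) * (1 / 2) = \<sigma> * (L * m * (1 / V) * (1 / 2))"
        by (simp add: m_def \<tau>_def)
      also have "\<dots> \<le> 1 * (L * m\<^sup>2 * (4 * L) * 1)"
        using h L V iV m by (intro mult_mono) (auto simp: power2_eq_square)
      finally have "\<sigma> * L * (real CARD('m) * \<tau>) * (1 / 2) \<le> 4 * L\<^sup>2 * m\<^sup>2"
        by (simp add: power2_eq_square algebra_simps)
      with a show ?thesis by linarith
    qed
    have Lm: "L\<^sup>2 * m\<^sup>2 \<ge> 1" using L m by (simp add: mult_ge1_I)
    have pos: "?\<rho> \<ge> 0" "?\<delta> \<ge> 0" "2 * Q \<ge> 0" using h m by auto
    note cov = near_points_cover[OF \<tau> h(1,3) _ h(5) r b1 b2]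
    have "real (card (near_points T x y u s \<sigma> \<delta> Q)) \<le> real (card (\<Union>c\<in>cell \<tau> ` x ` T. tbox x y u s \<sigma> (2 * Q) ?\<rho> ?\<delta> (r c)))"
      by (intro of_nat_mono card_mono cov finite_UN_I[OF f] finite_tbox) (use pos h in auto)
    also have "\<dots> \<le> (\<Sum>c\<in>cell \<tau> ` x ` T. real (card (tbox x y u s \<sigma> (2 * Q) ?\<rho> ?\<delta> (r c))))"
      unfolding of_nat_sum[symmetric] by (intro of_nat_mono card_UN_le f)
    also have "\<dots> \<le> (\<Sum>c\<in>cell \<tau> ` x ` T. (2 * (2 * Q) + 1) * (2 * ?\<rho> + 1) ^ CARD('m) * (2 * ?\<delta> + 1))"
      unfolding tbox_def by (intro sum_mono lbox_trivial pos)
    also have "\<dots> = real (card (cell \<tau> ` x ` T)) * ((2 * (2 * Q) + 1) * (2 * ?\<rho> + 1) ^ CARD('m) * (2 * ?\<delta> + 1))"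
      by simp
    also have "\<dots> \<le> (10 * L * V) ^ CARD('m) * ((5 * Q) * (4 * m + 2) ^ CARD('m) * (25 * L\<^sup>2 * m\<^sup>2 * (1 + \<delta>)))"
    proof (intro mult_mono)
      have "2 * L / \<tau> + 2 \<le> 10 * L * V" using V by (simp add: \<tau>_def)
      then show "real (card (cell \<tau> ` x ` T)) \<le> (10 * L * V) ^ CARD('m)"
        using \<tau> L by (intro order_trans[OF cI] power_mono) auto
      have "\<delta> * 1 \<le> \<delta> * (L\<^sup>2 * m\<^sup>2)" using h Lm by (intro mult_left_mono) auto
      moreover have "25 * L\<^sup>2 * m\<^sup>2 * (1 + \<delta>) = 25 * (L\<^sup>2 * m\<^sup>2) + 25 * (\<delta> * (L\<^sup>2 * m\<^sup>2))"
        "2 * ?\<delta> + 1 = 2 * \<delta> + 24 * (L\<^sup>2 * m\<^sup>2) + 1" by (simp_all add: algebra_simps)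
      ultimately show "2 * ?\<delta> + 1 \<le> 25 * L\<^sup>2 * m\<^sup>2 * (1 + \<delta>)" using Lm h by linarith
    qed (use h m L V Lm in auto)
    also have "\<dots> = C * (Q * (Q * s) ^ CARD('m) * (1 + \<delta>))"
      by (simp add: C_def V_def power_mult_distrib algebra_simps)
    finally show ?thesis .
  qed
  ultimately show ?thesis by blast
qed

end

section \<open>Bootstrapping between a hypersurface and its dual\<close>

text \<open>The square root accounts for the dual points \<open>(j, 0, l)\<close>, which are present when \<open>f\<close> is small
  on the scale in question.\<close>

definition counting_bound :: "real \<Rightarrow> 'a set \<Rightarrow> ('a \<Rightarrow> real ^ 'm) \<Rightarrow> ('a \<Rightarrow> real ^ 'm::finite) \<Rightarrow> ('a \<Rightarrow> real) \<Rightarrow> bool" where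
  "counting_bound t T x y u \<longleftrightarrow> (\<exists>C>0. \<forall>s \<sigma> \<delta> Q. 0 < s \<and> s \<le> 1 \<and> 0 < \<sigma> \<and> \<sigma> \<le> 1 \<and> 0 < \<delta> \<and> 1 \<le> Q \<longrightarrow>
     real (card (near_points T x y u s \<sigma> \<delta> Q)) \<le>
       C * (Q * (Q * s) ^ CARD('m) * (\<delta> + sqrt (\<delta> / (Q * s * \<sigma>)) + (Q * s) powr (t - 1))))"

lemma dyadic_exponent:
  assumes "D \<ge> (1 :: real)"
  shows "\<exists>n. D < 2 ^ n \<and> (\<forall>i<n. 2 ^ i \<le> D)"
proof -
  obtain k where "D < 2 ^ k" using real_arch_pow[of 2 D] by auto
  then have "D < 2 ^ (LEAST k. D < 2 ^ k)" by (rule LeastI)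
  moreover have "2 ^ i \<le> D" if "i < (LEAST k. D < 2 ^ k)" for i
    using not_less_Least[OF that] by simp
  ultimately show ?thesis by blast
qed

lemma sum_dyadic_powr_le:
  fixes D \<alpha> :: real
  assumes "\<alpha> > 0" "D > 0" "\<And>i. i < n \<Longrightarrow> 2 ^ i \<le> D"
  shows "(\<Sum>i<n. (2 ^ i) powr \<alpha>) \<le> 2 powr \<alpha> / (2 powr \<alpha> - 1) * D powr \<alpha>"
proof (cases n)
  case 0
  then show ?thesis using assms by (simp add: gr_one_powr less_imp_le)
next
  case (Suc k)
  let ?b = "2 powr \<alpha> :: real"
  have b: "?b > 1" using assms by (simp add: gr_one_powr)
  have pw: "(2 ^ i) powr \<alpha> = ?b ^ i" for i
    by (simp add: powr_realpow[symmetric] powr_powr powr_power mult.commute)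
  have "(\<Sum>i<n. (2 ^ i) powr \<alpha>) = (?b ^ n - 1) / (?b - 1)"
    unfolding pw by (rule geometric_sum) (use b assms in simp)
  also have "\<dots> \<le> ?b ^ n / (?b - 1)" using b by (intro divide_right_mono) auto
  also have "?b ^ n = ?b * (2 ^ k) powr \<alpha>" unfolding pw Suc by simp
  also have "\<dots> \<le> ?b * D powr \<alpha>"
    using assms(3)[of k] assms Suc by (intro mult_left_mono powr_mono2) auto
  finally show ?thesis using b by (simp add: divide_right_mono)
qed

context legendre
begin

text \<open>The condition \<open>transform\<close> turns the polar height
  \<open>\<xi> \<bullet> \<eta> - \<omega>\<close> into \<open>\<sigma> * s * v p\<close>. Thus the
  polar box is the dual tangent box at the same contact element \<open>p\<close>.\<close>

lemma tbox_transference: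
  assumes p: "p \<in> T" and pos: "X > 0" "\<rho> > 0" "\<delta> > 0"
  shows "real (card (tbox x y u s \<sigma> X \<rho> \<delta> p)) \<le> 4 * 18 ^ (CARD('m) + 2) * real CARD('m) ^ CARD('m) *
    (X * \<rho> ^ CARD('m) * \<delta>) * real (card (tbox y x v \<sigma> s (1 / (9 * \<delta>)) (1 / (9 * \<rho>)) (1 / (9 * X)) p))"
proof -
  have "(s *\<^sub>R x p) \<bullet> (\<sigma> *\<^sub>R y p) - s * \<sigma> * u p = \<sigma> * s * v p"
    by (simp add: transform[OF p, symmetric] algebra_simps)
  then show ?thesis
    using lbox_transference[OF pos, of "s *\<^sub>R x p" "\<sigma> *\<^sub>R y p" "s * \<sigma> * u p"] by (simp add: tbox_def)
qed

text \<open>Points with \<open>k = 0\<close> are counted cell by cell; the lower bound on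
  \<open>norm (y p)\<close> restricts their \<open>j\<close>. Every other point is, up to sign, a
  near point of the dual at some dyadic height. The quotient \<open>k / j\<close> fixes the slope up
  to \<open>R / (j * \<sigma>)\<close> after rescaling, hence by \<open>lip_x\<close> the base
  point, and this limits the number of cells that share a point.\<close>

lemma dual_sum_le:
  assumes I: "finite I" "\<And>c. c \<in> I \<Longrightarrow> r c \<in> T" "inj_on (\<lambda>c. cell \<tau> (x (r c))) I"
    and pos: "\<tau> > 0" "s > 0" "\<sigma> > 0" "0 < R" "R \<le> 1 / 2" "A > 0" "D \<ge> 0" and D: "D < 2 ^ n"
  shows "(\<Sum>c\<in>I. real (card (tbox y x v \<sigma> s D R A (r c)))) \<le>
     real (card I) * ((2 * (R * L / \<sigma>) + 1) * (2 * A + 1)) +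
     2 * (\<Sum>i<n. (4 * R * L / (2 ^ i * \<sigma> * \<tau>) + 2) ^ CARD('m) * real (card (near_points T y x v \<sigma> s A (2 ^ i))))"
proof -
  interpret d: legendre L T y x v u by (rule dual)
  define P where "P = (\<lambda>c. tbox y x v \<sigma> s D R A (r c))"
  define Z where "Z = (\<lambda>c. {(j, k, l) \<in> P c. k = 0})"
  define E where "E = (\<lambda>i c. {(j, k, l) \<in> P c. k \<noteq> 0 \<and> 2 ^ i \<le> j \<and> j < 2 ^ (i + 1)})"
  have fP: "finite (P c)" for c unfolding P_def by (rule finite_tbox) (use pos in auto)
  have split: "P c \<subseteq> Z c \<union> ((\<Union>i<n. E i c) \<union> uminus ` (\<Union>i<n. E i c))" if "c \<in> I" for c
  proof
    fix \<mu> assume \<mu>: "\<mu> \<in> P c"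
    obtain j k l where e: "\<mu> = (j, k, l)" by (cases \<mu>)
    have pos_case: "(j, k, l) \<in> (\<Union>i<n. E i c)" if "(j, k, l) \<in> P c" "k \<noteq> 0" "j > 0" for j k l
    proof -
      have j: "real_of_int j \<le> D" using that by (auto simp: P_def tbox_def lbox_def)
      have j1: "1 \<le> real_of_int j" using that by simp
      obtain i where i: "real_of_int j < 2 ^ i" "\<And>i'. i' < i \<Longrightarrow> 2 ^ i' \<le> real_of_int j"
        using dyadic_exponent[OF j1] by blast
      then obtain i' where i': "i = Suc i'" using j1 by (cases i) auto
      have "(2 :: real) ^ i' < 2 ^ n" using i(2)[of i'] i' j D by linarith
      then have "i' < n" by (rule power_less_imp_less_exp[rotated]) simp
      moreover have "2 ^ i' \<le> j" "j < 2 ^ (i' + 1)"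
        using i(1) i(2)[of i'] unfolding i'
        by (simp_all only: numeral_power_le_of_int_cancel_iff of_int_less_numeral_power_cancel_iff Suc_eq_plus1 lessI)
      ultimately show ?thesis using that by (auto simp: E_def)
    qed
    \<comment> \<open>For \<open>j = 0\<close> the box would contain a nonzero integer vector of
      norm at most \<open>R \<le> 1 / 2\<close>.\<close>
    have "j \<noteq> 0" if "k \<noteq> 0"
    proof
      assume "j = 0"
      then have "norm (rvec k) \<le> R" using \<mu> by (auto simp: e P_def tbox_def lbox_def)
      then show False using norm_rvec_ge_1[OF that] pos by linarith
    qed
    then consider "k = 0" | "k \<noteq> 0" "j > 0" | "k \<noteq> 0" "j < 0" by linarith
    then show "\<mu> \<in> Z c \<union> ((\<Union>i<n. E i c) \<union> uminus ` (\<Union>i<n. E i c))"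
    proof cases
      case 1
      then show ?thesis using \<mu> by (simp add: e Z_def)
    next
      case 2
      then show ?thesis using \<mu> pos_case by (simp add: e)
    next
      case 3
      have "(- j, - k, - l) \<in> P c" using \<mu> lbox_uminus unfolding e P_def tbox_def by blast
      then have "(- j, - k, - l) \<in> (\<Union>i<n. E i c)" using 3 by (intro pos_case) auto
      then have "- (- j, - k, - l) \<in> uminus ` (\<Union>i<n. E i c)" by (rule imageI)
      then show ?thesis by (simp add: e)
    qed
  qed
  have cZ: "real (card (Z c)) \<le> (2 * (R * L / \<sigma>) + 1) * (2 * A + 1)" if c: "c \<in> I" for c
  proof -
    let ?J = "\<lambda>z r. {j :: int. \<bar>real_of_int j - z\<bar> \<le> r}"
    let ?z = "\<lambda>j. real_of_int j * (\<sigma> * s * v (r c)) + (s *\<^sub>R x (r c)) \<bullet> (rvec 0 - real_of_int j *\<^sub>R (\<sigma> *\<^sub>R y (r c)))"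
    let ?S = "SIGMA j : ?J 0 (R * L / \<sigma>). ?J (?z j) A"
    have nn: "R * L / \<sigma> \<ge> 0" "A \<ge> 0" using pos L by auto
    have sub: "Z c \<subseteq> (\<lambda>(j, l). (j, 0, l)) ` ?S"
    proof
      fix \<mu> assume "\<mu> \<in> Z c"
      then obtain j l where e: "\<mu> = (j, 0, l)" and h: "(j, 0, l) \<in> lbox (\<sigma> *\<^sub>R y (r c)) (s *\<^sub>R x (r c)) (\<sigma> * s * v (r c)) D R A"
        by (auto simp: Z_def P_def tbox_def)
      have "\<bar>real_of_int j\<bar> * \<sigma> * norm (y (r c)) \<le> R" using h pos by (simp add: lbox_def abs_mult)
      then have "\<bar>real_of_int j\<bar> * \<sigma> * norm (y (r c)) * L \<le> R * L" using L by (intro mult_right_mono) auto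
      moreover have "\<bar>real_of_int j\<bar> * \<sigma> * 1 \<le> \<bar>real_of_int j\<bar> * \<sigma> * (L * norm (y (r c)))"
        by (intro mult_left_mono y_ge I c) (use pos in auto)
      ultimately have "\<bar>real_of_int j\<bar> * \<sigma> \<le> R * L" by (simp add: algebra_simps)
      then have "\<bar>real_of_int j\<bar> \<le> R * L / \<sigma>" using pos by (simp add: field_simps)
      moreover have "\<bar>real_of_int l - ?z j\<bar> \<le> A" using h by (simp add: lbox_def algebra_simps)
      ultimately show "\<mu> \<in> (\<lambda>(j, l). (j, 0, l)) ` ?S" by (auto simp: e)
    qed
    have fS: "finite ?S" using int_interval_bounds(1) nn by (intro finite_SigmaI)
    have "real (card (Z c)) \<le> real (card ?S)"
      by (intro of_nat_mono order_trans[OF card_mono[OF finite_imageI[OF fS] sub] card_image_le[OF fS]])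
    also have "\<dots> = (\<Sum>j\<in>?J 0 (R * L / \<sigma>). real (card (?J (?z j) A)))"
      using int_interval_bounds(1)[OF nn(1), of 0] int_interval_bounds(1)[OF nn(2)]
      by (subst card_SigmaI) auto
    also have "\<dots> \<le> (\<Sum>j\<in>?J 0 (R * L / \<sigma>). 2 * A + 1)"
      by (intro sum_mono int_interval_bounds(2) nn)
    also have "\<dots> = real (card (?J 0 (R * L / \<sigma>))) * (2 * A + 1)" by simp
    also have "\<dots> \<le> (2 * (R * L / \<sigma>) + 1) * (2 * A + 1)"
      by (intro mult_right_mono int_interval_bounds(2) nn) (use nn in auto)
    finally show ?thesis .
  qed
  have cE: "(\<Sum>c\<in>I. real (card (E i c))) \<le>
     (4 * R * L / (2 ^ i * \<sigma> * \<tau>) + 2) ^ CARD('m) * real (card (near_points T y x v \<sigma> s A (2 ^ i)))" for i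
  proof (rule sum_card_le[OF I(1)])
    show "finite (near_points T y x v \<sigma> s A (2 ^ i))" by (rule d.finite_near_points) (use pos in auto)
  next
    fix c assume c: "c \<in> I"
    show "E i c \<subseteq> near_points T y x v \<sigma> s A (2 ^ i)"
    proof
      fix \<mu> assume "\<mu> \<in> E i c"
      then obtain j k l where e: "\<mu> = (j, k, l)" and h: "(j, k, l) \<in> tbox y x v \<sigma> s D R A (r c)" "k \<noteq> 0" "2 ^ i \<le> j" "j < 2 ^ (i + 1)"
        by (auto simp: E_def P_def)
      have "2 ^ i \<le> real_of_int j" "real_of_int j < 2 ^ (i + 1)"
        using h(3,4) unfolding numeral_power_le_of_int_cancel_iff of_int_less_numeral_power_cancel_iff .
      then have j: "2 ^ i \<le> real_of_int j" "real_of_int j < 2 * 2 ^ i" by simp_all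
      moreover have "(0 :: real) \<le> 2 ^ i" by simp
      ultimately have "\<bar>real_of_int j\<bar> \<le> 2 * 2 ^ i" by linarith
      then have "(j, k, l) \<in> tbox y x v \<sigma> s (2 * 2 ^ i) (1 / 2) A (r c)"
        using h(1) pos by (auto simp: tbox_def lbox_def)
      then show "\<mu> \<in> near_points T y x v \<sigma> s A (2 ^ i)"
        using h j I(2)[OF c] by (auto simp: near_points_def e)
    qed
  next
    fix \<mu> assume "\<mu> \<in> near_points T y x v \<sigma> s A (2 ^ i)"
    let ?I = "{c \<in> I. \<mu> \<in> E i c}"
    let ?h = "2 * R * L / (2 ^ i * \<sigma>)"
    have hpos: "?h \<ge> 0" using pos L by auto
    show "real (card {c \<in> I. \<mu> \<in> E i c}) \<le> (4 * R * L / (2 ^ i * \<sigma> * \<tau>) + 2) ^ CARD('m)"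
    proof (cases "?I = {}")
      case True
      have "(4 * R * L / (2 ^ i * \<sigma> * \<tau>) + 2) ^ CARD('m) \<ge> 0" using pos L by (intro zero_le_power) auto
      then show ?thesis unfolding True by simp
    next
      case False
      then obtain c0 where c0: "c0 \<in> I" "\<mu> \<in> E i c0" by auto
      \<comment> \<open>Two slopes compatible with the same \<open>(j, k)\<close> differ by at most
        \<open>2 * R / (2 ^ i * \<sigma>)\<close>; the factor \<open>L\<close> comes from passing to
        base points.\<close>
      have near: "norm (z - x (r c0)) \<le> ?h" if z: "z \<in> (\<lambda>c. x (r c)) ` ?I" for z
      proof -
        obtain c where c: "z = x (r c)" "c \<in> I" "\<mu> \<in> E i c" using z by auto
        obtain j k l where e: "\<mu> = (j, k, l)" by (cases \<mu>)
        have h: "norm (rvec k - real_of_int j *\<^sub>R (\<sigma> *\<^sub>R y (r c))) \<le> R" "norm (rvec k - real_of_int j *\<^sub>R (\<sigma> *\<^sub>R y (r c0))) \<le> R"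
           "2 ^ i \<le> j"
          using c c0 by (auto simp: e E_def P_def tbox_def lbox_def)
        have j: "2 ^ i \<le> real_of_int j"
          using h(3) unfolding numeral_power_le_of_int_cancel_iff .
        have "(real_of_int j * \<sigma>) *\<^sub>R (y (r c) - y (r c0)) = (rvec k - real_of_int j *\<^sub>R (\<sigma> *\<^sub>R y (r c0))) - (rvec k - real_of_int j *\<^sub>R (\<sigma> *\<^sub>R y (r c)))"
          by (simp add: algebra_simps)
        then have "norm ((real_of_int j * \<sigma>) *\<^sub>R (y (r c) - y (r c0))) \<le>
            norm (rvec k - real_of_int j *\<^sub>R (\<sigma> *\<^sub>R y (r c0))) + norm (rvec k - real_of_int j *\<^sub>R (\<sigma> *\<^sub>R y (r c)))"
          by (simp only: norm_triangle_ineq4)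
        then have "norm ((real_of_int j * \<sigma>) *\<^sub>R (y (r c) - y (r c0))) \<le> 2 * R" using h by linarith
        then have "\<bar>real_of_int j\<bar> * \<sigma> * norm (y (r c) - y (r c0)) \<le> 2 * R" using pos by (simp add: abs_mult)
        moreover have "2 ^ i * \<sigma> * norm (y (r c) - y (r c0)) \<le> \<bar>real_of_int j\<bar> * \<sigma> * norm (y (r c) - y (r c0))"
          by (intro mult_right_mono order_trans[OF j abs_ge_self]) (use pos in auto)
        ultimately have "norm (y (r c) - y (r c0)) * (2 ^ i * \<sigma>) \<le> 2 * R" unfolding mult.commute[of _ "2 ^ i * \<sigma>"] by linarith
        then have "norm (y (r c) - y (r c0)) \<le> 2 * R / (2 ^ i * \<sigma>)" using pos by (subst pos_le_divide_eq) auto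
        then have "L * norm (y (r c) - y (r c0)) \<le> L * (2 * R / (2 ^ i * \<sigma>))" using L by (intro mult_left_mono) auto
        moreover have "norm (x (r c) - x (r c0)) \<le> L * norm (y (r c) - y (r c0))"
          by (rule lip_x) (use I c c0 in auto)
        ultimately show ?thesis by (simp add: c(1) mult_ac)
      qed
      have "card ?I = card ((\<lambda>c. cell \<tau> (x (r c))) ` ?I)"
        by (rule card_image[symmetric], rule inj_on_subset[OF I(3)]) auto
      also have "(\<lambda>c. cell \<tau> (x (r c))) ` ?I = cell \<tau> ` (\<lambda>c. x (r c)) ` ?I" by auto
      finally have "real (card ?I) \<le> (2 * ?h / \<tau> + 2) ^ CARD('m)"
        using card_cells_ball(2)[OF pos(1) hpos near] by simp
      also have "2 * ?h / \<tau> = 4 * R * L / (2 ^ i * \<sigma> * \<tau>)" by (simp add: field_simps)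
      finally show ?thesis .
    qed
  qed
  have fE: "finite (\<Union>i<n. E i c)" for c
    by (rule finite_subset[OF _ fP[of c]]) (auto simp: E_def)
  have cP: "real (card (P c)) \<le> real (card (Z c)) + 2 * (\<Sum>i<n. real (card (E i c)))" if c: "c \<in> I" for c
  proof -
    let ?U = "\<Union>i<n. E i c"
    have fZ: "finite (Z c)" by (rule finite_subset[OF _ fP[of c]]) (auto simp: Z_def)
    have "card (P c) \<le> card (Z c \<union> (?U \<union> uminus ` ?U))"
      by (intro card_mono split c) (use fE fZ in auto)
    also have "\<dots> \<le> card (Z c) + (card ?U + card (uminus ` ?U))"
      by (rule order_trans[OF card_Un_le add_left_mono[OF card_Un_le]])
    also have "\<dots> \<le> card (Z c) + 2 * card ?U" using card_image_le[OF fE, of uminus c] by simp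
    also have "card ?U \<le> (\<Sum>i<n. card (E i c))" by (rule card_UN_le) simp
    finally have "card (P c) \<le> card (Z c) + 2 * (\<Sum>i<n. card (E i c))" by simp
    then have "real (card (P c)) \<le> real (card (Z c) + 2 * (\<Sum>i<n. card (E i c)))" by (rule of_nat_mono)
    then show ?thesis by simp
  qed
  have "(\<Sum>c\<in>I. real (card (P c))) \<le> (\<Sum>c\<in>I. real (card (Z c)) + 2 * (\<Sum>i<n. real (card (E i c))))"
    by (intro sum_mono cP)
  also have "\<dots> = (\<Sum>c\<in>I. real (card (Z c))) + 2 * (\<Sum>i<n. \<Sum>c\<in>I. real (card (E i c)))"
    by (simp add: sum.distrib sum_distrib_left[symmetric] sum.swap[of _ I])
  also have "\<dots> \<le> (\<Sum>c\<in>I. (2 * (R * L / \<sigma>) + 1) * (2 * A + 1)) +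
      2 * (\<Sum>i<n. (4 * R * L / (2 ^ i * \<sigma> * \<tau>) + 2) ^ CARD('m) * real (card (near_points T y x v \<sigma> s A (2 ^ i))))"
    by (intro add_mono mult_left_mono sum_mono cZ cE) auto
  finally show ?thesis by (simp add: P_def)
qed

end

text \<open>At height \<open>q = 2 ^ i\<close> the overlap is at most a constant times
  \<open>(D / q) ^ CARD('m)\<close>, and the factor \<open>q ^ CARD('m)\<close> in the dual count
  cancels its denominator. What remains are \<open>q\<close>, \<open>q powr (1 / 2)\<close> and
  \<open>q powr t\<close>. Their dyadic sums are geometric with increasing terms, so each is bounded
  by its value at the top height \<open>D\<close>.\<close>

lemma (in legendre) dual_sum_bound:
  assumes t: "t > 0" and cb: "counting_bound t T y x v" and \<kappa>: "\<kappa> > 0"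
  shows "\<exists>C>0. \<forall>(I :: 'c set) r \<tau> s \<sigma> R A D. finite I \<and> r ` I \<subseteq> T \<and> inj_on (\<lambda>c. cell \<tau> (x (r c))) I \<and>
     0 < \<tau> \<and> 0 < s \<and> s \<le> 1 \<and> 0 < \<sigma> \<and> \<sigma> \<le> 1 \<and> 0 < R \<and> R \<le> 1 / 2 \<and> 0 < A \<and> 1 \<le> D \<and> R / (\<sigma> * \<tau>) \<le> \<kappa> * D \<longrightarrow>
     (\<Sum>c\<in>I. real (card (tbox y x v \<sigma> s D R A (r c)))) \<le>
       real (card I) * ((2 * (R * L / \<sigma>) + 1) * (2 * A + 1)) +
       C * ((D * \<sigma>) ^ CARD('m) * (D * A + sqrt (D * A / (\<sigma> * s)) + D powr t * \<sigma> powr (t - 1)))"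
proof -
  obtain C1 where C1: "C1 > 0" and cb': "\<And>s \<sigma> \<delta> Q. 0 < s \<and> s \<le> 1 \<and> 0 < \<sigma> \<and> \<sigma> \<le> 1 \<and> 0 < \<delta> \<and> 1 \<le> Q \<Longrightarrow>
     real (card (near_points T y x v s \<sigma> \<delta> Q)) \<le>
       C1 * (Q * (Q * s) ^ CARD('m) * (\<delta> + sqrt (\<delta> / (Q * s * \<sigma>)) + (Q * s) powr (t - 1)))"
    using cb unfolding counting_bound_def by blast
  define g where "g = (\<lambda>\<alpha> :: real. 2 powr \<alpha> / (2 powr \<alpha> - 1) :: real)"
  have g: "g \<alpha> > 0" if "\<alpha> > 0" for \<alpha> using that by (simp add: g_def gr_one_powr)
  define k where "k = 4 * L * \<kappa> + 2"
  have k: "k > 0" using \<kappa> L by (simp add: k_def add_pos_pos)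
  define G where "G = g 1 + g (1 / 2) + g t"
  have G: "G > 0" "g 1 \<le> G" "g (1 / 2) \<le> G" "g t \<le> G"
    using g[of 1] g[of "1/2"] g[OF t] by (simp_all add: G_def)
  define C where "C = 2 * (k ^ CARD('m) * C1 * G)"
  have "C > 0" using k C1 G by (simp add: C_def)
  moreover have "(\<Sum>c\<in>I. real (card (tbox y x v \<sigma> s D R A (r c)))) \<le>
       real (card I) * ((2 * (R * L / \<sigma>) + 1) * (2 * A + 1)) +
       C * ((D * \<sigma>) ^ CARD('m) * (D * A + sqrt (D * A / (\<sigma> * s)) + D powr t * \<sigma> powr (t - 1)))"
    if I: "finite I" "r ` I \<subseteq> T" "inj_on (\<lambda>c. cell \<tau> (x (r c))) I"
      and h: "0 < \<tau>" "0 < s" "s \<le> 1" "0 < \<sigma>" "\<sigma> \<le> 1" "0 < R" "R \<le> 1 / 2" "0 < A" "1 \<le> D" "R / (\<sigma> * \<tau>) \<le> \<kappa> * D"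
    for I :: "'c set" and r \<tau> s \<sigma> R A D
  proof -
    obtain n where n: "D < 2 ^ n" "\<And>i. i < n \<Longrightarrow> 2 ^ i \<le> D" using dyadic_exponent[OF h(9)] by blast
    let ?W = "\<lambda>i. 2 ^ i * A + (2 ^ i) powr (1 / 2) * sqrt (A / (\<sigma> * s)) + (2 ^ i) powr t * \<sigma> powr (t - 1)"
    have tm: "(4 * R * L / (2 ^ i * \<sigma> * \<tau>) + 2) ^ CARD('m) * real (card (near_points T y x v \<sigma> s A (2 ^ i)))
        \<le> k ^ CARD('m) * C1 * (D * \<sigma>) ^ CARD('m) * ?W i" if i: "i < n" for i
    proof -
      define q :: real where "q = 2 ^ i"
      have q: "q \<ge> 1" "q \<le> D" using n(2)[OF i] by (simp_all add: q_def)
      have "4 * R * L / (q * \<sigma> * \<tau>) + 2 = 4 * L * (R / (\<sigma> * \<tau>)) / q + 2"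
        using h q by (simp add: field_simps)
      \<comment> \<open>Since \<open>q \<le> D\<close>, the additive \<open>2\<close> from the cell
        count can also be written as a multiple of \<open>D / q\<close>.\<close>
      also have "\<dots> \<le> 4 * L * (\<kappa> * D) / q + 2 * (D / q)"
        using h q L by (intro add_mono divide_right_mono mult_left_mono) (auto simp: field_simps)
      also have "\<dots> = k * D / q" by (simp add: k_def field_simps add_divide_distrib)
      finally have m1: "4 * R * L / (q * \<sigma> * \<tau>) + 2 \<le> k * D / q" .
      have sq: "q * sqrt (A / (q * \<sigma> * s)) = q powr (1 / 2) * sqrt (A / (\<sigma> * s))"
      proof -
        have "q * sqrt (A / (q * \<sigma> * s)) = (sqrt q * sqrt q) * sqrt (A / (q * \<sigma> * s))" using q by simp
        also have "\<dots> = sqrt q * sqrt (q * (A / (q * \<sigma> * s)))" by (simp only: real_sqrt_mult mult.assoc)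
        also have "q * (A / (q * \<sigma> * s)) = A / (\<sigma> * s)" using q by simp
        finally show ?thesis using q by (simp add: powr_half_sqrt)
      qed
      have pw: "q * (q * \<sigma>) powr (t - 1) = q powr t * \<sigma> powr (t - 1)"
        using q h by (simp add: powr_mult powr_diff)
      have "(4 * R * L / (q * \<sigma> * \<tau>) + 2) ^ CARD('m) * real (card (near_points T y x v \<sigma> s A q))
         \<le> (k * D / q) ^ CARD('m) * (C1 * (q * (q * \<sigma>) ^ CARD('m) * (A + sqrt (A / (q * \<sigma> * s)) + (q * \<sigma>) powr (t - 1))))"
        using h q L k by (intro mult_mono power_mono m1 cb') auto
      also have "\<dots> = k ^ CARD('m) * C1 * (D * \<sigma>) ^ CARD('m) * (q * A + q * sqrt (A / (q * \<sigma> * s)) + q * (q * \<sigma>) powr (t - 1))"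
        using q by (simp add: power_mult_distrib power_divide field_simps)
      finally show ?thesis unfolding sq pw unfolding q_def .
    qed
    have "(\<Sum>i<n. (4 * R * L / (2 ^ i * \<sigma> * \<tau>) + 2) ^ CARD('m) * real (card (near_points T y x v \<sigma> s A (2 ^ i))))
       \<le> (\<Sum>i<n. k ^ CARD('m) * C1 * (D * \<sigma>) ^ CARD('m) * ?W i)"
      by (intro sum_mono tm) auto
    also have "\<dots> = k ^ CARD('m) * C1 * (D * \<sigma>) ^ CARD('m) *
       ((\<Sum>i<n. (2 ^ i) powr 1) * A + (\<Sum>i<n. (2 ^ i) powr (1 / 2)) * sqrt (A / (\<sigma> * s)) + (\<Sum>i<n. (2 ^ i) powr t) * \<sigma> powr (t - 1))"
      by (simp add: sum.distrib sum_distrib_left[symmetric] sum_distrib_right[symmetric])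
    also have "\<dots> \<le> k ^ CARD('m) * C1 * (D * \<sigma>) ^ CARD('m) *
       ((G * D powr 1) * A + (G * D powr (1 / 2)) * sqrt (A / (\<sigma> * s)) + (G * D powr t) * \<sigma> powr (t - 1))"
    proof (intro mult_left_mono add_mono mult_right_mono)
      have *: "(\<Sum>i<n. (2 ^ i) powr \<alpha>) \<le> G * D powr \<alpha>" if "\<alpha> > 0" "g \<alpha> \<le> G" for \<alpha>
      proof -
        have "(\<Sum>i<n. (2 ^ i) powr \<alpha>) \<le> g \<alpha> * D powr \<alpha>"
          unfolding g_def by (rule sum_dyadic_powr_le) (use that h n in auto)
        also have "\<dots> \<le> G * D powr \<alpha>" using that by (intro mult_right_mono) auto
        finally show ?thesis .
      qed
      show "(\<Sum>i<n. (2 ^ i) powr 1) \<le> G * D powr 1" by (rule *) (use G in auto)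
      show "(\<Sum>i<n. (2 ^ i) powr (1 / 2)) \<le> G * D powr (1 / 2)" by (rule *) (use G in auto)
      show "(\<Sum>i<n. (2 ^ i) powr t) \<le> G * D powr t" by (rule *) (use G t in auto)
    qed (use h k C1 in auto)
    also have "(G * D powr (1 / 2)) * sqrt (A / (\<sigma> * s)) = G * sqrt (D * A / (\<sigma> * s))"
      using h by (simp add: powr_half_sqrt real_sqrt_mult[symmetric] mult.assoc)
    finally have S: "(\<Sum>i<n. (4 * R * L / (2 ^ i * \<sigma> * \<tau>) + 2) ^ CARD('m) * real (card (near_points T y x v \<sigma> s A (2 ^ i))))
       \<le> k ^ CARD('m) * C1 * G * ((D * \<sigma>) ^ CARD('m) * (D * A + sqrt (D * A / (\<sigma> * s)) + D powr t * \<sigma> powr (t - 1)))"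
      using h by (simp add: algebra_simps)
    have "D \<ge> 0" using h by simp
    have "\<And>c. c \<in> I \<Longrightarrow> r c \<in> T" using I by auto
    from dual_sum_le[OF I(1) this I(3) h(1,2,4,6,7,8) \<open>D \<ge> 0\<close> n(1)] S show ?thesis
      unfolding C_def by linarith
  qed
  ultimately show ?thesis by (intro exI[of _ C]) auto
qed

section \<open>Exponent arithmetic of one bootstrap step\<close>

context
  fixes V \<sigma> U \<delta> Q t t' \<tau> \<rho> :: real and m :: nat
  assumes V: "V \<ge> 1" and \<sigma>: "\<sigma> > 0" "\<sigma> \<le> 1" and U: "U = V * \<sigma>" and \<delta>: "\<delta> > 0" "\<delta> \<le> U" "V powr (t' - 2) * U \<le> \<delta>"
    and t: "t > 0" and t': "t' = t / (1 + t)" and Q: "Q \<ge> V" and m: "m \<ge> 2"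
    and \<tau>: "\<tau> = sqrt (\<delta> / U)" and \<rho>: "\<rho> = V * \<tau>"
begin

lemma bootstrap_U_pos: "U > 0" using V \<sigma> U by simp

lemma bootstrap_tau_bounds: "\<tau> > 0" "\<tau> \<le> 1" "\<tau>\<^sup>2 = \<delta> / U"
  using bootstrap_U_pos \<delta> \<tau> by auto

lemma bootstrap_rho_sq: "\<rho>\<^sup>2 * \<sigma> = V * \<delta>"
  using bootstrap_tau_bounds(3) bootstrap_U_pos V \<sigma> by (simp add: \<rho> power_mult_distrib U) (simp add: power2_eq_square)

lemma bootstrap_delta_ge: "V powr (t' - 1) * \<sigma> \<le> \<delta>"
proof -
  have "V powr (t' - 2) * V = V powr (t' - 1)"
    using V powr_add[of V "t' - 2" 1] by simp
  then show ?thesis using \<delta>(3) by (simp add: U mult.assoc[symmetric])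
qed

text \<open>This is the purpose of the lower limit on \<open>\<delta>\<close>: it amounts to
  \<open>V powr t' \<le> \<rho>\<^sup>2\<close>, so that a tangent box over a cell is at least one
  lattice step wide.\<close>

lemma bootstrap_rho_ge_1: "\<rho> \<ge> 1"
proof -
  have "V powr t' * \<sigma> = V * (V powr (t' - 1) * \<sigma>)"
    using V powr_add[of V "t' - 1" 1] by simp
  also have "\<dots> \<le> V * \<delta>" using bootstrap_delta_ge V by (intro mult_left_mono) auto
  also have "\<dots> = \<rho>\<^sup>2 * \<sigma>" using bootstrap_rho_sq by simp
  finally have "V powr t' \<le> \<rho>\<^sup>2" using \<sigma> by simp
  moreover have "1 \<le> V powr t'" using V t t' by (simp add: ge_one_powr_ge_zero)
  ultimately have "1 \<le> \<rho>\<^sup>2" by linarith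
  moreover have "\<rho> \<ge> 0" using V bootstrap_tau_bounds by (simp add: \<rho>)
  ultimately show ?thesis by (metis power2_le_imp_le one_power2)
qed

text \<open>Within a cell the rescaled slope varies by a multiple of
  \<open>\<sigma> * \<tau>\<close>. This inequality keeps the resulting error of
  \<open>tbox_shift\<close> at the order of \<open>\<delta>\<close>.\<close>

lemma bootstrap_sigma_tau_le: "\<sigma> * \<tau> \<le> \<delta>"
proof -
  have "V * (\<sigma> * \<tau>) = \<sigma> * \<rho>" by (simp add: \<rho>)
  also have "\<dots> \<le> \<sigma> * \<rho>\<^sup>2" using bootstrap_rho_ge_1 \<sigma> by (intro mult_left_mono) (auto simp: power2_eq_square)
  also have "\<dots> = V * \<delta>" using bootstrap_rho_sq by (simp add: mult.commute)
  finally show ?thesis using V by simp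
qed

text \<open>The origin of the square root in \<open>counting_bound\<close>: dual points with
  \<open>k = 0\<close> number about \<open>1 / (\<rho> * \<sigma>)\<close> per cell at most, and the
  weight \<open>\<delta>\<close> turns this into
  \<open>\<tau> = sqrt (\<delta> / U)\<close>.\<close>

lemma bootstrap_delta_over_rho_sigma: "\<delta> / (\<rho> * \<sigma>) = \<tau>"
proof -
  have "\<rho> * \<sigma> * \<tau> = U * \<tau>\<^sup>2" by (simp add: \<rho> U power2_eq_square)
  also have "\<dots> = \<delta>" using bootstrap_tau_bounds(3) bootstrap_U_pos by simp
  finally have "\<delta> = \<tau> * (\<rho> * \<sigma>)" by (simp add: algebra_simps)
  then show ?thesis using bootstrap_rho_ge_1 \<sigma> by simp
qed

text \<open>The volume factor of the boxes times the factor \<open>(D * \<sigma>) ^ m\<close> of the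
  dual sum, with \<open>D = 1 / \<delta>\<close>, restores the expected \<open>V ^ m\<close> with a
  gain of \<open>\<rho> ^ m\<close>.\<close>

lemma bootstrap_rho_sigma_over_delta: "\<delta> * \<rho> ^ m * (\<sigma> / \<delta>) ^ m = V ^ m * (\<delta> / \<rho> ^ m)"
proof -
  have "\<rho> * (\<sigma> / \<delta>) = V / \<rho>"
    using bootstrap_rho_sq bootstrap_rho_ge_1 \<delta> by (simp add: field_simps power2_eq_square)
  then have "\<rho> ^ m * (\<sigma> / \<delta>) ^ m = (V / \<rho>) ^ m" by (simp only: power_mult_distrib[symmetric])
  then have "\<delta> * \<rho> ^ m * (\<sigma> / \<delta>) ^ m = \<delta> * (V / \<rho>) ^ m" by (simp only: mult.assoc)
  then show ?thesis by (simp add: power_divide)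
qed

text \<open>Dimension at least two enters here: \<open>\<rho> ^ m \<ge> \<rho>\<^sup>2\<close>, and
  \<open>\<rho>\<^sup>2\<close> equals \<open>V * \<delta> / \<sigma>\<close>.\<close>

lemma bootstrap_delta_over_rho_le: "\<delta> / \<rho> ^ m \<le> \<delta>" "\<delta> / \<rho> ^ m \<le> \<sigma> / V"
proof -
  have "\<rho> ^ 2 \<le> \<rho> ^ m" using bootstrap_rho_ge_1 m by (intro power_increasing)
  then have "\<delta> / \<rho> ^ m \<le> \<delta> / \<rho>\<^sup>2" using bootstrap_rho_ge_1 \<delta> by (intro divide_left_mono) auto
  also have "\<dots> = \<sigma> / V" using bootstrap_rho_sq bootstrap_rho_ge_1 V by (simp add: field_simps)
  finally show "\<delta> / \<rho> ^ m \<le> \<sigma> / V" .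
  have "1 \<le> \<rho> ^ m" using bootstrap_rho_ge_1 by (rule one_le_power)
  then show "\<delta> / \<rho> ^ m \<le> \<delta>" using \<delta> by (simp add: field_simps)
qed

text \<open>The three term lemmas treat the summands of \<open>dual_sum_bound\<close> for
  \<open>D = 1 / \<delta>\<close> and \<open>A = 1 / Q\<close>, weighted with
  \<open>\<delta> / \<rho> ^ m\<close>.\<close>

lemma bootstrap_term1: "\<delta> / \<rho> ^ m * (1 / \<delta> * (1 / Q)) \<le> V powr (t' - 1)"
proof -
  have "\<delta> / \<rho> ^ m * (1 / \<delta> * (1 / Q)) \<le> \<delta> * (1 / \<delta> * (1 / Q))"
    using bootstrap_delta_over_rho_le(1) \<delta> Q V by (intro mult_right_mono) auto
  also have "\<dots> = 1 / Q" using \<delta> by simp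
  also have "\<dots> \<le> 1 / V" using Q V by (intro divide_left_mono) auto
  also have "\<dots> = V powr (0 - 1)" using V by (simp add: powr_minus_divide)
  also have "\<dots> \<le> V powr (t' - 1)" using V t t' by (intro powr_mono) auto
  finally show ?thesis .
qed

lemma bootstrap_term2: "\<delta> / \<rho> ^ m * sqrt (1 / (\<delta> * U)) \<le> sqrt (\<delta> / U)"
proof -
  have "\<delta> / \<rho> ^ m * sqrt (1 / (\<delta> * U)) \<le> \<delta> * sqrt (1 / (\<delta> * U))"
    using bootstrap_delta_over_rho_le(1) \<delta> bootstrap_U_pos by (intro mult_right_mono) auto
  also have "\<dots> = sqrt (\<delta>\<^sup>2 * (1 / (\<delta> * U)))" using \<delta> by (simp add: real_sqrt_mult real_sqrt_divide)
  also have "\<delta>\<^sup>2 * (1 / (\<delta> * U)) = \<delta> / U" using \<delta> by (simp add: power2_eq_square)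
  finally show ?thesis .
qed

lemma bootstrap_term3: "\<delta> / \<rho> ^ m * ((1 / \<delta>) powr t * \<sigma> powr (t - 1)) \<le> V powr (t' - 1)"
proof -
  have "\<delta> / \<rho> ^ m * ((1 / \<delta>) powr t * \<sigma> powr (t - 1)) \<le> \<sigma> / V * ((1 / \<delta>) powr t * \<sigma> powr (t - 1))"
    by (intro mult_right_mono bootstrap_delta_over_rho_le) auto
  also have "\<dots> = (\<sigma> / \<delta>) powr t / V"
    using \<sigma> \<delta> V by (simp add: powr_divide powr_diff)
  also have "\<dots> \<le> (V powr (1 - t')) powr t / V"
  proof (intro divide_right_mono powr_mono2)
    have "\<sigma> = V powr (1 - t') * (V powr (t' - 1) * \<sigma>)"
      using V powr_add[of V "1 - t'" "t' - 1"] by (simp add: mult.assoc[symmetric])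
    also have "\<dots> \<le> V powr (1 - t') * \<delta>" using bootstrap_delta_ge by (intro mult_left_mono) auto
    finally show "\<sigma> / \<delta> \<le> V powr (1 - t')" using \<delta> by (simp add: field_simps)
  qed (use t \<sigma> \<delta> V in auto)
  also have "(V powr (1 - t')) powr t = V powr t'"
  proof -
    have "(1 - t') * t = t'" using t unfolding t' by (simp add: field_simps)
    then show ?thesis by (simp add: powr_powr)
  qed
  also have "V powr t' / V = V powr (t' - 1)" using V by (simp add: powr_diff)
  finally show ?thesis .
qed

end

section \<open>The bootstrap step and its iteration\<close>

context legendre
begin

text \<open>The polar of a box with sides \<open>Q\<close>, \<open>\<rho>\<close>,
  \<open>\<delta>\<close> has sides of order \<open>1 / \<delta>\<close>, \<open>1 / \<rho>\<close>,
  \<open>1 / Q\<close>. As \<open>\<rho> * \<sigma> * \<tau> = \<delta>\<close>, the choices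
  \<open>D = 1 / \<delta>\<close> and \<open>R = 1 / (2 * \<rho>)\<close> satisfy
  \<open>R / (\<sigma> * \<tau>) = D / 2\<close>, so \<open>dual_sum_bound\<close> applies with
  \<open>1 / 2\<close> for \<open>\<kappa>\<close>.\<close>

lemma bootstrap_core:
  fixes t :: real
  assumes m: "CARD('m) \<ge> 2" and t: "t > 0" and cb: "counting_bound t T y x v"
  defines "t' \<equiv> t / (1 + t)"
  shows "\<exists>C>0. \<forall>s \<sigma> \<delta> Q. 0 < s \<and> s \<le> 1 \<and> 0 < \<sigma> \<and> \<sigma> \<le> 1 \<and> 0 < \<delta> \<and> \<delta> \<le> 1 \<and> 1 \<le> Q * s \<and>
      \<delta> \<le> Q * s * \<sigma> \<and> (Q * s) powr (t' - 2) * (Q * s * \<sigma>) \<le> \<delta> \<longrightarrow>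
     real (card (near_points T x y u s \<sigma> \<delta> Q)) \<le>
       C * (Q * (Q * s) ^ CARD('m) * (\<delta> + sqrt (\<delta> / (Q * s * \<sigma>)) + (Q * s) powr (t' - 1)))"
proof -
  obtain C2 where C2: "C2 > 0" and dual_sum: "\<And>(I :: (int ^ 'm) set) r \<tau> s \<sigma> R A D. finite I \<and> r ` I \<subseteq> T \<and> inj_on (\<lambda>c. cell \<tau> (x (r c))) I \<and>
     0 < \<tau> \<and> 0 < s \<and> s \<le> 1 \<and> 0 < \<sigma> \<and> \<sigma> \<le> 1 \<and> 0 < R \<and> R \<le> 1 / 2 \<and> 0 < A \<and> 1 \<le> D \<and> R / (\<sigma> * \<tau>) \<le> 1 / 2 * D \<Longrightarrow>
     (\<Sum>c\<in>I. real (card (tbox y x v \<sigma> s D R A (r c)))) \<le>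
       real (card I) * ((2 * (R * L / \<sigma>) + 1) * (2 * A + 1)) +
       C2 * ((D * \<sigma>) ^ CARD('m) * (D * A + sqrt (D * A / (\<sigma> * s)) + D powr t * \<sigma> powr (t - 1)))"
    using dual_sum_bound[OF t cb, of "1 / 2"] by auto
  define m where "m = real CARD('m)"
  have m1: "m \<ge> 1" by (simp add: m_def Suc_le_eq)
  \<comment> \<open>The summands stand for the original tolerance, the curvature over a cell and the
    turning of the tangent plane, all in units of \<open>\<delta>\<close>.\<close>
  define C1 where "C1 = 1 + 2 * L * m\<^sup>2 + L * m"
  have C1: "C1 \<ge> 1" using m1 L by (simp add: C1_def)
  define Ct where "Ct = 4 * 18 ^ (CARD('m) + 2) * m ^ CARD('m)"
  have Ct: "Ct > 0" using m1 by (simp add: Ct_def)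
  define K where "K = Ct * (2 * (1 + 2 * m) ^ CARD('m) * C1)"
  have K: "K > 0" using Ct m1 C1 by (simp add: K_def)
  define C where "C = K * (3 * (4 * L) ^ CARD('m) * L + 2 * C2)"
  have "C > 0" using K L C2 by (auto simp: C_def intro!: mult_pos_pos add_pos_pos)
  moreover have "real (card (near_points T x y u s \<sigma> \<delta> Q)) \<le>
       C * (Q * (Q * s) ^ CARD('m) * (\<delta> + sqrt (\<delta> / (Q * s * \<sigma>)) + (Q * s) powr (t' - 1)))"
    if s: "0 < s" "s \<le> 1" and \<sigma>: "0 < \<sigma>" "\<sigma> \<le> 1" and \<delta>: "0 < \<delta>" "\<delta> \<le> 1" and V1: "1 \<le> Q * s"
      and \<delta>U: "\<delta> \<le> Q * s * \<sigma>" "(Q * s) powr (t' - 2) * (Q * s * \<sigma>) \<le> \<delta>" for s \<sigma> \<delta> Q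
  proof -
    define V U where "V = Q * s" and "U = V * \<sigma>"
    define \<tau> where "\<tau> = sqrt (\<delta> / U)"
    define \<rho> where "\<rho> = V * \<tau>"
    have Q: "Q \<ge> V" "Q > 0"
    proof -
      show "Q > 0" using V1 s by (metis less_le_trans zero_less_mult_pos2 zero_less_one)
      then show "Q \<ge> V" using s by (simp add: V_def)
    qed
    have Q1: "1 \<le> Q" using Q(1) V1 by (simp add: V_def)
    note ctx = V1[folded V_def] \<sigma> U_def \<delta>(1) \<delta>U[folded V_def, folded U_def] t t'_def[THEN meta_eq_to_obj_eq] Q(1) m \<tau>_def \<rho>_def
    note Upos = bootstrap_U_pos[OF ctx]
    note tau = bootstrap_tau_bounds[OF ctx] and rho1 = bootstrap_rho_ge_1[OF ctx] and st = bootstrap_sigma_tau_le[OF ctx]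
      and drs = bootstrap_delta_over_rho_sigma[OF ctx] and rsd = bootstrap_rho_sigma_over_delta[OF ctx]
      and b1 = bootstrap_term1[OF ctx] and b2 = bootstrap_term2[OF ctx] and b3 = bootstrap_term3[OF ctx]
    let ?m = "CARD('m)"
    obtain r where r: "\<And>c. c \<in> cell \<tau> ` x ` T \<Longrightarrow> r c \<in> T \<and> cell \<tau> (x (r c)) = c"
      using cell_representatives by metis
    let ?I = "cell \<tau> ` x ` T"
    have finI: "finite ?I" and cI0: "real (card ?I) \<le> (2 * L / \<tau> + 2) ^ ?m"
      using finite_cells[OF tau(1)] by auto
    have cI: "real (card ?I) \<le> (4 * L) ^ ?m / \<tau> ^ ?m"
    proof -
      have "2 * L / \<tau> + 2 \<le> 4 * L / \<tau>" using tau L by (simp add: field_simps)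
      then have "(2 * L / \<tau> + 2) ^ ?m \<le> (4 * L / \<tau>) ^ ?m" using tau L by (intro power_mono) auto
      with cI0 show ?thesis by (simp add: power_divide)
    qed
    define \<rho>0 where "\<rho>0 = (1 + 2 * m) * \<rho>"
    define \<delta>0 where "\<delta>0 = C1 * \<delta>"
    have \<rho>0: "\<rho>0 \<ge> \<rho>" using rho1 m1 by (simp add: \<rho>0_def)
    have \<delta>0: "\<delta>0 \<ge> \<delta>" using \<delta> C1 by (simp add: \<delta>0_def)
    have cov1: "1 / 2 + 2 * Q * s * (real CARD('m) * \<tau>) \<le> \<rho>0"
      using rho1 by (simp add: \<rho>0_def \<rho>_def V_def m_def algebra_simps)
    have cov2: "\<delta> + 2 * Q * s * \<sigma> * L * (real CARD('m) * \<tau>)\<^sup>2 + \<sigma> * L * (real CARD('m) * \<tau>) * (1 / 2) \<le> \<delta>0"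
    proof -
      have "2 * Q * s * \<sigma> * L * (real CARD('m) * \<tau>)\<^sup>2 = 2 * L * m\<^sup>2 * (U * \<tau>\<^sup>2)"
        by (simp add: U_def V_def m_def power_mult_distrib)
      also have "U * \<tau>\<^sup>2 = \<delta>" using tau(3) Upos by simp
      finally have a: "2 * Q * s * \<sigma> * L * (real CARD('m) * \<tau>)\<^sup>2 = 2 * L * m\<^sup>2 * \<delta>" .
      have "\<sigma> * L * (real CARD('m) * \<tau>) * (1 / 2) = L * m * (1 / 2) * (\<sigma> * \<tau>)" by (simp add: m_def)
      also have "\<dots> \<le> L * m * 1 * \<delta>" using st L m1 tau \<sigma> by (intro mult_mono) auto
      finally show ?thesis unfolding a by (simp add: \<delta>0_def C1_def algebra_simps)
    qed
    let ?P = "\<lambda>c. tbox x y u s \<sigma> (2 * Q) \<rho>0 \<delta>0 (r c)"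
    let ?D = "\<lambda>c. tbox y x v \<sigma> s (1 / \<delta>) (1 / (2 * \<rho>)) (1 / Q) (r c)"
    have "real (card (near_points T x y u s \<sigma> \<delta> Q)) \<le> real (card (\<Union>c\<in>?I. ?P c))"
      by (intro of_nat_mono card_mono near_points_cover[OF tau(1) s(1) \<sigma>(1) Q(2) \<delta>(1) r cov1 cov2] finite_UN_I[OF finI] finite_tbox)
        (use \<rho>0 \<delta>0 rho1 \<delta> Q in auto)
    also have "\<dots> \<le> (\<Sum>c\<in>?I. real (card (?P c)))"
      unfolding of_nat_sum[symmetric] by (intro of_nat_mono card_UN_le finI)
    also have "\<dots> \<le> (\<Sum>c\<in>?I. Ct * (2 * Q * \<rho>0 ^ ?m * \<delta>0) * real (card (?D c)))"
    proof (intro sum_mono)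
      fix c assume c: "c \<in> ?I"
      have "real (card (?P c)) \<le> Ct * (2 * Q * \<rho>0 ^ ?m * \<delta>0) *
          real (card (tbox y x v \<sigma> s (1 / (9 * \<delta>0)) (1 / (9 * \<rho>0)) (1 / (9 * (2 * Q))) (r c)))"
        unfolding Ct_def m_def by (rule tbox_transference) (use r[OF c] Q \<rho>0 \<delta>0 rho1 \<delta> in auto)
      \<comment> \<open>The polar sides are rounded up to \<open>1 / \<delta>\<close>,
        \<open>1 / (2 * \<rho>)\<close> and \<open>1 / Q\<close>; the middle one stays at most
        \<open>1 / 2\<close> because \<open>\<rho> \<ge> 1\<close>.\<close>
      also have "\<dots> \<le> Ct * (2 * Q * \<rho>0 ^ ?m * \<delta>0) * real (card (?D c))"
      proof (intro mult_left_mono of_nat_mono card_mono finite_tbox)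
        show "tbox y x v \<sigma> s (1 / (9 * \<delta>0)) (1 / (9 * \<rho>0)) (1 / (9 * (2 * Q))) (r c) \<subseteq> ?D c"
          unfolding tbox_def using Q \<rho>0 \<delta>0 rho1 \<delta> by (intro lbox_mono divide_left_mono) auto
      qed (use Q \<rho>0 \<delta>0 rho1 \<delta> Ct in auto)
      finally show "real (card (?P c)) \<le> Ct * (2 * Q * \<rho>0 ^ ?m * \<delta>0) * real (card (?D c))" .
    qed
    also have "\<dots> = K * (Q * \<rho> ^ ?m * \<delta>) * (\<Sum>c\<in>?I. real (card (?D c)))"
      by (simp add: sum_distrib_left[symmetric] K_def \<rho>0_def \<delta>0_def power_mult_distrib)
    also have "\<dots> \<le> K * (Q * \<rho> ^ ?m * \<delta>) * ((4 * L) ^ ?m / \<tau> ^ ?m * (3 * (L / (\<rho> * \<sigma>) + 1)) +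
        C2 * ((\<sigma> / \<delta>) ^ ?m * (1 / \<delta> * (1 / Q) + sqrt (1 / (\<delta> * U)) + (1 / \<delta>) powr t * \<sigma> powr (t - 1))))"
    proof (rule mult_left_mono)
      have "\<rho> * \<sigma> * \<tau> = \<delta>" using drs rho1 \<sigma> by (simp add: field_simps)
      then have "1 / (2 * \<rho>) / (\<sigma> * \<tau>) = 1 / 2 * (1 / \<delta>)" by (auto simp: mult.assoc)
      then have R: "1 / (2 * \<rho>) / (\<sigma> * \<tau>) \<le> 1 / 2 * (1 / \<delta>)" by (rule eq_refl)
      have inj: "inj_on (\<lambda>c. cell \<tau> (x (r c))) ?I"
        using r by (intro inj_onI) metis
      have dQ: "1 / \<delta> * (1 / Q) / (\<sigma> * s) = 1 / (\<delta> * U)" by (simp add: U_def V_def)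
      have "(\<Sum>c\<in>?I. real (card (?D c))) \<le>
         real (card ?I) * ((2 * (1 / (2 * \<rho>) * L / \<sigma>) + 1) * (2 * (1 / Q) + 1)) +
         C2 * ((1 / \<delta> * \<sigma>) ^ ?m * (1 / \<delta> * (1 / Q) + sqrt (1 / \<delta> * (1 / Q) / (\<sigma> * s)) + (1 / \<delta>) powr t * \<sigma> powr (t - 1)))"
        by (rule dual_sum) (use finI r inj tau s \<sigma> rho1 Q \<delta> R in \<open>auto simp: field_simps\<close>)
      also have "\<dots> \<le> (4 * L) ^ ?m / \<tau> ^ ?m * (3 * (L / (\<rho> * \<sigma>) + 1)) +
         C2 * ((\<sigma> / \<delta>) ^ ?m * (1 / \<delta> * (1 / Q) + sqrt (1 / (\<delta> * U)) + (1 / \<delta>) powr t * \<sigma> powr (t - 1)))"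
      proof (rule add_mono)
        have "1 / Q \<le> 1" using Q1 by simp
        moreover have "2 * (1 / (2 * \<rho>) * L / \<sigma>) = L / (\<rho> * \<sigma>)" using rho1 \<sigma> by (simp add: field_simps)
        moreover have nn: "L / (\<rho> * \<sigma>) \<ge> 0" using rho1 \<sigma> L by simp
        ultimately have "(2 * (1 / (2 * \<rho>) * L / \<sigma>) + 1) * (2 * (1 / Q) + 1) \<le> (L / (\<rho> * \<sigma>) + 1) * 3"
          by (intro mult_mono) (use Q in \<open>auto simp: divide_le_eq\<close>)
        then have f: "(2 * (1 / (2 * \<rho>) * L / \<sigma>) + 1) * (2 * (1 / Q) + 1) \<le> 3 * (L / (\<rho> * \<sigma>) + 1)" by simp
        show "real (card ?I) * ((2 * (1 / (2 * \<rho>) * L / \<sigma>) + 1) * (2 * (1 / Q) + 1)) \<le> (4 * L) ^ ?m / \<tau> ^ ?m * (3 * (L / (\<rho> * \<sigma>) + 1))"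
          by (rule mult_mono[OF cI f]) (use L tau Q rho1 \<sigma> in auto)
        have e: "1 / \<delta> * \<sigma> = \<sigma> / \<delta>" by simp
        show "C2 * ((1 / \<delta> * \<sigma>) ^ ?m * (1 / \<delta> * (1 / Q) + sqrt (1 / \<delta> * (1 / Q) / (\<sigma> * s)) + (1 / \<delta>) powr t * \<sigma> powr (t - 1)))
           \<le> C2 * ((\<sigma> / \<delta>) ^ ?m * (1 / \<delta> * (1 / Q) + sqrt (1 / (\<delta> * U)) + (1 / \<delta>) powr t * \<sigma> powr (t - 1)))"
          unfolding dQ e by (rule order_refl)
      qed
      finally show "(\<Sum>c\<in>?I. real (card (?D c))) \<le> \<dots>" .
    qed (use K Q rho1 \<delta> in auto)
    also have "\<dots> = K * (3 * (4 * L) ^ ?m * (Q * (\<rho> / \<tau>) ^ ?m * (L * (\<delta> / (\<rho> * \<sigma>)) + \<delta>)) +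
        C2 * (Q * (\<delta> * \<rho> ^ ?m * (\<sigma> / \<delta>) ^ ?m) * (1 / \<delta> * (1 / Q) + sqrt (1 / (\<delta> * U)) + (1 / \<delta>) powr t * \<sigma> powr (t - 1))))"
      by (simp add: power_divide algebra_simps add_divide_distrib)
    \<comment> \<open>The number of cells, of order \<open>\<tau> ^ (- m)\<close>, combines with
      \<open>\<rho> ^ m\<close> to \<open>V ^ m\<close>, as
      \<open>\<rho> = V * \<tau>\<close>.\<close>
    also have "\<dots> = K * (3 * (4 * L) ^ ?m * (Q * V ^ ?m * (L * \<tau> + \<delta>)) +
        C2 * (Q * V ^ ?m * (\<delta> / \<rho> ^ ?m * (1 / \<delta> * (1 / Q)) + \<delta> / \<rho> ^ ?m * sqrt (1 / (\<delta> * U)) +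
           \<delta> / \<rho> ^ ?m * ((1 / \<delta>) powr t * \<sigma> powr (t - 1)))))"
    proof -
      have "\<rho> / \<tau> = V" using tau by (simp add: \<rho>_def)
      then show ?thesis unfolding rsd drs by (simp add: algebra_simps)
    qed
    also have "\<dots> \<le> K * (3 * (4 * L) ^ ?m * (Q * V ^ ?m * (L * (\<delta> + \<tau> + V powr (t' - 1)))) +
        C2 * (Q * V ^ ?m * (V powr (t' - 1) + \<tau> + V powr (t' - 1))))"
    proof -
      have "\<delta> \<le> L * \<delta>" "0 \<le> L * V powr (t' - 1)" using mult_right_mono[OF L, of \<delta>] \<delta> L by auto
      then have "L * \<tau> + \<delta> \<le> L * (\<delta> + \<tau> + V powr (t' - 1))"
        unfolding distrib_left by linarith
      then show ?thesis
        by (intro mult_left_mono add_mono b1 b3 b2[folded \<tau>_def]) (use K L Q C2 V1 in \<open>auto simp: V_def\<close>)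
    qed
    also have "\<dots> \<le> K * (3 * (4 * L) ^ ?m * (Q * V ^ ?m * (L * (\<delta> + \<tau> + V powr (t' - 1)))) +
        C2 * (Q * V ^ ?m * (2 * (\<delta> + \<tau> + V powr (t' - 1)))))"
      by (intro mult_left_mono add_mono order_refl) (use K Q C2 V1 \<delta> tau in \<open>auto simp: V_def\<close>)
    also have "\<dots> = C * (Q * V ^ ?m * (\<delta> + \<tau> + V powr (t' - 1)))"
      by (simp add: C_def algebra_simps)
    finally show ?thesis by (simp add: V_def U_def \<tau>_def)
  qed
  ultimately show ?thesis by (intro exI[of _ C]) auto
qed

end

lemma near_points_mono:
  "\<delta> \<le> \<delta>' \<Longrightarrow> near_points T x y u s \<sigma> \<delta> Q \<subseteq> near_points T x y u s \<sigma> \<delta>' Q"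
  by (auto simp: near_points_def tbox_def lbox_def)

context legendre
begin

lemma counting_bound_1: "counting_bound 1 T x y u"
proof -
  obtain C where C: "C > 0" and b: "\<And>s \<sigma> \<delta> Q. 0 < s \<and> s \<le> 1 \<and> 0 < \<sigma> \<and> \<sigma> \<le> 1 \<and> 0 < \<delta> \<and> 1 \<le> Q \<Longrightarrow>
     real (card (near_points T x y u s \<sigma> \<delta> Q)) \<le> C * (Q * (Q * s) ^ CARD('m) * (1 + \<delta>))"
    using near_points_trivial by blast
  have "real (card (near_points T x y u s \<sigma> \<delta> Q)) \<le>
       C * (Q * (Q * s) ^ CARD('m) * (\<delta> + sqrt (\<delta> / (Q * s * \<sigma>)) + (Q * s) powr (1 - 1)))"
    if h: "0 < s \<and> s \<le> 1 \<and> 0 < \<sigma> \<and> \<sigma> \<le> 1 \<and> 0 < \<delta> \<and> 1 \<le> Q" for s \<sigma> \<delta> Q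
    by (rule order_trans[OF b[OF h]], intro mult_left_mono) (use h C in auto)
  then show ?thesis unfolding counting_bound_def using C by blast
qed

text \<open>Outside the range of \<open>bootstrap_core\<close> either one of the three error terms
  is at least \<open>1\<close>, so that the trivial bound suffices, or \<open>\<delta>\<close> is so
  small that it may be raised to the lower end of the range.\<close>

lemma counting_bound_bootstrap:
  assumes m: "CARD('m) \<ge> 2" and t: "t > 0" "t \<le> 1" and cb: "counting_bound t T y x v"
  shows "counting_bound (t / (1 + t)) T x y u"
proof -
  define t' where "t' = t / (1 + t)"
  have t': "0 < t'" "t' < 1" using t by (auto simp: t'_def)
  obtain C0 where C0: "C0 > 0" and b0: "\<And>s \<sigma> \<delta> Q. 0 < s \<and> s \<le> 1 \<and> 0 < \<sigma> \<and> \<sigma> \<le> 1 \<and> 0 < \<delta> \<and> 1 \<le> Q \<Longrightarrow>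
     real (card (near_points T x y u s \<sigma> \<delta> Q)) \<le> C0 * (Q * (Q * s) ^ CARD('m) * (1 + \<delta>))"
    using near_points_trivial by blast
  obtain C1 where C1: "C1 > 0" and b1: "\<And>s \<sigma> \<delta> Q. 0 < s \<and> s \<le> 1 \<and> 0 < \<sigma> \<and> \<sigma> \<le> 1 \<and> 0 < \<delta> \<and> \<delta> \<le> 1 \<and> 1 \<le> Q * s \<and>
      \<delta> \<le> Q * s * \<sigma> \<and> (Q * s) powr (t' - 2) * (Q * s * \<sigma>) \<le> \<delta> \<Longrightarrow>
     real (card (near_points T x y u s \<sigma> \<delta> Q)) \<le>
       C1 * (Q * (Q * s) ^ CARD('m) * (\<delta> + sqrt (\<delta> / (Q * s * \<sigma>)) + (Q * s) powr (t' - 1)))"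
    using bootstrap_core[OF m t(1) cb] unfolding t'_def by blast
  define C where "C = 2 * C0 + 3 * C1"
  have C: "C > 0" "C \<ge> 2 * C0" "C \<ge> 3 * C1" using C0 C1 by (auto simp: C_def)
  have "real (card (near_points T x y u s \<sigma> \<delta> Q)) \<le>
       C * (Q * (Q * s) ^ CARD('m) * (\<delta> + sqrt (\<delta> / (Q * s * \<sigma>)) + (Q * s) powr (t' - 1)))"
    if h: "0 < s \<and> s \<le> 1 \<and> 0 < \<sigma> \<and> \<sigma> \<le> 1 \<and> 0 < \<delta> \<and> 1 \<le> Q" for s \<sigma> \<delta> Q
  proof -
    define V U where "V = Q * s" and "U = V * \<sigma>"
    have V: "V > 0" and U: "U > 0" using h by (auto simp: V_def U_def)
    define B where "B = Q * V ^ CARD('m)"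
    have B: "B > 0" using h V by (simp add: B_def)
    have sq: "sqrt (\<delta> / U) \<ge> 0" using U h by simp
    have d: "\<delta> > 0" using h by simp
    have triv: ?thesis if "1 \<le> \<delta> \<or> 1 \<le> sqrt (\<delta> / U) \<or> 1 \<le> V powr (t' - 1)"
    proof -
      have "1 + \<delta> \<le> 2 * (\<delta> + b + c)" if "1 \<le> \<delta> \<or> 1 \<le> b \<or> 1 \<le> c" "b \<ge> 0" "c \<ge> 0" for b c :: real
        using that d by auto
      from this[OF that] have le: "1 + \<delta> \<le> 2 * (\<delta> + sqrt (\<delta> / U) + V powr (t' - 1))" using sq by simp
      have "real (card (near_points T x y u s \<sigma> \<delta> Q)) \<le> C0 * (B * (1 + \<delta>))"
        using b0[OF h] by (simp add: B_def V_def)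
      also have "\<dots> \<le> C0 * (B * (2 * (\<delta> + sqrt (\<delta> / U) + V powr (t' - 1))))"
        using le C0 B by (intro mult_left_mono) auto
      also have "\<dots> = 2 * C0 * (B * (\<delta> + sqrt (\<delta> / U) + V powr (t' - 1)))" by simp
      also have "\<dots> \<le> C * (B * (\<delta> + sqrt (\<delta> / U) + V powr (t' - 1)))"
        using C B h sq by (intro mult_right_mono) auto
      finally show ?thesis by (simp add: B_def V_def U_def)
    qed
    consider "V < 1" | "\<delta> > 1" | "\<delta> > U" | "V \<ge> 1" "\<delta> \<le> 1" "\<delta> \<le> U" "V powr (t' - 2) * U \<le> \<delta>"
      | "V \<ge> 1" "\<delta> \<le> 1" "\<delta> \<le> U" "\<delta> < V powr (t' - 2) * U" by linarith
    then show ?thesis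
    proof cases
      case 1
      have "V powr 0 \<le> V powr (t' - 1)" using 1 V t' by (intro powr_mono') auto
      then show ?thesis using V by (intro triv) simp
    next
      case 2
      then show ?thesis by (intro triv) simp
    next
      case 3
      then have "sqrt (\<delta> / U) \<ge> 1" using U by simp
      then show ?thesis by (intro triv) simp
    next
      case 4
      have "real (card (near_points T x y u s \<sigma> \<delta> Q)) \<le> C1 * (B * (\<delta> + sqrt (\<delta> / U) + V powr (t' - 1)))"
        using b1[of s \<sigma> \<delta> Q] h 4 by (simp add: B_def V_def U_def)
      also have "\<dots> \<le> C * (B * (\<delta> + sqrt (\<delta> / U) + V powr (t' - 1)))"
        using C C1 B h sq by (intro mult_right_mono) auto
      finally show ?thesis by (simp add: B_def V_def U_def)
    next
      case 5
      \<comment> \<open>At this tolerance \<open>\<delta>1\<close> and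
        \<open>sqrt (\<delta>1 / U) = V powr ((t' - 2) / 2)\<close> are both at most the error
        \<open>V powr (t' - 1)\<close>, so the increase costs only a constant.\<close>
      define \<delta>1 where "\<delta>1 = V powr (t' - 2) * U"
      have "\<delta>1 = V powr (t' - 2) * V powr 1 * \<sigma>" using V by (simp add: \<delta>1_def U_def)
      also have "V powr (t' - 2) * V powr 1 = V powr (t' - 1)" unfolding powr_add[symmetric] by simp
      finally have e1: "\<delta>1 = V powr (t' - 1) * \<sigma>" .
      have d0: "\<delta>1 > 0" using U V by (simp add: \<delta>1_def)
      have le1: "V powr (t' - 1) \<le> V powr 0" "V powr (t' - 2) \<le> V powr 0"
        using 5 t' by (intro powr_mono; simp)+
      have d1: "\<delta>1 \<le> V powr (t' - 1)" using h by (simp add: e1 mult_left_le)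
      then have d2: "\<delta>1 \<le> 1" using le1 V by simp
      have d3: "\<delta>1 \<le> U" using le1(2) U V by (simp add: \<delta>1_def mult_left_le_one_le)
      have d4: "sqrt (\<delta>1 / U) \<le> V powr (t' - 1)"
      proof -
        have "sqrt (\<delta>1 / U) = sqrt (V powr (t' - 2))" using U by (simp add: \<delta>1_def)
        also have "\<dots> = V powr ((t' - 2) * (1 / 2))" using V by (simp add: powr_half_sqrt[symmetric] powr_powr)
        also have "\<dots> \<le> V powr (t' - 1)" using 5 t' by (intro powr_mono) auto
        finally show ?thesis .
      qed
      have "real (card (near_points T x y u s \<sigma> \<delta> Q)) \<le> real (card (near_points T x y u s \<sigma> \<delta>1 Q))"
        using 5 h d0 by (intro of_nat_mono card_mono near_points_mono finite_near_points) (auto simp: \<delta>1_def)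
      also have "\<dots> \<le> C1 * (B * (\<delta>1 + sqrt (\<delta>1 / U) + V powr (t' - 1)))"
        using b1[of s \<sigma> \<delta>1 Q] h 5 d0 d2 d3 by (simp add: B_def V_def U_def \<delta>1_def)
      also have "\<dots> \<le> C1 * (B * (3 * V powr (t' - 1)))"
        using d1 d4 C1 B by (intro mult_left_mono) auto
      also have "\<dots> = (3 * C1) * (B * V powr (t' - 1))" by simp
      also have "\<dots> \<le> C * (B * (\<delta> + sqrt (\<delta> / U) + V powr (t' - 1)))"
        using C C1 B h sq by (intro mult_mono mult_left_mono) auto
      finally show ?thesis by (simp add: B_def V_def U_def)
    qed
  qed
  then show ?thesis unfolding counting_bound_def t'_def[symmetric] using C(1) by blast
qed

end

text \<open>The map from \<open>t\<close> to \<open>t / (1 + t)\<close> adds \<open>1\<close> to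
  \<open>1 / t\<close>. Every step appeals to the dual, so the induction has to be over all contact
  data at once.\<close>

lemma legendre_counting_bound:
  fixes x y :: "'a \<Rightarrow> real ^ 'm::finite"
  assumes "legendre L T x y u v" and m: "CARD('m) \<ge> 2"
  shows "counting_bound (1 / (real k + 1)) T x y u"
  using assms(1)
proof (induction k arbitrary: x y u v)
  case 0
  then show ?case using legendre.counting_bound_1 by fastforce
next
  case (Suc k)
  have "counting_bound (1 / (real k + 1)) T y x v"
    by (rule Suc.IH[OF legendre.dual[OF Suc.prems]])
  from legendre.counting_bound_bootstrap[OF Suc.prems m _ _ this]
  have "counting_bound (1 / (real k + 1) / (1 + 1 / (real k + 1))) T x y u" by (simp add: field_simps)
  moreover have "1 / (real k + 1) / (1 + 1 / (real k + 1)) = 1 / (real (Suc k) + 1)"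
    by (simp add: field_simps)
  ultimately show ?case by simp
qed

section \<open>Smooth homogeneous functions\<close>

definition grad :: "(real ^ 'm \<Rightarrow> real) \<Rightarrow> real ^ 'm \<Rightarrow> real ^ 'm::finite" where
  "grad f x = (\<chi> i. partial_deriv i f x)"

lemma partial_deriv_eq:
  assumes "(f has_derivative f') (at x)"
  shows "partial_deriv i f x = f' (axis i 1)"
proof -
  have 1: "((\<lambda>t. f (x + t *\<^sub>R axis i 1)) has_derivative (\<lambda>t. f' (t *\<^sub>R axis i 1))) (at 0)"
    by (rule has_derivative_compose[of "\<lambda>t. x + t *\<^sub>R axis i 1"]) (auto intro!: derivative_eq_intros assms)
  have "f' (t *\<^sub>R axis i 1) = t * f' (axis i 1)" for t
    using has_derivative_linear[OF assms] by (simp add: linear_cmul)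
  then have "(\<lambda>t. f' (t *\<^sub>R axis i 1)) = (*) (f' (axis i 1))" by (auto simp: mult.commute)
  with 1 have "((\<lambda>t. f (x + t *\<^sub>R axis i 1)) has_field_derivative f' (axis i 1)) (at 0)"
    by (simp only: has_field_derivative_def)
  then show ?thesis unfolding partial_deriv_def by (rule DERIV_imp_deriv)
qed

lemma has_derivative_grad:
  assumes "(f has_derivative f') (at x)"
  shows "f' h = grad f x \<bullet> h"
proof -
  have "f' h = f' (\<Sum>i\<in>UNIV. h $ i *\<^sub>R axis i 1)"
    by (simp add: basis_expansion[of h, unfolded scalar_mult_eq_scaleR])
  also have "\<dots> = (\<Sum>i\<in>UNIV. h $ i * f' (axis i 1))"
    using has_derivative_linear[OF assms] by (simp add: linear_sum linear_cmul)
  also have "\<dots> = grad f x \<bullet> h"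
    by (simp add: inner_vec_def grad_def partial_deriv_eq[OF assms] mult.commute)
  finally show ?thesis .
qed

text \<open>The row index of \<open>hessian\<close> belongs to the outer derivative, so the
  derivative of the gradient is the transposed matrix. The transpose has the same determinant, which
  is all that nondegeneracy refers to.\<close>

lemma smooth_on_grad:
  fixes f :: "real ^ 'm::finite \<Rightarrow> real"
  assumes S: "open S" and C2: "C_on 2 S f" and x: "x \<in> S"
  shows "(f has_derivative (\<lambda>h. grad f x \<bullet> h)) (at x)"
    and "(grad f has_derivative (\<lambda>h. transpose (hessian f x) *v h)) (at x)"
    and "continuous_on S (\<lambda>x. hessian f x $ i $ j)"
proof -
  have C2': "C_on (Suc (Suc 0)) S f" using C2 by (simp add: numeral_2_eq_2)
  have f1: "(f has_derivative frechet_derivative f (at z)) (at z)" if "z \<in> S" for z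
    using C2' that by (simp add: frechet_derivative_works)
  then show 1: "(f has_derivative (\<lambda>h. grad f x \<bullet> h)) (at x)"
    using has_derivative_grad[OF f1[OF x]] f1[OF x] x by (metis (no_types, lifting) ext)
  define G where "G = (\<lambda>j z. frechet_derivative f (at z) (axis j 1))"
  have G: "(G j has_derivative frechet_derivative (G j) (at z)) (at z)" if "z \<in> S" for z j
    using C2' that by (simp add: frechet_derivative_works G_def)
  have Gc: "continuous_on S (\<lambda>z. frechet_derivative (G j) (at z) h)" for j h
    using C2' by (simp add: G_def)
  have pd: "partial_deriv j f z = G j z" if "z \<in> S" for j z
    unfolding G_def by (rule partial_deriv_eq[OF f1[OF that]])
  have P: "(partial_deriv j f has_derivative frechet_derivative (G j) (at z)) (at z)" if "z \<in> S" for j z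
    by (rule has_derivative_transform_within_open[OF G[OF that] S that]) (simp add: pd)
  have H: "hessian f z $ i $ j = frechet_derivative (G j) (at z) (axis i 1)" if "z \<in> S" for i j z
    by (simp add: hessian_def partial_deriv_eq[OF P[OF that]])
  show "continuous_on S (\<lambda>x. hessian f x $ i $ j)"
    using Gc by (simp add: H cong: continuous_on_cong)
  have "(transpose (hessian f x) *v h) $ j = frechet_derivative (G j) (at x) h" for h j
  proof -
    have "grad (partial_deriv j f) x \<bullet> h = frechet_derivative (G j) (at x) h"
      by (rule has_derivative_grad[OF P[OF x], symmetric])
    then show ?thesis
      by (simp add: matrix_vector_mult_def transpose_def inner_vec_def grad_def hessian_def)
  qed
  then show "(grad f has_derivative (\<lambda>h. transpose (hessian f x) *v h)) (at x)"
    unfolding has_derivative_componentwise_within[of "grad f"]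
    using P[OF x] by (auto simp: Basis_vec_def inner_axis grad_def)
qed

text \<open>Differentiate \<open>f (l *\<^sub>R z) = l powr d * f z\<close> at \<open>x\<close> in
  two ways and evaluate in the direction \<open>grad f (l *\<^sub>R x)\<close>: this vector is
  orthogonal to itself.\<close>

lemma homogeneous_grad_eq_0:
  fixes f :: "real ^ 'm::finite \<Rightarrow> real"
  assumes f: "f \<in> homogeneous d" and l: "l > 0" and d: "(f has_derivative (\<lambda>h. grad f x \<bullet> h)) (at x)"
    "(f has_derivative (\<lambda>h. grad f (l *\<^sub>R x) \<bullet> h)) (at (l *\<^sub>R x))" and 0: "grad f x = 0"
  shows "grad f (l *\<^sub>R x) = 0"
proof -
  have "((\<lambda>z. f (l *\<^sub>R z)) has_derivative (\<lambda>h. grad f (l *\<^sub>R x) \<bullet> (l *\<^sub>R h))) (at x)"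
    by (rule has_derivative_compose[where f = "\<lambda>z. l *\<^sub>R z" and g = f and f' = "\<lambda>h. l *\<^sub>R h"])
      (use d(2) in \<open>auto intro!: derivative_eq_intros\<close>)
  moreover have "((\<lambda>z. f (l *\<^sub>R z)) has_derivative (\<lambda>h. l powr d * (grad f x \<bullet> h))) (at x)"
  proof -
    have "(\<lambda>z. f (l *\<^sub>R z)) = (\<lambda>z. l powr d * f z)" using f l by (auto simp: homogeneous_def)
    then show ?thesis using has_derivative_mult_right[OF d(1), of "l powr d"] by simp
  qed
  ultimately have "(\<lambda>h. grad f (l *\<^sub>R x) \<bullet> (l *\<^sub>R h)) = (\<lambda>h. l powr d * (grad f x \<bullet> h))"
    by (rule has_derivative_unique)
  then have "grad f (l *\<^sub>R x) \<bullet> (l *\<^sub>R grad f (l *\<^sub>R x)) = 0" using 0 by (metis inner_zero_left mult_zero_right)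
  then show ?thesis using l by simp
qed

text \<open>The quantitative core of the inverse function theorem. If \<open>B\<close> bounds the
  Hessian at \<open>x\<close> from below, then near \<open>x\<close> the gradient minus this linear
  map has Lipschitz constant at most \<open>B / 2\<close>, so half of the lower bound
  survives.\<close>

lemma grad_local_bilipschitz:
  fixes f :: "real ^ 'm::finite \<Rightarrow> real"
  assumes S: "open S" and C2: "C_on 2 S f" and x: "x \<in> S" and det: "det (hessian f x) \<noteq> 0"
  shows "\<exists>e>0. \<exists>K>0. \<exists>\<beta>>0. ball x e \<subseteq> S \<and> (\<forall>p\<in>ball x e. \<forall>q\<in>ball x e.
     norm (grad f p - grad f q) \<le> K * norm (p - q) \<and> \<beta> * norm (p - q) \<le> norm (grad f p - grad f q) \<and>
     \<bar>f p - f q - grad f q \<bullet> (p - q)\<bar> \<le> K * (norm (p - q))\<^sup>2)"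
proof -
  let ?H = "\<lambda>z. transpose (hessian f z)"
  have "invertible (?H x)" using det by (simp add: invertible_det_nz det_transpose)
  then have "inj ((*v) (?H x))" by (simp add: inj_matrix_vector_mult)
  then obtain B where B: "B > 0" "\<And>h. B * norm h \<le> norm (?H x *v h)"
    using linear_inj_bounded_below_pos[OF matrix_vector_mul_linear] by metis
  define m where "m = real CARD('m)"
  have m: "m > 0" by (simp add: m_def)
  \<comment> \<open>A square matrix of size \<open>m\<close> with entries at most
    \<open>\<eta>\<close> has operator norm at most \<open>m * m * \<eta>\<close>, here
    \<open>B / 2\<close>.\<close>
  define \<eta> where "\<eta> = B / (2 * (m * m))"
  have \<eta>: "\<eta> > 0" using B m by (simp add: \<eta>_def)
  have "\<exists>e>0. \<forall>z\<in>S. dist z x < e \<longrightarrow> dist (hessian f z $ i $ j) (hessian f x $ i $ j) < \<eta>" for i j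
    using smooth_on_grad(3)[OF S C2 x, of i j] x \<eta> unfolding continuous_on_iff by blast
  then obtain e0 where e0: "\<And>i j. e0 i j > 0" "\<And>i j z. z \<in> S \<Longrightarrow> dist z x < e0 i j \<Longrightarrow> dist (hessian f z $ i $ j) (hessian f x $ i $ j) < \<eta>"
    by metis
  obtain e1 where e1: "e1 > 0" "ball x e1 \<subseteq> S" using S x open_contains_ball by blast
  define e where "e = Min (insert e1 (range (\<lambda>(i, j). e0 i j)))"
  have "e \<le> z" if "z \<in> insert e1 (range (\<lambda>(i, j). e0 i j))" for z
    using that unfolding e_def by (intro Min_le) auto
  from this[of e1] this[of "e0 i j" for i j] have e: "e > 0" "e \<le> e1" "e \<le> e0 i j" for i j
    using e0(1) e1(1) by (auto simp: e_def image_iff split: prod.splits)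
  have eS: "ball x e \<subseteq> S" using e1(2) e(2) by auto
  have on: "onorm (\<lambda>h. ?H z *v h - ?H x *v h) \<le> B / 2" if z: "z \<in> ball x e" for z
  proof -
    have "\<bar>(?H z - ?H x) $ i $ j\<bar> \<le> \<eta>" for i j
      using e0(2)[of z j i] e(3)[of j i] z eS by (auto simp: transpose_def dist_real_def dist_commute)
    then have "onorm ((*v) (?H z - ?H x)) \<le> m * m * \<eta>"
      unfolding m_def by (rule onorm_le_matrix_component)
    also have "m * m * \<eta> = B / 2" using m by (simp add: \<eta>_def)
    also have "(*v) (?H z - ?H x) = (\<lambda>h. ?H z *v h - ?H x *v h)"
      by (intro ext) (rule matrix_vector_mult_diff_rdistrib)
    finally show ?thesis .
  qed
  have close: "norm (grad f p - grad f q - ?H x *v (p - q)) \<le> B / 2 * norm (p - q)"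
    if p: "p \<in> ball x e" "q \<in> ball x e" for p q
  proof -
    have "norm ((grad f p - ?H x *v p) - (grad f q - ?H x *v q)) \<le> B / 2 * norm (p - q)"
    proof (rule differentiable_bound[where S = "ball x e" and f' = "\<lambda>z h. ?H z *v h - ?H x *v h"])
      fix z assume z: "z \<in> ball x e"
      then have "(grad f has_derivative (*v) (?H z)) (at z)"
        by (intro smooth_on_grad(2)[OF S C2] subsetD[OF eS])
      then show "((\<lambda>z. grad f z - ?H x *v z) has_derivative (\<lambda>h. ?H z *v h - ?H x *v h)) (at z within ball x e)"
        by (rule has_derivative_diff[OF has_derivative_at_withinI linear_imp_has_derivative[OF matrix_vector_mul_linear]])
    qed (use p on in auto)
    then show ?thesis by (simp add: matrix_vector_mult_diff_distrib algebra_simps)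
  qed
  define K where "K = onorm ((*v) (?H x)) + B / 2"
  have bl: "bounded_linear ((*v) (?H x))" by (simp add: linear_linear matrix_vector_mul_linear)
  have K: "K > 0" using onorm_pos_le[OF bl] B by (simp add: K_def)
  have lip: "norm (grad f p - grad f q) \<le> K * norm (p - q)" if p: "p \<in> ball x e" "q \<in> ball x e" for p q
  proof -
    have "norm (?H x *v (p - q)) \<le> onorm ((*v) (?H x)) * norm (p - q)" by (rule onorm[OF bl])
    then show ?thesis using close[OF p] norm_triangle_sub[of "grad f p - grad f q" "?H x *v (p - q)"]
      by (simp add: K_def distrib_right)
  qed
  have low: "B / 2 * norm (p - q) \<le> norm (grad f p - grad f q)" if p: "p \<in> ball x e" "q \<in> ball x e" for p q
    using close[OF p] B(2)[of "p - q"] norm_triangle_ineq2[of "?H x *v (p - q)" "grad f p - grad f q"]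
    by (simp add: norm_minus_commute)
  have taylor: "\<bar>f p - f q - grad f q \<bullet> (p - q)\<bar> \<le> K * (norm (p - q))\<^sup>2" if p: "p \<in> ball x e" "q \<in> ball x e" for p q
  proof -
    \<comment> \<open>Mean value inequality for \<open>f\<close> minus its linearization at
      \<open>q\<close>: along the segment the gradient of this difference is at most
      \<open>K * norm (p - q)\<close>.\<close>
    have seg: "closed_segment p q \<subseteq> ball x e" using p by (simp add: closed_segment_subset)
    have "norm ((f p - grad f q \<bullet> p) - (f q - grad f q \<bullet> q)) \<le> (K * norm (p - q)) * norm (p - q)"
    proof (rule differentiable_bound[where S = "closed_segment p q" and f' = "\<lambda>z h. (grad f z - grad f q) \<bullet> h"])
      fix z assume z: "z \<in> closed_segment p q"
      then have zb: "z \<in> ball x e" using seg by auto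
      show "((\<lambda>z. f z - grad f q \<bullet> z) has_derivative (\<lambda>h. (grad f z - grad f q) \<bullet> h)) (at z within closed_segment p q)"
        unfolding inner_diff_left
        by (rule has_derivative_diff[OF has_derivative_at_withinI[OF smooth_on_grad(1)[OF S C2 subsetD[OF eS zb]]]
              bounded_linear_imp_has_derivative[OF bounded_linear_inner_right]])
      show "onorm (\<lambda>h. (grad f z - grad f q) \<bullet> h) \<le> K * norm (p - q)"
      proof (rule onorm_le)
        fix h
        have "norm ((grad f z - grad f q) \<bullet> h) \<le> norm (grad f z - grad f q) * norm h"
          using Cauchy_Schwarz_ineq2 by simp
        also have "norm (grad f z - grad f q) \<le> K * norm (z - q)" by (rule lip[OF zb p(2)])
        also have "norm (z - q) \<le> norm (p - q)" using segment_bound(2)[OF z] by (simp add: norm_minus_commute)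
        finally show "norm ((grad f z - grad f q) \<bullet> h) \<le> K * norm (p - q) * norm h"
          using K by (simp add: mult_left_mono mult_right_mono)
      qed
    qed auto
    then show ?thesis by (simp add: inner_diff_right power2_eq_square algebra_simps)
  qed
  show ?thesis
    using e(1) K B(1) eS lip low taylor
    by (intro exI[of _ e] conjI exI[of _ K] exI[of _ "B / 2"]) auto
qed

section \<open>Local Legendre structure of nondegenerate homogeneous functions\<close>

lemma homogeneous_nondeg_C2:
  assumes "f \<in> homogeneous_nondeg d"
  shows "C_on 2 (UNIV - {0}) f" "open (UNIV - {0 :: real ^ 'm::finite})" "f \<in> homogeneous d"
    and "x \<noteq> 0 \<Longrightarrow> det (hessian f x) \<noteq> 0"
  using assms by (auto simp: homogeneous_nondeg_def smooth_on_def open_delete)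

text \<open>If the gradient vanished at \<open>x\<close>, it would vanish along the ray through \<open>x\<close>,
  contradicting local injectivity.\<close>

lemma homogeneous_nondeg_grad_nonzero:
  fixes f :: "real ^ 'm::finite \<Rightarrow> real"
  assumes f: "f \<in> homogeneous_nondeg d" and x: "x \<noteq> 0"
  shows "grad f x \<noteq> 0"
proof
  assume 0: "grad f x = 0"
  note C2 = homogeneous_nondeg_C2[OF f]
  obtain e \<beta> where e: "e > 0" "\<beta> > 0" and b: "\<And>p q. p \<in> ball x e \<Longrightarrow> q \<in> ball x e \<Longrightarrow> \<beta> * norm (p - q) \<le> norm (grad f p - grad f q)"
    using grad_local_bilipschitz[OF C2(2) C2(1) _ C2(4)[OF x]] x by auto
  \<comment> \<open>This places \<open>(1 + h) *\<^sub>R x\<close> at distance \<open>e / 2\<close>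
    from \<open>x\<close>.\<close>
  define h where "h = e / (2 * norm x)"
  have h: "h > 0" using e x by (simp add: h_def)
  have "grad f ((1 + h) *\<^sub>R x) = 0"
  proof (rule homogeneous_grad_eq_0[OF C2(3) _ _ _ 0])
    show "(f has_derivative (\<lambda>h. grad f x \<bullet> h)) (at x)"
      by (rule smooth_on_grad(1)[OF C2(2) C2(1)]) (use x in auto)
    show "(f has_derivative (\<lambda>k. grad f ((1 + h) *\<^sub>R x) \<bullet> k)) (at ((1 + h) *\<^sub>R x))"
      by (rule smooth_on_grad(1)[OF C2(2) C2(1)]) (use x h in auto)
  qed (use h in auto)
  moreover have "(1 + h) *\<^sub>R x \<in> ball x e" using x e by (simp add: dist_norm scaleR_left_distrib h_def)
  ultimately have "\<beta> * norm ((1 + h) *\<^sub>R x - x) \<le> 0" using b[of "(1 + h) *\<^sub>R x" x] e 0 by simp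
  then show False using e h x by (simp add: scaleR_left_distrib mult_le_0_iff)
qed

text \<open>The Legendre transform \<open>p \<bullet> grad f p - f p\<close> is recorded as a
  function of \<open>p\<close> rather than of the slope. Its smoothness is not invoked: its second
  order estimate follows from that of \<open>f\<close> together with the lower Lipschitz bound of
  the gradient.\<close>

lemma homogeneous_nondeg_local_legendre:
  fixes f :: "real ^ 'm::finite \<Rightarrow> real"
  assumes f: "f \<in> homogeneous_nondeg d" and x: "x \<noteq> 0"
  shows "\<exists>e>0. \<exists>L. legendre L (ball x e) (\<lambda>p. p) (grad f) f (\<lambda>p. p \<bullet> grad f p - f p)"
proof -
  note C2 = homogeneous_nondeg_C2[OF f]
  obtain e0 K \<beta> where e0: "e0 > 0" and K: "K > 0" and \<beta>: "\<beta> > 0" and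
    b: "\<forall>p\<in>ball x e0. \<forall>q\<in>ball x e0.
     norm (grad f p - grad f q) \<le> K * norm (p - q) \<and> \<beta> * norm (p - q) \<le> norm (grad f p - grad f q) \<and>
     \<bar>f p - f q - grad f q \<bullet> (p - q)\<bar> \<le> K * (norm (p - q))\<^sup>2"
    using grad_local_bilipschitz[OF C2(2) C2(1) _ C2(4)[OF x]] x by auto
  define G where "G = norm (grad f x)"
  have G: "G > 0" using homogeneous_nondeg_grad_nonzero[OF f x] by (simp add: G_def)
  define X where "X = norm x"
  have X: "X > 0" using x by (simp add: X_def)
  \<comment> \<open>The last two radii keep \<open>norm p\<close> and \<open>norm (grad f p)\<close>
    at least half of their values at \<open>x\<close>, as \<open>x_ge\<close> and
    \<open>y_ge\<close> demand.\<close>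
  define e where "e = min e0 (min (X / 2) (G / (2 * K)))"
  have e: "e > 0" "e \<le> e0" "e \<le> X / 2" "K * e \<le> G / 2"
  proof -
    have "e \<le> G / (2 * K)" by (simp add: e_def)
    then show "K * e \<le> G / 2" using K by (simp add: field_simps)
  qed (use e0 X G K in \<open>auto simp: e_def\<close>)
  define L where "L = 1 + 2 * X + 2 / X + 2 * G + 2 / G + 1 / \<beta> + K + K * (1 / \<beta>)\<^sup>2"
  have L0: "2 / X > 0" "2 / G > 0" "1 / \<beta> > 0" "K * (1 / \<beta>)\<^sup>2 > 0" using X G \<beta> K by auto
  have L: "L \<ge> 1" "L \<ge> 2 * X" "L \<ge> 2 / X" "L \<ge> 2 * G" "L \<ge> 2 / G" "L \<ge> 1 / \<beta>" "L \<ge> K" "L \<ge> K * (1 / \<beta>)\<^sup>2"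
    using L0 X G K unfolding L_def by linarith+
  have b': "norm (grad f p - grad f q) \<le> K * norm (p - q)" "\<beta> * norm (p - q) \<le> norm (grad f p - grad f q)"
     "\<bar>f p - f q - grad f q \<bullet> (p - q)\<bar> \<le> K * (norm (p - q))\<^sup>2" if "p \<in> ball x e" "q \<in> ball x e" for p q
    using b that e(2) by auto
  have pq: "norm (p - q) \<le> 1 / \<beta> * norm (grad f p - grad f q)" if "p \<in> ball x e" "q \<in> ball x e" for p q
    using b'(2)[OF that] \<beta> by (simp add: field_simps)
  have near: "norm (p - x) \<le> e" "norm (grad f p - grad f x) \<le> G / 2" if "p \<in> ball x e" for p
  proof -
    show 1: "norm (p - x) \<le> e" using that by (simp add: dist_norm norm_minus_commute)
    have "norm (grad f p - grad f x) \<le> K * norm (p - x)" using that e by (intro b') auto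
    also have "\<dots> \<le> K * e" using 1 K by (intro mult_left_mono) auto
    finally show "norm (grad f p - grad f x) \<le> G / 2" using e by simp
  qed
  have two: "1 \<le> L * z" if "w / 2 \<le> z" "2 / w \<le> L" "w > 0" for w z
  proof -
    have "1 = 2 / w * (w / 2)" using that by simp
    also have "\<dots> \<le> L * z" using that L by (intro mult_mono) auto
    finally show ?thesis .
  qed
  have "legendre L (ball x e) (\<lambda>p. p) (grad f) f (\<lambda>p. p \<bullet> grad f p - f p)"
  proof
    show "1 \<le> L" by fact
  next
    fix p assume p: "p \<in> ball x e"
    have n: "norm p \<le> X + e" "norm p \<ge> X - e" "norm (grad f p) \<le> G + G / 2" "norm (grad f p) \<ge> G - G / 2"
      using near[OF p] norm_triangle_sub[of p x] norm_triangle_sub[of x p] norm_triangle_sub[of "grad f p" "grad f x"]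
        norm_triangle_sub[of "grad f x" "grad f p"]
      by (simp_all add: X_def G_def norm_minus_commute)
    show "norm p \<le> L" using n e L X by linarith
    show "norm (grad f p) \<le> L" using n L G by linarith
    show "1 \<le> L * norm p" by (rule two[of X]) (use n e L X in auto)
    show "1 \<le> L * norm (grad f p)" by (rule two[of G]) (use n L G in auto)
    show "f p + (p \<bullet> grad f p - f p) = p \<bullet> grad f p" by simp
  next
    fix p q assume pq': "p \<in> ball x e" "q \<in> ball x e"
    show "norm (p - q) \<le> L * norm (grad f p - grad f q)"
      using pq[OF pq'] L(6) mult_right_mono[OF L(6), of "norm (grad f p - grad f q)"] by simp
    show "norm (grad f p - grad f q) \<le> L * norm (p - q)"
      using b'(1)[OF pq'] mult_right_mono[OF L(7), of "norm (p - q)"] by simp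
    show "\<bar>f p - f q - grad f q \<bullet> (p - q)\<bar> \<le> L * (norm (p - q))\<^sup>2"
      using b'(3)[OF pq'] mult_right_mono[OF L(7), of "(norm (p - q))\<^sup>2"] by simp
    \<comment> \<open>The Taylor remainder of the transform between \<open>q\<close> and
      \<open>p\<close> is the remainder of \<open>f\<close> with the two points exchanged.\<close>
    have "\<bar>p \<bullet> grad f p - f p - (q \<bullet> grad f q - f q) - q \<bullet> (grad f p - grad f q)\<bar> = \<bar>f q - f p - grad f p \<bullet> (q - p)\<bar>"
      by (simp add: inner_diff_right inner_diff_left inner_commute algebra_simps)
    also have "\<dots> \<le> K * (norm (q - p))\<^sup>2" by (rule b'(3)[OF pq'(2,1)])
    also have "\<dots> \<le> K * (1 / \<beta> * norm (grad f p - grad f q))\<^sup>2"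
      using pq[OF pq'] K by (intro mult_left_mono power_mono) (auto simp: norm_minus_commute)
    also have "\<dots> = K * (1 / \<beta>)\<^sup>2 * (norm (grad f p - grad f q))\<^sup>2" by (simp add: power_mult_distrib power_divide)
    also have "\<dots> \<le> L * (norm (grad f p - grad f q))\<^sup>2" by (intro mult_right_mono L) auto
    finally show "\<bar>p \<bullet> grad f p - f p - (q \<bullet> grad f q - f q) - q \<bullet> (grad f p - grad f q)\<bar> \<le> L * (norm (grad f p - grad f q))\<^sup>2" .
  qed
  then show ?thesis using e(1) by blast
qed

text \<open>Compactness leaves finitely many constants \<open>L\<close>; by homogeneity this one
  annulus represents all dyadic shells.\<close>

lemma homogeneous_nondeg_cover:
  fixes f :: "real ^ 'm::finite \<Rightarrow> real"
  assumes f: "f \<in> homogeneous_nondeg d"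
  shows "\<exists>\<T>. finite \<T> \<and> {x. 1 / 2 \<le> norm x \<and> norm x \<le> 1} \<subseteq> \<Union>\<T> \<and>
    (\<forall>T\<in>\<T>. \<exists>L. legendre L T (\<lambda>p. p) (grad f) f (\<lambda>p. p \<bullet> grad f p - f p))"
proof -
  let ?A = "{x :: real ^ 'm. 1 / 2 \<le> norm x \<and> norm x \<le> 1}"
  have "\<forall>x\<in>?A. \<exists>e>0. \<exists>L. legendre L (ball x e) (\<lambda>p. p) (grad f) f (\<lambda>p. p \<bullet> grad f p - f p)"
  proof
    fix x assume "x \<in> ?A"
    then have "x \<noteq> 0" by auto
    then show "\<exists>e>0. \<exists>L. legendre L (ball x e) (\<lambda>p. p) (grad f) f (\<lambda>p. p \<bullet> grad f p - f p)"
      by (rule homogeneous_nondeg_local_legendre[OF f])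
  qed
  from bchoice[OF this] obtain e where e: "\<And>x. x \<in> ?A \<Longrightarrow> e x > 0"
    "\<And>x. x \<in> ?A \<Longrightarrow> \<exists>L. legendre L (ball x (e x)) (\<lambda>p. p) (grad f) f (\<lambda>p. p \<bullet> grad f p - f p)"
    by blast
  have "?A = cball 0 1 - ball 0 (1 / 2)" by auto
  then have c: "compact ?A" by (simp add: compact_diff)
  have cov: "?A \<subseteq> (\<Union>x\<in>?A. ball x (e x))"
  proof
    fix x assume "x \<in> ?A"
    then show "x \<in> (\<Union>x\<in>?A. ball x (e x))" using e(1) by (intro UN_I[of x]) auto
  qed
  obtain X where X: "X \<subseteq> ?A" "finite X" "?A \<subseteq> (\<Union>x\<in>X. ball x (e x))"
    by (rule compactE_image[OF c open_ball cov])
  then show ?thesis using e(2) by (intro exI[of _ "(\<lambda>x. ball x (e x)) ` X"]) auto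
qed

section \<open>Upper bound\<close>

lemma rational_points_iff:
  "(q, a) \<in> rational_points f \<delta> Q \<longleftrightarrow> real_of_int q / Q \<in> {1..<2} \<and>
     norm ((1 / real_of_int q) *\<^sub>R rvec a) < 1 \<and>
     int_dist (real_of_int q * f ((1 / real_of_int q) *\<^sub>R rvec a)) \<le> \<delta>"
proof -
  have "(\<chi> i. real_of_int (a $ i) / real_of_int q) = (1 / real_of_int q) *\<^sub>R rvec a"
    by (simp add: vec_eq_iff)
  then show ?thesis by (simp only: rational_points_def mem_Collect_eq prod.case)
qed

lemma int_dist_le:
  "\<bar>x - of_int z\<bar> \<le> r \<Longrightarrow> int_dist x \<le> r"
  unfolding int_dist_def by (rule order_trans[OF cInf_lower]) (auto intro!: bdd_belowI[of _ 0])

text \<open>On the shell of radius about \<open>s\<close> homogeneity reads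
  \<open>f (s *\<^sub>R y) = s * s powr (d - 1) * f y\<close>, so the slope scale is
  \<open>\<sigma> = s powr (d - 1)\<close>. A nonzero \<open>a\<close> has
  \<open>norm (a / q) \<ge> 1 / q > 1 / (2 * Q)\<close>, which bounds the number of shells. Pairs
  with \<open>a = 0\<close> are excluded from \<open>near_points\<close> and are listed
  separately.\<close>

lemma rational_points_subset:
  fixes f :: "real ^ 'm::finite \<Rightarrow> real"
  assumes f: "f \<in> homogeneous d" and cov: "{x. 1 / 2 \<le> norm x \<and> norm x \<le> 1} \<subseteq> \<Union>\<T>"
    and Q: "Q \<ge> 1" "2 * Q \<le> 2 ^ n" and \<delta>: "\<delta> > 0"
  shows "rational_points f \<delta> Q \<subseteq> (\<lambda>q. (q, 0)) ` {q. Q \<le> real_of_int q \<and> real_of_int q < 2 * Q} \<union>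
     (\<Union>T\<in>\<T>. \<Union>i<n. (\<lambda>(q, a, b). (q, a)) ` near_points T (\<lambda>p. p) g f ((1 / 2) ^ i) (((1 / 2) ^ i) powr (d - 1)) \<delta> Q)"
proof
  fix \<mu> assume \<mu>: "\<mu> \<in> rational_points f \<delta> Q"
  obtain q a where e: "\<mu> = (q, a)" by (cases \<mu>)
  define x where "x = (1 / real_of_int q) *\<^sub>R rvec a"
  have q: "Q \<le> real_of_int q" "real_of_int q < 2 * Q" and x1: "norm x < 1" and id: "int_dist (real_of_int q * f x) \<le> \<delta>"
    using \<mu> Q by (auto simp: e rational_points_iff x_def field_simps)
  have q0: "real_of_int q > 0" using q Q by linarith
  show "\<mu> \<in> (\<lambda>q. (q, 0)) ` {q. Q \<le> real_of_int q \<and> real_of_int q < 2 * Q} \<union>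
     (\<Union>T\<in>\<T>. \<Union>i<n. (\<lambda>(q, a, b). (q, a)) ` near_points T (\<lambda>p. p) g f ((1 / 2) ^ i) (((1 / 2) ^ i) powr (d - 1)) \<delta> Q)"
  proof (cases "a = 0")
    case True
    then show ?thesis using q by (auto simp: e)
  next
    case False
    have xq: "norm x \<ge> 1 / real_of_int q" using norm_rvec_ge_1[OF False] q0 by (simp add: x_def field_simps)
    then have x0: "norm x > 0" using q0 by (meson less_le_trans zero_less_divide_1_iff)
    have "1 \<le> 1 / norm x" using x0 x1 by simp
    from dyadic_exponent[OF this] obtain k where k: "1 / norm x < 2 ^ k" "\<And>i. i < k \<Longrightarrow> 2 ^ i \<le> 1 / norm x" by blast
    have "k \<noteq> 0" using k(1) \<open>1 \<le> 1 / norm x\<close> by (intro notI) simp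
    then obtain i where i: "k = Suc i" by (cases k) auto
    have lo: "2 ^ i * norm x \<le> 1" and hi: "1 / 2 \<le> 2 ^ i * norm x"
      using k(1) k(2)[of i] x0 by (simp_all add: i field_simps)
    have "(2 :: real) ^ i \<le> 1 / norm x" using lo x0 by (simp add: field_simps)
    also have "\<dots> \<le> real_of_int q" using xq x0 q0 by (simp add: field_simps)
    also have "\<dots> < 2 ^ n" using q Q by linarith
    finally have "i < n" by (rule power_less_imp_less_exp[rotated]) simp
    define s :: real where "s = (1 / 2) ^ i"
    have s: "s > 0" by (simp add: s_def)
    define y where "y = 2 ^ i *\<^sub>R x"
    have sy: "s *\<^sub>R y = x" by (simp add: s_def y_def power_divide)
    have "y \<in> {x. 1 / 2 \<le> norm x \<and> norm x \<le> 1}" using lo hi by (simp add: y_def)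
    then have "y \<in> \<Union>\<T>" using cov by blast
    then obtain T where T: "T \<in> \<T>" "y \<in> T" by auto
    have fx: "f x = s * s powr (d - 1) * f y"
    proof -
      have "f x = s powr d * f y" using f s unfolding sy[symmetric] homogeneous_def by auto
      also have "s powr d = s powr (1 + (d - 1))" by simp
      also have "\<dots> = s * s powr (d - 1)" using s by (subst powr_add) simp
      finally show ?thesis .
    qed
    \<comment> \<open>The base point is chosen to be \<open>a / q\<close> itself, so the condition
      on \<open>b\<close> becomes \<open>\<bar>b - q * f x\<bar> \<le> \<delta>\<close>.\<close>
    have "rvec a - real_of_int q *\<^sub>R (s *\<^sub>R y) = 0" unfolding sy using q0 by (simp add: x_def)
    then have a: "rvec a - (real_of_int q * s) *\<^sub>R y = 0" by simp
    obtain b where b: "int_dist (real_of_int q * f x) = \<bar>real_of_int q * f x - of_int b\<bar>" using int_dist_attained by blast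
    have "(q, a, b) \<in> near_points T (\<lambda>p. p) g f s (s powr (d - 1)) \<delta> Q"
      unfolding near_points_def mem_Collect_eq prod.case tbox_def lbox_def
      using False q q0 T id by (auto intro!: bexI[of _ y] simp: a b[unfolded fx] fx abs_minus_commute)
    then have "\<mu> \<in> (\<lambda>(q, a, b). (q, a)) ` near_points T (\<lambda>p. p) g f s (s powr (d - 1)) \<delta> Q"
      by (force simp: e)
    then show ?thesis using T \<open>i < n\<close> unfolding s_def by blast
  qed
qed

lemma sum_half_powers_le: "(\<Sum>i<n. (1 / 2 :: real) ^ i) \<le> 2"
proof -
  have "(\<Sum>i<n. (1 / 2 :: real) ^ i) = (1 - (1 / 2) ^ n) / (1 - 1 / 2)" by (subst sum_gp_strict) simp
  then show ?thesis by simp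
qed

text \<open>Where the square root exceeds \<open>1\<close> the trivial bound is better. The
  resulting cap is essential for large \<open>d\<close>: without it the shell contributions would
  grow towards the origin.\<close>

lemma legendre_card_le:
  fixes x y :: "'a \<Rightarrow> real ^ 'm::finite"
  assumes "legendre L T x y u v" and m: "CARD('m) \<ge> 2"
  shows "\<exists>C>0. \<forall>s \<sigma> \<delta> Q. 0 < s \<and> s \<le> 1 \<and> 0 < \<sigma> \<and> \<sigma> \<le> 1 \<and> 0 < \<delta> \<and> \<delta> \<le> 1 \<and> 1 \<le> Q \<longrightarrow>
     real (card (near_points T x y u s \<sigma> \<delta> Q)) \<le>
       C * (Q * (Q * s) ^ CARD('m) * (\<delta> + min 1 (sqrt (\<delta> / (Q * s * \<sigma>))) + (Q * s) powr (1 / (real k + 1) - 1)))"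
proof -
  interpret legendre L T x y u v by fact
  obtain C0 where C0: "C0 > 0" and b0: "\<And>s \<sigma> \<delta> Q. 0 < s \<and> s \<le> 1 \<and> 0 < \<sigma> \<and> \<sigma> \<le> 1 \<and> 0 < \<delta> \<and> 1 \<le> Q \<Longrightarrow>
     real (card (near_points T x y u s \<sigma> \<delta> Q)) \<le> C0 * (Q * (Q * s) ^ CARD('m) * (1 + \<delta>))"
    using near_points_trivial by blast
  obtain C1 where C1: "C1 > 0" and b1: "\<And>s \<sigma> \<delta> Q. 0 < s \<and> s \<le> 1 \<and> 0 < \<sigma> \<and> \<sigma> \<le> 1 \<and> 0 < \<delta> \<and> 1 \<le> Q \<Longrightarrow>
     real (card (near_points T x y u s \<sigma> \<delta> Q)) \<le>
       C1 * (Q * (Q * s) ^ CARD('m) * (\<delta> + sqrt (\<delta> / (Q * s * \<sigma>)) + (Q * s) powr (1 / (real k + 1) - 1)))"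
    using legendre_counting_bound[OF assms] unfolding counting_bound_def by blast
  have "real (card (near_points T x y u s \<sigma> \<delta> Q)) \<le>
       (C0 + C1) * (Q * (Q * s) ^ CARD('m) * (\<delta> + min 1 (sqrt (\<delta> / (Q * s * \<sigma>))) + (Q * s) powr (1 / (real k + 1) - 1)))"
    if h: "0 < s \<and> s \<le> 1 \<and> 0 < \<sigma> \<and> \<sigma> \<le> 1 \<and> 0 < \<delta> \<and> \<delta> \<le> 1 \<and> 1 \<le> Q" for s \<sigma> \<delta> Q
  proof (cases "sqrt (\<delta> / (Q * s * \<sigma>)) \<le> 1")
    case True
    then have mn: "min 1 (sqrt (\<delta> / (Q * s * \<sigma>))) = sqrt (\<delta> / (Q * s * \<sigma>))" by simp
    show ?thesis unfolding mn
      by (rule order_trans[OF b1]) (use h C0 in \<open>auto intro!: mult_right_mono mult_nonneg_nonneg add_nonneg_nonneg\<close>)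
  next
    case False
    then have mn: "min 1 (sqrt (\<delta> / (Q * s * \<sigma>))) = 1" by simp
    have "real (card (near_points T x y u s \<sigma> \<delta> Q)) \<le> C0 * (Q * (Q * s) ^ CARD('m) * (1 + \<delta>))" using b0 h by blast
    also have "\<dots> \<le> (C0 + C1) * (Q * (Q * s) ^ CARD('m) * (\<delta> + 1 + (Q * s) powr (1 / (real k + 1) - 1)))"
      using h C0 C1 by (intro mult_mono mult_left_mono) auto
    finally show ?thesis unfolding mn .
  qed
  then show ?thesis using C0 C1 by (intro exI[of _ "C0 + C1"]) auto
qed

text \<open>The number of bootstrap rounds is chosen so that the error \<open>Q powr (t - 1)\<close>
  drops below \<open>\<delta>\<close>. The number \<open>n\<close> of shells depends on
  \<open>Q\<close>, so the constant is fixed before it and the remaining sum is estimated later,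
  according to the size of \<open>d\<close>.\<close>

lemma homogeneous_nondeg_upper:
  fixes f :: "real ^ 'm::finite \<Rightarrow> real"
  assumes m: "CARD('m) \<ge> 2" and f: "f \<in> homogeneous_nondeg d" and d: "d > 1" and \<epsilon>: "0 < \<epsilon>" "\<epsilon> < 1"
  shows "\<exists>C>0. \<forall>\<delta> Q. 1 \<le> Q \<and> Q powr (\<epsilon> - 1) < \<delta> \<and> \<delta> \<le> 1 \<longrightarrow> (\<exists>n.
     real (N f \<delta> Q) \<le> C * (Q ^ (CARD('m) + 1) *
        (\<delta> + (\<Sum>i<n. ((1 / 2) ^ i) ^ CARD('m) * min 1 (sqrt (\<delta> / Q * (2 ^ i) powr d))))))"
proof -
  obtain k where k: "1 / (real k + 1) < \<epsilon>"
    using reals_Archimedean[OF \<epsilon>(1)] by (auto simp: inverse_eq_divide add.commute)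
  define t where "t = 1 / (real k + 1)"
  have t: "t > 0" "t < \<epsilon>" using k by (auto simp: t_def)
  obtain \<T> where \<T>: "finite \<T>" "{x. 1 / 2 \<le> norm x \<and> norm x \<le> 1} \<subseteq> \<Union>\<T>"
     "\<And>T. T \<in> \<T> \<Longrightarrow> \<exists>L. legendre L T (\<lambda>p. p) (grad f) f (\<lambda>p. p \<bullet> grad f p - f p)"
    using homogeneous_nondeg_cover[OF f] by blast
  let ?P = "\<lambda>T C. C > 0 \<and> (\<forall>s \<sigma> \<delta> Q. 0 < s \<and> s \<le> 1 \<and> 0 < \<sigma> \<and> \<sigma> \<le> 1 \<and> 0 < \<delta> \<and> \<delta> \<le> 1 \<and> 1 \<le> Q \<longrightarrow>
     real (card (near_points T (\<lambda>p. p) (grad f) f s \<sigma> \<delta> Q)) \<le>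
       C * (Q * (Q * s) ^ CARD('m) * (\<delta> + min 1 (sqrt (\<delta> / (Q * s * \<sigma>))) + (Q * s) powr (t - 1))))"
  have "\<forall>T\<in>\<T>. \<exists>C. ?P T C"
  proof
    fix T assume "T \<in> \<T>"
    then obtain L where "legendre L T (\<lambda>p. p) (grad f) f (\<lambda>p. p \<bullet> grad f p - f p)" using \<T>(3) by blast
    from legendre_card_le[OF this m, of k] show "\<exists>C. ?P T C" unfolding t_def by blast
  qed
  from bchoice[OF this] obtain c where c: "\<And>T. T \<in> \<T> \<Longrightarrow> ?P T (c T)" by blast
  define C0 where "C0 = (\<Sum>T\<in>\<T>. c T)"
  have C0: "C0 \<ge> 0" unfolding C0_def using c by (intro sum_nonneg less_imp_le) blast
  define C where "C = 2 + 4 * C0"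
  have "C > 0" using C0 by (simp add: C_def)
  moreover have "\<exists>n. real (N f \<delta> Q) \<le> C * (Q ^ (CARD('m) + 1) *
        (\<delta> + (\<Sum>i<n. ((1 / 2) ^ i) ^ CARD('m) * min 1 (sqrt (\<delta> / Q * (2 ^ i) powr d)))))"
    if Q: "1 \<le> Q" and \<delta>: "Q powr (\<epsilon> - 1) < \<delta>" "\<delta> \<le> 1" for \<delta> Q
  proof -
    let ?m = "CARD('m)"
    obtain n where n: "2 * Q < 2 ^ n" using real_arch_pow[of 2 "2 * Q"] by auto
    have \<delta>0: "\<delta> > 0" using \<delta>(1) by (meson powr_ge_zero le_less_trans)
    let ?s = "\<lambda>i :: nat. (1 / 2 :: real) ^ i"
    let ?M = "\<lambda>i. min 1 (sqrt (\<delta> / Q * (2 ^ i) powr d))"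
    let ?NP = "\<lambda>T i. near_points T (\<lambda>p. p) (grad f) f (?s i) (?s i powr (d - 1)) \<delta> Q"
    let ?Z = "{q. Q \<le> real_of_int q \<and> real_of_int q < 2 * Q}"
    have cZ: "finite ?Z" "real (card ?Z) \<le> 2 * Q"
    proof -
      have sub: "?Z \<subseteq> {q. \<bar>real_of_int q - 3 * Q / 2\<bar> \<le> Q / 2}"
      proof
        fix q assume "q \<in> ?Z"
        then have "Q \<le> real_of_int q" "real_of_int q < 2 * Q" by auto
        then have "\<bar>real_of_int q - 3 * Q / 2\<bar> \<le> Q / 2" unfolding abs_le_iff by linarith
        then show "q \<in> {q. \<bar>real_of_int q - 3 * Q / 2\<bar> \<le> Q / 2}" by simp
      qed
      have fin: "finite {q. \<bar>real_of_int q - 3 * Q / 2\<bar> \<le> Q / 2}" using Q by (intro int_interval_bounds) auto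
      show "finite ?Z" by (rule finite_subset[OF sub fin])
      have "real (card ?Z) \<le> real (card {q. \<bar>real_of_int q - 3 * Q / 2\<bar> \<le> Q / 2})"
        by (intro of_nat_mono card_mono sub fin)
      also have "\<dots> \<le> 2 * (Q / 2) + 1" using Q by (intro int_interval_bounds) auto
      finally show "real (card ?Z) \<le> 2 * Q" using Q by simp
    qed
    have s: "0 < ?s i" "?s i \<le> 1" for i by (simp_all add: power_le_one)
    have \<sigma>: "0 < ?s i powr (d - 1)" "?s i powr (d - 1) \<le> 1" for i
    proof -
      show "?s i powr (d - 1) \<le> 1" using d s[of i] by (simp add: powr_le1)
    qed simp
    have finNP: "finite (?NP T i)" if T: "T \<in> \<T>" for T i
    proof -
      obtain L where "legendre L T (\<lambda>p. p) (grad f) f (\<lambda>p. p \<bullet> grad f p - f p)" using \<T>(3)[OF T] by blast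
      then show ?thesis by (rule legendre.finite_near_points) (use Q \<delta>0 in auto)
    qed
    have cNP: "real (card (?NP T i)) \<le> c T * (Q ^ (?m + 1) * (?s i * \<delta> + ?s i ^ ?m * ?M i + ?s i * Q powr (t - 1)))" if T: "T \<in> \<T>" for T i
    proof -
      have "real (card (?NP T i)) \<le> c T * (Q * (Q * ?s i) ^ ?m * (\<delta> + min 1 (sqrt (\<delta> / (Q * ?s i * ?s i powr (d - 1)))) + (Q * ?s i) powr (t - 1)))"
        using c[OF T] s[of i] \<sigma>[of i] \<delta>0 \<delta> Q by auto
      also have "\<delta> / (Q * ?s i * ?s i powr (d - 1)) = \<delta> / Q * (2 ^ i) powr d"
      proof -
        have "?s i * ?s i powr (d - 1) = ?s i powr d" using powr_add[of "?s i" 1 "d - 1"] by simp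
        also have "\<dots> = 1 / (2 ^ i) powr d" by (simp add: power_divide powr_divide)
        finally show ?thesis by (simp add: mult.assoc)
      qed
      also have "c T * (Q * (Q * ?s i) ^ ?m * (\<delta> + ?M i + (Q * ?s i) powr (t - 1))) =
         c T * (Q ^ (?m + 1) * (?s i ^ ?m * \<delta> + ?s i ^ ?m * ?M i + (?s i ^ ?m * ?s i powr (t - 1)) * Q powr (t - 1)))"
        using Q by (simp add: powr_mult power_mult_distrib algebra_simps)
      also have "\<dots> \<le> c T * (Q ^ (?m + 1) * (?s i * \<delta> + ?s i ^ ?m * ?M i + ?s i * Q powr (t - 1)))"
      proof (intro mult_left_mono add_mono mult_right_mono order_refl)
        have "?s i ^ ?m \<le> ?s i ^ 1" using s[of i] m by (intro power_decreasing) auto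
        then show "?s i ^ ?m \<le> ?s i" by simp
        \<comment> \<open>With at least two factors \<open>?s i\<close> the total exponent
          \<open>2 + (t - 1)\<close> exceeds \<open>1\<close>, and the errors of the shells form a
          convergent series.\<close>
        have "?s i ^ ?m * ?s i powr (t - 1) \<le> ?s i ^ 2 * ?s i powr (t - 1)"
          using s[of i] m by (intro mult_right_mono power_decreasing) auto
        also have "\<dots> = ?s i powr (2 + (t - 1))" using powr_add[of "?s i" 2 "t - 1"] powr_numeral[of "?s i" "num.Bit0 num.One"] s[of i] by simp
        also have "\<dots> \<le> ?s i powr 1" using t s[of i] by (intro powr_mono') auto
        finally show "?s i ^ ?m * ?s i powr (t - 1) \<le> ?s i" by simp
      qed (use c[OF T] \<delta>0 Q in auto)
      finally show ?thesis .
    qed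
    have "rational_points f \<delta> Q \<subseteq> (\<lambda>q. (q, 0)) ` ?Z \<union> (\<Union>T\<in>\<T>. \<Union>i<n. (\<lambda>(q, a, b). (q, a)) ` ?NP T i)"
      by (rule rational_points_subset[OF homogeneous_nondeg_C2(3)[OF f] \<T>(2) Q _ \<delta>0]) (use n in simp)
    then have "N f \<delta> Q \<le> card ((\<lambda>q. (q, 0 :: int ^ 'm)) ` ?Z \<union> (\<Union>T\<in>\<T>. \<Union>i<n. (\<lambda>(q, a, b). (q, a)) ` ?NP T i))"
      unfolding N_def using cZ \<T>(1) finNP by (intro card_mono) auto
    also have "\<dots> \<le> card ((\<lambda>q. (q, 0 :: int ^ 'm)) ` ?Z) + card (\<Union>T\<in>\<T>. \<Union>i<n. (\<lambda>(q, a, b). (q, a)) ` ?NP T i)"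
      by (rule card_Un_le)
    also have "\<dots> \<le> card ?Z + (\<Sum>T\<in>\<T>. \<Sum>i<n. card (?NP T i))"
    proof (intro add_mono card_image_le cZ)
      have "card (\<Union>T\<in>\<T>. \<Union>i<n. (\<lambda>(q, a, b). (q, a)) ` ?NP T i) \<le> (\<Sum>T\<in>\<T>. card (\<Union>i<n. (\<lambda>(q, a, b). (q, a)) ` ?NP T i))"
        by (rule card_UN_le[OF \<T>(1)])
      also have "\<dots> \<le> (\<Sum>T\<in>\<T>. \<Sum>i<n. card ((\<lambda>(q, a, b). (q, a)) ` ?NP T i))"
        by (intro sum_mono card_UN_le) simp
      also have "\<dots> \<le> (\<Sum>T\<in>\<T>. \<Sum>i<n. card (?NP T i))" by (intro sum_mono card_image_le finNP)
      finally show "card (\<Union>T\<in>\<T>. \<Union>i<n. (\<lambda>(q, a, b). (q, a)) ` ?NP T i) \<le> (\<Sum>T\<in>\<T>. \<Sum>i<n. card (?NP T i))" .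
    qed
    finally have "real (N f \<delta> Q) \<le> real (card ?Z + (\<Sum>T\<in>\<T>. \<Sum>i<n. card (?NP T i)))" by (rule of_nat_mono)
    also have "\<dots> = real (card ?Z) + (\<Sum>T\<in>\<T>. \<Sum>i<n. real (card (?NP T i)))" by simp
    also have "\<dots> \<le> 2 * Q + (\<Sum>T\<in>\<T>. \<Sum>i<n. c T * (Q ^ (?m + 1) * (?s i * \<delta> + ?s i ^ ?m * ?M i + ?s i * Q powr (t - 1))))"
      by (intro add_mono sum_mono cNP cZ) auto
    also have "\<dots> = 2 * Q + C0 * (Q ^ (?m + 1) * ((\<Sum>i<n. ?s i) * \<delta> + (\<Sum>i<n. ?s i ^ ?m * ?M i) + (\<Sum>i<n. ?s i) * Q powr (t - 1)))"
      by (simp add: C0_def sum_distrib_left[symmetric] sum_distrib_right[symmetric] sum.distrib)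
    also have "\<dots> \<le> 2 * (Q ^ (?m + 1) * \<delta>) + C0 * (Q ^ (?m + 1) * (2 * \<delta> + (\<Sum>i<n. ?s i ^ ?m * ?M i) + 2 * \<delta>))"
    proof (intro add_mono mult_left_mono mult_right_mono mult_mono sum_half_powers_le order_refl)
      have "Q powr (t - 1) \<le> Q powr (\<epsilon> - 1)" using t Q by (intro powr_mono) auto
      then show "Q powr (t - 1) \<le> \<delta>" using \<delta> by linarith
      \<comment> \<open>The pairs with \<open>a = 0\<close>, at most \<open>2 * Q\<close> of them,
        are absorbed because \<open>\<delta>\<close> exceeds \<open>1 / Q\<close>.\<close>
      have "Q powr (0 - 1) \<le> Q powr (\<epsilon> - 1)" using \<epsilon> Q by (intro powr_mono) auto
      then have "1 / Q \<le> \<delta>" using \<delta> Q by (simp add: powr_minus_divide)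
      have "Q = Q ^ 2 * (1 / Q)" using Q by (simp add: power2_eq_square)
      also have "\<dots> \<le> Q ^ (?m + 1) * \<delta>" using m Q \<open>1 / Q \<le> \<delta>\<close> by (intro mult_mono power_increasing) auto
      finally show "Q \<le> Q ^ (?m + 1) * \<delta>" .
    qed (use C0 Q \<delta>0 in auto)
    also have "\<dots> \<le> C * (Q ^ (?m + 1) * (\<delta> + (\<Sum>i<n. ?s i ^ ?m * ?M i)))"
    proof -
      have S: "(\<Sum>i<n. ?s i ^ ?m * ?M i) \<ge> 0" using \<delta>0 Q by (intro sum_nonneg) auto
      have "(2 * \<delta> + C0 * (4 * \<delta> + (\<Sum>i<n. ?s i ^ ?m * ?M i))) \<le> C * (\<delta> + (\<Sum>i<n. ?s i ^ ?m * ?M i))"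
      proof -
        have "0 \<le> C0 * (\<Sum>i<n. ?s i ^ ?m * ?M i)" using C0 S by simp
        then show ?thesis using S by (simp add: C_def algebra_simps)
      qed
      then have "Q ^ (?m + 1) * (2 * \<delta> + C0 * (4 * \<delta> + (\<Sum>i<n. ?s i ^ ?m * ?M i))) \<le> Q ^ (?m + 1) * (C * (\<delta> + (\<Sum>i<n. ?s i ^ ?m * ?M i)))"
        using Q by (intro mult_left_mono) auto
      then show ?thesis by (simp add: algebra_simps)
    qed
    finally show ?thesis by blast
  qed
  ultimately show ?thesis by blast
qed

section \<open>Lower bound\<close>

lemma legendre_subset:
  assumes "legendre L T x y u v" "T' \<subseteq> T"
  shows "legendre L T' x y u v"
proof -
  interpret legendre L T x y u v by fact
  have T: "p \<in> T" if "p \<in> T'" for p using assms(2) that by blast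
  show ?thesis
    by unfold_locales (intro L norm_x norm_y x_ge y_ge transform lip_x lip_y taylor_u taylor_v T; assumption)+
qed

text \<open>Dirichlet's argument: sort the pairs \<open>(q, a)\<close> by the fractional part of the
  height of the tangent plane into bins of width \<open>\<delta>\<close>. Differences from one fixed
  member of the fullest bin lie in the box, with the difference of the integer parts as last
  coordinate. Up to a constant the volume is attained even for \<open>\<delta>\<close> far below
  \<open>1\<close>.\<close>

lemma lbox_pigeonhole:
  fixes \<xi> \<eta> :: "real ^ 'm::finite" and X \<rho> \<delta> \<omega> :: real
  assumes X: "X \<ge> 1" and \<rho>: "\<rho> \<ge> 2 * real CARD('m)" and \<delta>: "0 < \<delta>" "\<delta> \<le> 1"
  shows "X * (\<rho> / (2 * real CARD('m))) ^ CARD('m) * \<delta> / 2 \<le> real (card (lbox \<xi> \<eta> \<omega> X \<rho> \<delta>))"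
proof -
  define m where "m = real CARD('m)"
  have m: "m \<ge> 1" by (simp add: m_def Suc_le_eq)
  define w where "w = \<lfloor>\<rho> / m\<rfloor>"
  have rm: "\<rho> / m \<ge> 2" using \<rho> m by (simp add: m_def field_simps)
  have w: "real_of_int w \<le> \<rho> / m" "\<rho> / (2 * m) \<le> real_of_int w" "w \<ge> 0"
  proof -
    have "\<rho> / (2 * m) = \<rho> / m / 2" by simp
    then show "\<rho> / (2 * m) \<le> real_of_int w" using rm unfolding w_def by linarith
    show "real_of_int w \<le> \<rho> / m" by (simp add: w_def)
    show "w \<ge> 0" using rm by (simp add: w_def)
  qed
  define A where "A = (\<lambda>q :: int. {a :: int ^ 'm. \<forall>i. a $ i \<in> {\<lceil>real_of_int q * \<xi> $ i\<rceil>..\<lceil>real_of_int q * \<xi> $ i\<rceil> + w - 1}})"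
  define P where "P = (SIGMA q : {0..\<lfloor>X\<rfloor>}. A q)"
  have finA: "finite (A q)" for q unfolding A_def by (rule finite_vec_set) simp
  have finP: "finite P" using finA by (simp add: P_def)
  have cA: "real (card (A q)) = real_of_int w ^ CARD('m)" for q
    unfolding A_def by (subst card_vec_set) (use w in simp)
  have cP: "X * (\<rho> / (2 * m)) ^ CARD('m) \<le> real (card P)"
  proof -
    have "X * (\<rho> / (2 * m)) ^ CARD('m) \<le> (real_of_int \<lfloor>X\<rfloor> + 1) * real_of_int w ^ CARD('m)"
      using X w rm m by (intro mult_mono power_mono) (auto simp: le_divide_eq)
    also have "\<dots> = real (card P)"
      using finA X by (simp add: P_def card_SigmaI cA)
    finally show ?thesis .
  qed
  define \<theta> where "\<theta> = (\<lambda>(q, a). real_of_int q * \<omega> + \<eta> \<bullet> (rvec a - real_of_int q *\<^sub>R \<xi>))"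
  define bin where "bin = (\<lambda>p. \<lfloor>frac (\<theta> p) / \<delta>\<rfloor>)"
  let ?B = "{0..\<lfloor>1 / \<delta>\<rfloor>}"
  have bin: "bin \<in> P \<rightarrow> ?B"
  proof
    fix p
    have "frac (\<theta> p) / \<delta> \<le> 1 / \<delta>" using \<delta> frac_lt_1[of "\<theta> p"] by (intro divide_right_mono) auto
    then show "bin p \<in> ?B" using \<delta> frac_ge_0[of "\<theta> p"] by (auto simp: bin_def intro: floor_mono)
  qed
  have cB: "real (card ?B) \<le> 2 / \<delta>"
  proof -
    have "1 \<le> 1 / \<delta>" using \<delta> by simp
    moreover have "2 / \<delta> = 2 * (1 / \<delta>)" by simp
    moreover have "real (card ?B) = real_of_int \<lfloor>1 / \<delta>\<rfloor> + 1" using \<delta> by simp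
    ultimately show ?thesis by linarith
  qed
  have "\<lfloor>1 / \<delta>\<rfloor> \<ge> 0" using \<delta> by simp
  then have "?B \<noteq> {}" by simp
  from pigeonhole_card[OF bin finP _ this] obtain k where k: "card P \<le> card (bin -` {k} \<inter> P) * card ?B" by auto
  let ?S = "bin -` {k} \<inter> P"
  have "real (card P) \<le> real (card ?S) * real (card ?B)" using k by (metis of_nat_le_iff of_nat_mult)
  also have "\<dots> \<le> real (card ?S) * (2 / \<delta>)" by (intro mult_left_mono cB) auto
  finally have cS: "real (card P) * \<delta> / 2 \<le> real (card ?S)" using \<delta> by (simp add: field_simps)
  have "X * (\<rho> / (2 * m)) ^ CARD('m) > 0" using X rm m \<rho> by (intro mult_pos_pos zero_less_power) (auto simp: m_def)
  then have "real (card P) * \<delta> / 2 > 0" using cP \<delta> by auto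
  then have "?S \<noteq> {}" using cS by (metis card.empty not_less of_nat_0)
  then obtain q0 a0 where p0: "(q0, a0) \<in> ?S" by auto
  have "card ?S \<le> card (lbox \<xi> \<eta> \<omega> X \<rho> \<delta>)"
  proof (rule card_inj_on_le[where f = "\<lambda>(q, a). (q - q0, a - a0, \<lfloor>\<theta> (q, a)\<rfloor> - \<lfloor>\<theta> (q0, a0)\<rfloor>)"])
    show "inj_on (\<lambda>(q, a). (q - q0, a - a0, \<lfloor>\<theta> (q, a)\<rfloor> - \<lfloor>\<theta> (q0, a0)\<rfloor>)) ?S"
    proof (rule inj_onI)
      fix p p' :: "int \<times> (int ^ 'm)"
      assume "(\<lambda>(q, a). (q - q0, a - a0, \<lfloor>\<theta> (q, a)\<rfloor> - \<lfloor>\<theta> (q0, a0)\<rfloor>)) p = (\<lambda>(q, a). (q - q0, a - a0, \<lfloor>\<theta> (q, a)\<rfloor> - \<lfloor>\<theta> (q0, a0)\<rfloor>)) p'"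
      then show "p = p'" by (cases p; cases p') simp
    qed
    show "finite (lbox \<xi> \<eta> \<omega> X \<rho> \<delta>)" using X \<rho> \<delta> by (intro lbox_trivial) auto
    show "(\<lambda>(q, a). (q - q0, a - a0, \<lfloor>\<theta> (q, a)\<rfloor> - \<lfloor>\<theta> (q0, a0)\<rfloor>)) ` ?S \<subseteq> lbox \<xi> \<eta> \<omega> X \<rho> \<delta>"
    proof
      fix s assume "s \<in> (\<lambda>(q, a). (q - q0, a - a0, \<lfloor>\<theta> (q, a)\<rfloor> - \<lfloor>\<theta> (q0, a0)\<rfloor>)) ` ?S"
      then obtain q a where qa: "(q, a) \<in> P" "bin (q, a) = k"
        and s: "s = (q - q0, a - a0, \<lfloor>\<theta> (q, a)\<rfloor> - \<lfloor>\<theta> (q0, a0)\<rfloor>)" by auto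
      let ?v = "\<lambda>q a. rvec a - real_of_int q *\<^sub>R \<xi>"
      have comp: "0 \<le> ?v q a $ i \<and> ?v q a $ i \<le> real_of_int w" if "(q, a) \<in> P" for q a i
      proof -
        have "\<lceil>real_of_int q * \<xi> $ i\<rceil> \<le> a $ i" "a $ i \<le> \<lceil>real_of_int q * \<xi> $ i\<rceil> + w - 1"
          using that by (auto simp: P_def A_def)
        then show ?thesis by simp linarith
      qed
      have P0: "(q0, a0) \<in> P" "bin (q0, a0) = k" using p0 by auto
      have v: "rvec (a - a0) - real_of_int (q - q0) *\<^sub>R \<xi> = ?v q a - ?v q0 a0"
        by (simp add: rvec_diff scaleR_left_diff_distrib)
      have "norm (?v q a - ?v q0 a0) \<le> real CARD('m) * (\<rho> / m)"
      proof (rule norm_le_card_bound)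
        fix i show "\<bar>(?v q a - ?v q0 a0) $ i\<bar> \<le> \<rho> / m"
          using comp[OF qa(1), of i] comp[OF P0(1), of i] w(1) by (simp only: vector_minus_component) linarith
      qed
      then have n: "norm (?v q a - ?v q0 a0) \<le> \<rho>" using m by (simp add: m_def)
      have "q \<in> {0..\<lfloor>X\<rfloor>}" "q0 \<in> {0..\<lfloor>X\<rfloor>}" using qa P0 by (auto simp: P_def)
      then have q: "\<bar>real_of_int (q - q0)\<bar> \<le> X" by simp linarith
      have "\<lfloor>frac (\<theta> (q, a)) / \<delta>\<rfloor> = \<lfloor>frac (\<theta> (q0, a0)) / \<delta>\<rfloor>" using qa P0 by (simp add: bin_def)
      then have "\<bar>frac (\<theta> (q, a)) / \<delta> - frac (\<theta> (q0, a0)) / \<delta>\<bar> \<le> 1" by linarith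
      then have fr: "\<bar>frac (\<theta> (q, a)) - frac (\<theta> (q0, a0))\<bar> \<le> \<delta>"
        using \<delta> by (simp add: diff_divide_distrib[symmetric] field_simps)
      have "real_of_int (\<lfloor>\<theta> (q, a)\<rfloor> - \<lfloor>\<theta> (q0, a0)\<rfloor>) - real_of_int (q - q0) * \<omega> - \<eta> \<bullet> (?v q a - ?v q0 a0)
          = frac (\<theta> (q0, a0)) - frac (\<theta> (q, a))"
        by (simp add: frac_def \<theta>_def inner_diff_right algebra_simps)
      then show "s \<in> lbox \<xi> \<eta> \<omega> X \<rho> \<delta>"
        using q n fr unfolding s lbox_def mem_Collect_eq prod.case v by (simp add: abs_minus_commute)
    qed
  qed
  then have "real (card ?S) \<le> real (card (lbox \<xi> \<eta> \<omega> X \<rho> \<delta>))" by simp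
  moreover have "X * (\<rho> / (2 * m)) ^ CARD('m) * \<delta> / 2 \<le> real (card P) * \<delta> / 2"
    using cP \<delta> by (simp add: mult_right_mono)
  ultimately show ?thesis using cS unfolding m_def by linarith
qed

text \<open>Multiplying \<open>(q, a)\<close> by \<open>\<lceil>Q / q\<rceil>\<close> moves the denominator into \<open>[Q, 2 * Q)\<close> without
  changing \<open>a / q\<close>.\<close>

lemma card_le_rational_points:
  fixes f :: "real ^ 'm::finite \<Rightarrow> real" and W :: "(int \<times> (int ^ 'm) \<times> int) set"
  assumes \<eta>: "0 < \<eta>" "\<eta> \<le> 1" and Q: "Q \<ge> 1" and \<delta>: "0 < \<delta>" "\<delta> < 1"
    and W: "\<And>q a b. (q, a, b) \<in> W \<Longrightarrow> \<eta> * Q < real_of_int q \<and> real_of_int q \<le> Q \<and>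
      norm ((1 / real_of_int q) *\<^sub>R rvec a) < 1 \<and>
      \<bar>real_of_int b - real_of_int q * f ((1 / real_of_int q) *\<^sub>R rvec a)\<bar> \<le> \<eta> * \<delta> / 2"
  shows "real (card W) \<le> real (N f \<delta> Q) * (2 / \<eta>)"
proof -
  define M where "M = (\<lambda>q :: int. \<lceil>Q / real_of_int q\<rceil>)"
  let ?M = "{1..\<lceil>1 / \<eta>\<rceil>}"
  have M: "M q \<ge> 1" "M q \<le> \<lceil>1 / \<eta>\<rceil>" "Q \<le> real_of_int (M q) * real_of_int q" "real_of_int (M q) * real_of_int q < 2 * Q"
     "real_of_int (M q) \<le> 2 / \<eta>"
    if q: "\<eta> * Q < real_of_int q" "real_of_int q \<le> Q" for q
  proof -
    have q0: "real_of_int q > 0" using q \<eta> Q by (meson less_trans mult_pos_pos less_le_trans zero_less_one)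
    have b: "1 \<le> Q / real_of_int q" "Q / real_of_int q < 1 / \<eta>" using q q0 \<eta> by (simp_all add: field_simps)
    then show "M q \<ge> 1" unfolding M_def by linarith
    show "M q \<le> \<lceil>1 / \<eta>\<rceil>" unfolding M_def using b by (intro ceiling_mono) simp
    have c: "Q / real_of_int q \<le> real_of_int (M q)" "real_of_int (M q) < Q / real_of_int q + 1"
      unfolding M_def by linarith+
    show "Q \<le> real_of_int (M q) * real_of_int q" using c(1) q0 by (simp add: field_simps)
    have "real_of_int (M q) * real_of_int q < (Q / real_of_int q + 1) * real_of_int q"
      using c(2) q0 by (intro mult_strict_right_mono)
    also have "\<dots> = Q + real_of_int q" using q0 by (simp add: field_simps)
    finally show "real_of_int (M q) * real_of_int q < 2 * Q" using q by linarith
    have "1 \<le> 1 / \<eta>" using \<eta> by simp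
    moreover have "2 / \<eta> = 1 / \<eta> + 1 / \<eta>" by simp
    ultimately show "real_of_int (M q) \<le> 2 / \<eta>" using c(2) b(2) by linarith
  qed
  have "card W \<le> card (rational_points f \<delta> Q \<times> ?M)"
  proof (rule card_inj_on_le[where f = "\<lambda>(q, a, b). ((M q * q, \<chi> i. M q * a $ i), M q)"])
    show "finite (rational_points f \<delta> Q \<times> ?M)" using Q by (intro finite_cartesian_product finite_rational_points) auto
    show "inj_on (\<lambda>(q, a, b). ((M q * q, \<chi> i. M q * a $ i), M q)) W"
    proof (rule inj_onI)
      fix s s'
      assume s: "s \<in> W" "s' \<in> W" "(\<lambda>(q, a, b). ((M q * q, \<chi> i. M q * a $ i), M q)) s = (\<lambda>(q, a, b). ((M q * q, \<chi> i. M q * a $ i), M q)) s'"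
      obtain q a b where e: "s = (q, a, b)" by (cases s)
      obtain q' a' b' where e': "s' = (q', a', b')" by (cases s')
      have h: "(q, a, b) \<in> W" "(q', a', b') \<in> W" and eq: "M q * q = M q' * q'" "(\<chi> i. M q * a $ i) = (\<chi> i. M q' * a' $ i)" "M q = M q'"
        using s unfolding e e' prod.case prod.inject by blast+
      have M0: "M q \<noteq> 0" using M(1)[of q] W[OF h(1)] by auto
      then have q: "q' = q" using eq by simp
      have a: "a' = a" using eq M0 by (simp add: vec_eq_iff)
      \<comment> \<open>Injectivity in the last coordinate: two integers this close to the same
        number coincide.\<close>
      have "\<bar>real_of_int b - real_of_int q * f ((1 / real_of_int q) *\<^sub>R rvec a)\<bar> \<le> \<eta> * \<delta> / 2"
        "\<bar>real_of_int b' - real_of_int q * f ((1 / real_of_int q) *\<^sub>R rvec a)\<bar> \<le> \<eta> * \<delta> / 2"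
        using W[OF h(1)] W[OF h(2)] q a by auto
      moreover have "\<eta> * \<delta> \<le> 1 * \<delta>" using \<eta> \<delta> by (intro mult_right_mono) auto
      ultimately have "\<bar>real_of_int b - real_of_int b'\<bar> < 1" using \<delta> by linarith
      then have "b = b'" by linarith
      then show "s = s'" using q a by (simp add: e e')
    qed
    show "(\<lambda>(q, a, b). ((M q * q, \<chi> i. M q * a $ i), M q)) ` W \<subseteq> rational_points f \<delta> Q \<times> ?M"
    proof
      fix s assume "s \<in> (\<lambda>(q, a, b). ((M q * q, \<chi> i. M q * a $ i), M q)) ` W"
      then obtain q a b where h: "(q, a, b) \<in> W" and s: "s = ((M q * q, \<chi> i. M q * a $ i), M q)" by auto
      note w = W[OF h]
      have Mq: "M q \<ge> 1" "M q \<le> \<lceil>1 / \<eta>\<rceil>" "Q \<le> real_of_int (M q) * real_of_int q" "real_of_int (M q) * real_of_int q < 2 * Q"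
        "real_of_int (M q) \<le> 2 / \<eta>" using M w by auto
      define x where "x = (1 / real_of_int q) *\<^sub>R rvec a"
      have M0: "real_of_int (M q) > 0" using Mq by simp
      have "rvec (\<chi> i. M q * a $ i) = real_of_int (M q) *\<^sub>R rvec a" by (simp add: vec_eq_iff)
      then have x: "(1 / real_of_int (M q * q)) *\<^sub>R rvec (\<chi> i. M q * a $ i) = x"
        using M0 by (simp add: x_def)
      have "\<bar>real_of_int (M q * q) * f x - real_of_int (M q * b)\<bar> = real_of_int (M q) * \<bar>real_of_int b - real_of_int q * f x\<bar>"
      proof -
        have "real_of_int (M q * q) * f x - real_of_int (M q * b) = - (real_of_int (M q) * (real_of_int b - real_of_int q * f x))"
          by (simp add: algebra_simps)
        then show ?thesis using M0 by (simp only: abs_minus_cancel abs_mult)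
      qed
      also have "\<dots> \<le> (2 / \<eta>) * (\<eta> * \<delta> / 2)" using w Mq M0 \<eta> \<delta> by (intro mult_mono) (auto simp: x_def)
      also have "\<dots> = \<delta>" using \<eta> by simp
      finally have "int_dist (real_of_int (M q * q) * f x) \<le> \<delta>" by (rule int_dist_le)
      then show "s \<in> rational_points f \<delta> Q \<times> ?M"
        using Mq w Q unfolding s mem_Times_iff fst_conv snd_conv rational_points_iff x by (auto simp: x_def field_simps)
    qed
  qed
  then have "real (card W) \<le> real (card (rational_points f \<delta> Q \<times> ?M))" by (rule of_nat_mono)
  also have "\<dots> = real (N f \<delta> Q) * real (card ?M)" by (simp add: card_cartesian_product N_def)
  also have "\<dots> \<le> real (N f \<delta> Q) * (2 / \<eta>)"
  proof (intro mult_left_mono)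
    have "1 \<le> 1 / \<eta>" using \<eta> by simp
    moreover have "2 / \<eta> = 1 / \<eta> + 1 / \<eta>" by simp
    moreover have "real (card ?M) = real_of_int \<lceil>1 / \<eta>\<rceil>" using \<eta> by simp
    ultimately show "real (card ?M) \<le> 2 / \<eta>" by linarith
  qed simp
  finally show ?thesis .
qed

text \<open>Settles bounded \<open>Q\<close>, where a lower bound for the count only has to be
  positive.\<close>

lemma N_ge_1:
  fixes f :: "real ^ 'm::finite \<Rightarrow> real"
  assumes f: "f \<in> homogeneous d" and Q: "Q \<ge> 1" and \<delta>: "\<delta> \<ge> 0"
  shows "N f \<delta> Q \<ge> 1"
proof -
  have f0: "f 0 = 0"
  proof -
    have "f (0 *\<^sub>R 0) = 0 powr d * f 0" using f unfolding homogeneous_def by blast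
    then show ?thesis by simp
  qed
  have "Q \<le> real_of_int \<lceil>Q\<rceil>" "real_of_int \<lceil>Q\<rceil> < 2 * Q" using Q by linarith+
  moreover have "int_dist 0 \<le> \<delta>" by (rule int_dist_le[of _ 0]) (use \<delta> in simp)
  ultimately have "(\<lceil>Q\<rceil>, 0) \<in> rational_points f \<delta> Q"
    unfolding rational_points_iff using Q by (simp add: f0 field_simps)
  moreover have "finite (rational_points f \<delta> Q)" using Q by (intro finite_rational_points) auto
  ultimately show ?thesis unfolding N_def by (metis One_nat_def Suc_leI card_gt_0_iff empty_iff)
qed

text \<open>Meant for a height \<open>X\<close> that is a small multiple of \<open>Q\<close>, to
  show that points with small denominator are few on average over the cells. Both scales are
  \<open>1\<close>. The assumption \<open>L \<le> \<rho>\<close> leaves at most \<open>3 * 3\<close>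
  dual points with \<open>k = 0\<close> per cell, whence the \<open>9\<close>.\<close>

lemma (in legendre) sum_card_tbox_le:
  assumes m: "CARD('m) \<ge> 2" and t: "t > 0" and cb: "counting_bound t T y x v" and \<kappa>: "\<kappa> > 0"
  shows "\<exists>C>0. \<forall>(I :: 'c set) r \<tau> X \<rho> \<delta>. finite I \<and> r ` I \<subseteq> T \<and> inj_on (\<lambda>c. cell \<tau> (x (r c))) I \<and>
     0 < \<tau> \<and> 1 \<le> X \<and> L \<le> \<rho> \<and> 0 < \<delta> \<and> \<delta> \<le> 1 / 9 \<and> \<delta> \<le> \<kappa> * (\<rho> * \<tau>) \<longrightarrow>
     (\<Sum>c\<in>I. real (card (tbox x y u 1 1 X \<rho> \<delta> (r c)))) \<le>
       4 * 18 ^ (CARD('m) + 2) * real CARD('m) ^ CARD('m) * (X * \<rho> ^ CARD('m) * \<delta>) *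
        (9 * real (card I) + C * ((1 / \<delta>) ^ CARD('m) * (1 / (\<delta> * X) + sqrt (1 / (\<delta> * X)) + (1 / \<delta>) powr t)))"
proof -
  define K where "K = 4 * 18 ^ (CARD('m) + 2) * real CARD('m) ^ CARD('m)"
  have K: "K \<ge> 0" by (simp add: K_def)
  obtain C where C: "C > 0" and dual_sum: "\<And>(I :: 'c set) r \<tau> s \<sigma> R A D. finite I \<and> r ` I \<subseteq> T \<and> inj_on (\<lambda>c. cell \<tau> (x (r c))) I \<and>
     0 < \<tau> \<and> 0 < s \<and> s \<le> 1 \<and> 0 < \<sigma> \<and> \<sigma> \<le> 1 \<and> 0 < R \<and> R \<le> 1 / 2 \<and> 0 < A \<and> 1 \<le> D \<and> R / (\<sigma> * \<tau>) \<le> \<kappa> * D \<Longrightarrow>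
     (\<Sum>c\<in>I. real (card (tbox y x v \<sigma> s D R A (r c)))) \<le>
       real (card I) * ((2 * (R * L / \<sigma>) + 1) * (2 * A + 1)) +
       C * ((D * \<sigma>) ^ CARD('m) * (D * A + sqrt (D * A / (\<sigma> * s)) + D powr t * \<sigma> powr (t - 1)))"
    using dual_sum_bound[OF t cb \<kappa>] by auto
  have "(\<Sum>c\<in>I. real (card (tbox x y u 1 1 X \<rho> \<delta> (r c)))) \<le> K * (X * \<rho> ^ CARD('m) * \<delta>) *
        (9 * real (card I) + C * ((1 / \<delta>) ^ CARD('m) * (1 / (\<delta> * X) + sqrt (1 / (\<delta> * X)) + (1 / \<delta>) powr t)))"
    if I: "finite I" "r ` I \<subseteq> T" "inj_on (\<lambda>c. cell \<tau> (x (r c))) I"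
      and h: "0 < \<tau>" "1 \<le> X" "L \<le> \<rho>" "0 < \<delta>" "\<delta> \<le> 1 / 9" "\<delta> \<le> \<kappa> * (\<rho> * \<tau>)"
    for I :: "'c set" and r \<tau> X \<rho> \<delta>
  proof -
    have \<rho>: "\<rho> \<ge> 1" using h L by linarith
    let ?D = "1 / (9 * \<delta>)" and ?R = "1 / (9 * \<rho>)" and ?A = "1 / (9 * X)"
    have "(\<Sum>c\<in>I. real (card (tbox x y u 1 1 X \<rho> \<delta> (r c)))) \<le>
       (\<Sum>c\<in>I. K * (X * \<rho> ^ CARD('m) * \<delta>) * real (card (tbox y x v 1 1 ?D ?R ?A (r c))))"
      unfolding K_def by (intro sum_mono tbox_transference) (use I h \<rho> in auto)
    also have "\<dots> = K * (X * \<rho> ^ CARD('m) * \<delta>) * (\<Sum>c\<in>I. real (card (tbox y x v 1 1 ?D ?R ?A (r c))))"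
      by (simp add: sum_distrib_left)
    also have "\<dots> \<le> K * (X * \<rho> ^ CARD('m) * \<delta>) * (real (card I) * ((2 * (?R * L / 1) + 1) * (2 * ?A + 1)) +
       C * ((?D * 1) ^ CARD('m) * (?D * ?A + sqrt (?D * ?A / (1 * 1)) + ?D powr t * 1 powr (t - 1))))"
    proof (intro mult_left_mono dual_sum conjI)
      show "?R / (1 * \<tau>) \<le> \<kappa> * ?D" using h \<rho> by (simp add: field_simps)
    qed (use I h \<rho> K in auto)
    also have "\<dots> \<le> K * (X * \<rho> ^ CARD('m) * \<delta>) * (9 * real (card I) +
       C * ((1 / \<delta>) ^ CARD('m) * (1 / (\<delta> * X) + sqrt (1 / (\<delta> * X)) + (1 / \<delta>) powr t)))"
    proof (rule mult_left_mono[OF add_mono])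
      have "?R * L \<le> 1" "?A \<le> 1" using h \<rho> L by (simp_all add: field_simps)
      then have "2 * (?R * L / 1) + 1 \<le> 3" "2 * ?A + 1 \<le> 3" by linarith+
      then have "(2 * (?R * L / 1) + 1) * (2 * ?A + 1) \<le> 3 * 3" by (rule mult_mono) (use h in auto)
      then have "real (card I) * ((2 * (?R * L / 1) + 1) * (2 * ?A + 1)) \<le> real (card I) * 9" by (intro mult_left_mono) auto
      then show "real (card I) * ((2 * (?R * L / 1) + 1) * (2 * ?A + 1)) \<le> 9 * real (card I)" by (simp only: mult.commute)
      have D: "0 < ?D" "?D \<le> 1 / \<delta>" using h by (simp_all add: field_simps)
      have A: "0 < ?A" "?A \<le> 1 / X" using h by (simp_all add: field_simps)
      have DA: "?D * ?A \<le> 1 / (\<delta> * X)" using mult_mono[OF D(2) A(2)] D A h by simp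
      show "C * ((?D * 1) ^ CARD('m) * (?D * ?A + sqrt (?D * ?A / (1 * 1)) + ?D powr t * 1 powr (t - 1))) \<le>
         C * ((1 / \<delta>) ^ CARD('m) * (1 / (\<delta> * X) + sqrt (1 / (\<delta> * X)) + (1 / \<delta>) powr t))"
      proof (rule mult_left_mono[OF mult_mono[OF _ add_mono[OF add_mono]]])
        show "(?D * 1) ^ CARD('m) \<le> (1 / \<delta>) ^ CARD('m)" using D by (intro power_mono) auto
        show "?D * ?A \<le> 1 / (\<delta> * X)" by (rule DA)
        show "sqrt (?D * ?A / (1 * 1)) \<le> sqrt (1 / (\<delta> * X))" using DA by (intro real_sqrt_le_mono) simp
        have "?D powr t \<le> (1 / \<delta>) powr t" using D t by (intro powr_mono2) auto
        then show "?D powr t * 1 powr (t - 1) \<le> (1 / \<delta>) powr t" by simp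
      qed (use C D A h in auto)
    qed (use K h \<rho> in auto)
    finally show ?thesis .
  qed
  then show ?thesis using C unfolding K_def by (intro exI[of _ C]) auto
qed

text \<open>One small ball at distance about \<open>1 / 2\<close> from the origin already supplies
  enough points. The cells there have mesh \<open>\<tau> = \<rho> / Q\<close>, so that boxes of
  width \<open>\<rho>\<close> overlap only boundedly often once small denominators are
  removed.\<close>

lemma homogeneous_nondeg_lower:
  fixes f :: "real ^ 'm::finite \<Rightarrow> real"
  assumes m: "CARD('m) \<ge> 2" and f: "f \<in> homogeneous_nondeg d" and \<epsilon>: "0 < \<epsilon>" "\<epsilon> < 1"
  shows "\<exists>C>0. \<forall>\<delta> Q. 1 \<le> Q \<and> Q powr (\<epsilon> - 1) < \<delta> \<and> \<delta> < 1 / 2 \<longrightarrow>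
     \<delta> * Q ^ (CARD('m) + 1) \<le> C * real (N f \<delta> Q)"
proof -
  let ?m = "CARD('m)"
  obtain k where k: "1 / (real k + 1) < \<epsilon> / 2"
    using reals_Archimedean[of "\<epsilon> / 2"] \<epsilon>(1) by (auto simp: inverse_eq_divide add.commute)
  define t where "t = 1 / (real k + 1)"
  have t: "t > 0" "t < \<epsilon> / 2" using k by (auto simp: t_def)
  define z :: "real ^ 'm" where "z = (1 / 2) *\<^sub>R axis undefined 1"
  have z: "norm z = 1 / 2" by (simp add: z_def)
  then have "z \<noteq> 0" by auto
  from homogeneous_nondeg_local_legendre[OF f this] obtain e L where e: "e > 0"
    and leg: "legendre L (ball z e) (\<lambda>p. p) (grad f) f (\<lambda>p. p \<bullet> grad f p - f p)" by blast
  define r0 where "r0 = min e (1 / 4)"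
  have r0: "r0 > 0" "r0 \<le> 1 / 4" using e by (auto simp: r0_def)
  let ?T = "ball z r0"
  interpret legendre L ?T "\<lambda>p. p" "grad f" f "\<lambda>p. p \<bullet> grad f p - f p"
    by (rule legendre_subset[OF leg]) (auto simp: r0_def)
  have cb: "counting_bound t ?T (grad f) (\<lambda>p. p) (\<lambda>p. p \<bullet> grad f p - f p)"
    unfolding t_def by (rule legendre_counting_bound[OF dual m])
  define m' where "m' = real ?m"
  have m': "m' \<ge> 2" using m by (simp add: m'_def)
  \<comment> \<open>The proportion of the volume guaranteed by
    \<open>lbox_pigeonhole\<close>.\<close>
  define c2 where "c2 = 1 / (2 * (2 * m') ^ ?m)"
  have c2: "c2 > 0" "c2 \<le> 1"
    using m' one_le_power[of "2 * m'" ?m] by (auto simp: c2_def field_simps)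
  define K where "K = 4 * 18 ^ (?m + 2) * m' ^ ?m"
  have K: "K \<ge> 1" unfolding K_def using m' by (intro mult_ge1_I one_le_power) auto
  \<comment> \<open>Then \<open>10 * K * \<eta> = c2 / 2\<close>: denominators up to
    \<open>\<eta> * Q\<close> use up at most half of the points provided by the pigeonhole
    principle.\<close>
  define \<eta> where "\<eta> = c2 / (20 * K)"
  have \<eta>: "\<eta> > 0" "\<eta> \<le> 1" using c2 K by (auto simp: \<eta>_def field_simps)
  \<comment> \<open>With \<open>\<rho>\<^sup>2 = \<theta> * (\<delta> * Q)\<close> the Taylor error
    \<open>L * \<rho>\<^sup>2 / (\<eta> * Q)\<close> becomes \<open>\<eta> * \<delta> / 4\<close>,
    half of what \<open>card_le_rational_points\<close> tolerates.\<close>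
  define \<theta> where "\<theta> = \<eta>\<^sup>2 / (4 * L)"
  have "\<eta>\<^sup>2 \<le> 1" using \<eta> by (simp add: power_le_one)
  then have \<theta>: "\<theta> > 0" "\<theta> \<le> 1" using \<eta> L by (auto simp: \<theta>_def field_simps)
  \<comment> \<open>Makes \<open>\<kappa> * (\<rho> * \<tau>)\<close> equal to the box tolerance
    \<open>\<eta> * \<delta> / 4\<close>.\<close>
  define \<kappa> where "\<kappa> = \<eta> / (4 * \<theta>)"
  have \<kappa>: "\<kappa> > 0" using \<eta> \<theta> by (simp add: \<kappa>_def)
  obtain C where C: "C > 0" and sum_le: "\<And>(I :: (int ^ 'm) set) r \<tau> X \<rho> \<delta>. finite I \<and> r ` I \<subseteq> ?T \<and> inj_on (\<lambda>c. cell \<tau> (r c)) I \<and>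
     0 < \<tau> \<and> 1 \<le> X \<and> L \<le> \<rho> \<and> 0 < \<delta> \<and> \<delta> \<le> 1 / 9 \<and> \<delta> \<le> \<kappa> * (\<rho> * \<tau>) \<Longrightarrow>
     (\<Sum>c\<in>I. real (card (tbox (\<lambda>p. p) (grad f) f 1 1 X \<rho> \<delta> (r c)))) \<le> K * (X * \<rho> ^ ?m * \<delta>) *
        (9 * real (card I) + C * ((1 / \<delta>) ^ ?m * (1 / (\<delta> * X) + sqrt (1 / (\<delta> * X)) + (1 / \<delta>) powr t)))"
    using sum_card_tbox_le[OF m t(1) cb \<kappa>] unfolding K_def m'_def by blast
  define c3 where "c3 = r0 / (4 * m')"
  have c3: "c3 > 0" using r0 m' by (simp add: c3_def)
  \<comment> \<open>An upper limit for the mesh \<open>\<tau>\<close>: the first entry gives the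
    grid enough points, the second keeps \<open>a / q\<close> within \<open>r0 / 4\<close> of the
    grid point it belongs to.\<close>
  define r1 where "r1 = min c3 (\<eta> * r0 / 4)"
  have r1: "r1 > 0" "r1 \<le> c3" "r1 \<le> \<eta> * r0 / 4" using c3 \<eta> r0 by (auto simp: r1_def)
  define B4 where "B4 = C * (12 / \<eta>\<^sup>2) * (4 / (\<eta> * c3)) ^ ?m"
  \<comment> \<open>After the \<open>1\<close>, the summands force in turn
    \<open>\<rho> \<ge> 2 * m' + L\<close>, \<open>X \<ge> 1\<close>, \<open>\<tau> \<le> r1\<close>
    and the smallness of the dual error.\<close>
  define B where "B = 1 + (2 * m' + L)\<^sup>2 / \<theta> + 1 / \<eta> + 1 / r1\<^sup>2 + B4"
  have nn: "(2 * m' + L)\<^sup>2 / \<theta> \<ge> 0" "1 / \<eta> \<ge> 0" "1 / r1\<^sup>2 \<ge> 0" "B4 \<ge> 0"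
    using \<theta> \<eta> c3 C by (auto simp: B4_def)
  have B: "B \<ge> 1" "B \<ge> (2 * m' + L)\<^sup>2 / \<theta>" "B \<ge> 1 / \<eta>" "B \<ge> 1 / r1\<^sup>2" "B \<ge> B4"
    using nn unfolding B_def by linarith+
  define Q0 where "Q0 = B powr (2 / \<epsilon>)"
  have Q0: "Q0 \<ge> 1" unfolding Q0_def using B \<epsilon> by (intro ge_one_powr_ge_zero) auto
  define C1 where "C1 = (2 / \<eta>) * (4 / \<eta>) ^ ?m * (16 / (c2 * c3 ^ ?m * \<eta>))"
  have C1: "C1 > 0" using \<eta> c2 c3 by (simp add: C1_def)
  have main: "\<delta> * Q ^ (?m + 1) \<le> C1 * real (N f \<delta> Q)"
    if Q: "1 \<le> Q" and \<delta>: "Q powr (\<epsilon> - 1) < \<delta>" "\<delta> < 1 / 2" and QB: "Q powr (\<epsilon> / 2) \<ge> B" for \<delta> Q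
  proof -
    have \<delta>0: "\<delta> > 0" using \<delta>(1) by (meson powr_ge_zero le_less_trans)
    have \<delta>Q: "\<delta> * Q \<ge> Q powr \<epsilon>"
    proof -
      have "Q powr \<epsilon> = Q powr (\<epsilon> - 1) * Q" using Q powr_add[of Q "\<epsilon> - 1" 1] by simp
      also have "\<dots> \<le> \<delta> * Q" using \<delta> Q by (intro mult_right_mono) auto
      finally show ?thesis .
    qed
    have "Q powr (\<epsilon> / 2) \<le> Q powr \<epsilon>" using Q \<epsilon> by (intro powr_mono) auto
    then have \<delta>QB: "\<delta> * Q \<ge> B" using QB \<delta>Q by linarith
    have "Q powr (\<epsilon> / 2) \<le> Q powr 1" using Q \<epsilon> by (intro powr_mono) auto
    then have QB': "Q \<ge> B" using QB Q by simp
    define \<rho> where "\<rho> = sqrt (\<theta> * (\<delta> * Q))"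
    have \<rho>2: "\<rho>\<^sup>2 = \<theta> * (\<delta> * Q)" using \<theta> \<delta>0 Q by (simp add: \<rho>_def)
    have \<rho>: "2 * m' + L \<le> \<rho>"
    proof (rule power2_le_imp_le)
      have "(2 * m' + L)\<^sup>2 = \<theta> * ((2 * m' + L)\<^sup>2 / \<theta>)" using \<theta> by simp
      also have "\<dots> \<le> \<theta> * (\<delta> * Q)" using B(2) \<delta>QB \<theta> by (intro mult_left_mono) auto
      finally show "(2 * m' + L)\<^sup>2 \<le> \<rho>\<^sup>2" using \<rho>2 by simp
    qed (use \<theta> \<delta>0 Q in \<open>simp add: \<rho>_def\<close>)
    then have \<rho>': "\<rho> \<ge> L" "\<rho> \<ge> 2 * m'" "\<rho> > 0" using m' L by linarith+
    define X where "X = \<eta> * Q"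
    have X: "X \<ge> 1"
    proof -
      have "1 = \<eta> * (1 / \<eta>)" using \<eta> by simp
      also have "\<dots> \<le> \<eta> * Q" using B(3) QB' \<eta> by (intro mult_left_mono) auto
      finally show ?thesis by (simp add: X_def)
    qed
    define \<tau> where "\<tau> = \<rho> / Q"
    have \<tau>0: "\<tau> > 0" using \<rho>' Q by (simp add: \<tau>_def)
    have \<tau>: "\<tau> \<le> r1"
    proof (rule power2_le_imp_le)
      have "\<tau>\<^sup>2 = \<theta> * \<delta> / Q" using Q by (simp add: \<tau>_def power_divide \<rho>2) (simp add: power2_eq_square)
      also have "\<dots> \<le> 1 / Q" using \<theta> \<delta> \<delta>0 Q by (intro divide_right_mono mult_le_one) auto
      also have "\<dots> \<le> 1 / (1 / r1\<^sup>2)" using B(4) QB' r1 Q by (intro divide_left_mono) auto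
      finally show "\<tau>\<^sup>2 \<le> r1\<^sup>2" by simp
    qed (use r1 in simp)
    define \<delta>1 where "\<delta>1 = \<eta> * \<delta> / 4"
    have \<delta>1: "0 < \<delta>1" "\<delta>1 \<le> 1 / 9"
    proof -
      have "\<eta> \<le> 1 / 20" using c2 K by (auto simp: \<eta>_def field_simps)
      then have "\<eta> * \<delta> \<le> 1 / 20 * (1 / 2)" using \<eta> \<delta> \<delta>0 by (intro mult_mono) auto
      then show "\<delta>1 \<le> 1 / 9" by (simp add: \<delta>1_def)
    qed (use \<eta> \<delta>0 in \<open>simp add: \<delta>1_def\<close>)
    define I where "I = {c :: int ^ 'm. \<forall>i. c $ i \<in> {j. \<bar>real_of_int j - z $ i / \<tau>\<bar> \<le> c3 / \<tau>}}"
    define r where "r = (\<lambda>c :: int ^ 'm. \<tau> *\<^sub>R rvec c)"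
    have w1: "c3 / \<tau> \<ge> 1" using \<tau> r1 \<tau>0 by simp
    have finI: "finite I"
      unfolding I_def by (intro finite_vec_set int_interval_bounds(1)) (use w1 in linarith)
    have cI: "(c3 / \<tau>) ^ ?m \<le> real (card I)"
    proof -
      have "(c3 / \<tau>) ^ ?m = (\<Prod>i\<in>(UNIV :: 'm set). c3 / \<tau>)" by simp
      also have "\<dots> \<le> (\<Prod>i\<in>UNIV. real (card {j. \<bar>real_of_int j - z $ i / \<tau>\<bar> \<le> c3 / \<tau>}))"
      proof (intro prod_mono conjI)
        fix i
        have "c3 / \<tau> \<ge> 0" using w1 by linarith
        from int_interval_bounds(3)[OF this, of "z $ i / \<tau>"]
        show "c3 / \<tau> \<le> real (card {j. \<bar>real_of_int j - z $ i / \<tau>\<bar> \<le> c3 / \<tau>})" using w1 by linarith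
      qed (use w1 in linarith)
      also have "\<dots> = real (card I)" unfolding I_def by (subst card_vec_set) simp
      finally show ?thesis .
    qed
    have rI: "norm (r c - z) \<le> r0 / 4" if c: "c \<in> I" for c
    proof -
      have "norm (r c - z) \<le> real ?m * c3"
      proof (rule norm_le_card_bound)
        fix i
        have "\<bar>real_of_int (c $ i) - z $ i / \<tau>\<bar> \<le> c3 / \<tau>" using c by (simp add: I_def)
        then have "\<tau> * \<bar>real_of_int (c $ i) - z $ i / \<tau>\<bar> \<le> c3" using \<tau>0 by (simp add: field_simps)
        moreover have "\<tau> * \<bar>real_of_int (c $ i) - z $ i / \<tau>\<bar> = \<bar>\<tau> * (real_of_int (c $ i) - z $ i / \<tau>)\<bar>"
          using \<tau>0 by (simp add: abs_mult)
        moreover have "\<tau> * (real_of_int (c $ i) - z $ i / \<tau>) = (r c - z) $ i"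
          using \<tau>0 by (simp add: r_def right_diff_distrib)
        ultimately show "\<bar>(r c - z) $ i\<bar> \<le> c3" by simp
      qed
      also have "real ?m * c3 = r0 / 4" using m' by (simp add: c3_def m'_def)
      finally show ?thesis .
    qed
    have rT: "r c \<in> ?T" if "c \<in> I" for c
      using rI[OF that] r0 by (simp add: dist_norm norm_minus_commute)
    have cell_r: "cell \<tau> (r c) = c" for c
      using \<tau>0 by (simp add: cell_def r_def vec_eq_iff)
    let ?P = "\<lambda>X c. tbox (\<lambda>p. p) (grad f) f 1 1 X \<rho> \<delta>1 (r c)"
    define W where "W = (\<lambda>c. {(q, a, b) \<in> ?P Q c. X < real_of_int q})"
    define Y where "Y = Q * \<rho> ^ ?m * \<delta>1"
    have Y: "Y > 0" using Q \<rho>' \<delta>1 by (simp add: Y_def)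
    have finP: "finite (?P X' c)" if "X' \<ge> 0" for X' c
      by (rule finite_tbox) (use that \<rho>' \<delta>1 in auto)
    have finW: "finite (W c)" for c
      by (rule finite_subset[OF _ finP[of Q c]]) (use Q in \<open>auto simp: W_def\<close>)
    have many: "c2 * Y \<le> real (card (?P Q c))" for c
    proof -
      have "Q * (\<rho> / (2 * real ?m)) ^ ?m * \<delta>1 / 2 \<le> real (card (?P Q c))"
        unfolding tbox_def by (rule lbox_pigeonhole) (use Q \<rho>' \<delta>1 in \<open>auto simp: m'_def\<close>)
      moreover have "Q * (\<rho> / (2 * real ?m)) ^ ?m * \<delta>1 / 2 = c2 * Y"
        by (simp add: c2_def Y_def m'_def power_divide)
      ultimately show ?thesis by simp
    qed
    have few: "(\<Sum>c\<in>I. real (card (?P X c))) \<le> c2 / 2 * Y * real (card I)"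
    proof -
      have inj: "inj_on (\<lambda>c. cell \<tau> (r c)) I" by (simp add: cell_r)
      have "\<kappa> * (\<rho> * \<tau>) = \<kappa> * (\<rho>\<^sup>2 / Q)" by (simp add: \<tau>_def power2_eq_square)
      also have "\<dots> = \<delta>1" using Q \<theta> by (simp add: \<rho>2 \<kappa>_def \<delta>1_def)
      finally have k: "\<delta>1 \<le> \<kappa> * (\<rho> * \<tau>)" by simp
      have "(\<Sum>c\<in>I. real (card (?P X c))) \<le> K * (X * \<rho> ^ ?m * \<delta>1) *
        (9 * real (card I) + C * ((1 / \<delta>1) ^ ?m * (1 / (\<delta>1 * X) + sqrt (1 / (\<delta>1 * X)) + (1 / \<delta>1) powr t)))"
        using rT inj k finI \<tau>0 X \<rho>' \<delta>1 by (intro sum_le) auto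
      also have "\<dots> \<le> K * (X * \<rho> ^ ?m * \<delta>1) * (9 * real (card I) + real (card I))"
      proof (intro mult_left_mono add_left_mono)
        have i2: "1 / \<eta> \<ge> 1" "1 / \<eta> \<le> 1 / \<eta>\<^sup>2" using \<eta> by (simp_all add: field_simps power2_eq_square)
        have "\<delta>1 * X = \<eta>\<^sup>2 / 4 * (\<delta> * Q)" by (simp add: \<delta>1_def X_def power2_eq_square)
        also have "\<dots> \<ge> \<eta>\<^sup>2 / 4 * 1" using \<delta>QB B \<eta> by (intro mult_left_mono) auto
        finally have dX: "\<eta>\<^sup>2 / 4 \<le> \<delta>1 * X" by simp
        have "\<eta>\<^sup>2 / 4 > 0" using \<eta> by simp
        then have "1 / (\<delta>1 * X) \<le> 1 / (\<eta>\<^sup>2 / 4)" using dX X \<delta>1 \<eta> by (intro divide_left_mono) auto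
        then have t1: "1 / (\<delta>1 * X) \<le> 4 / \<eta>\<^sup>2" by simp
        have "sqrt (1 / (\<delta>1 * X)) \<le> sqrt ((2 / \<eta>)\<^sup>2)" using t1 by (intro real_sqrt_le_mono) (simp add: power_divide)
        also have "\<dots> = 2 / \<eta>" using \<eta> by simp
        finally have t2: "sqrt (1 / (\<delta>1 * X)) \<le> 4 / \<eta>\<^sup>2" using i2 by simp
        have t3: "(1 / \<delta>1) powr t \<le> 4 / \<eta>\<^sup>2 * Q powr t"
        proof -
          have "1 \<le> \<delta> * Q" using \<delta>QB B by linarith
          then have "1 / \<delta> \<le> Q" using \<delta>0 by (simp add: field_simps)
          then have "4 / \<eta> * (1 / \<delta>) \<le> 4 / \<eta> * Q" using \<eta> by (intro mult_left_mono) auto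
          then have "(1 / \<delta>1) powr t \<le> (4 / \<eta> * Q) powr t" using \<delta>1 t by (intro powr_mono2) (auto simp: \<delta>1_def)
          also have "\<dots> = (4 / \<eta>) powr t * Q powr t" by (rule powr_mult)
          also have "(4 / \<eta>) powr t \<le> (4 / \<eta>) powr 1" using \<eta> t \<epsilon> by (intro powr_mono) (auto simp: field_simps)
          also have "\<dots> \<le> 4 / \<eta>\<^sup>2" using i2 \<eta> by simp
          finally show ?thesis using Q by (simp add: mult_right_mono)
        qed
        have Qt: "1 \<le> Q powr t" using Q t by (simp add: ge_one_powr_ge_zero)
        have tt: "1 / (\<delta>1 * X) + sqrt (1 / (\<delta>1 * X)) + (1 / \<delta>1) powr t \<le> 12 / \<eta>\<^sup>2 * Q powr t"
        proof -
          have "4 / \<eta>\<^sup>2 * 1 \<le> 4 / \<eta>\<^sup>2 * Q powr t" using Qt by (intro mult_left_mono) auto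
          moreover have "12 / \<eta>\<^sup>2 * Q powr t = 3 * (4 / \<eta>\<^sup>2 * Q powr t)" by simp
          ultimately show ?thesis using t1 t2 t3 by linarith
        qed
        \<comment> \<open>The dual error relative to the number of cells is of order
          \<open>w ^ ?m * Q powr t\<close>. As \<open>?m \<ge> 2\<close>, the first factor is at
          most \<open>w\<^sup>2 \<le> Q powr (- \<epsilon>)\<close>, which beats
          \<open>Q powr t\<close> because \<open>t < \<epsilon> / 2\<close>.\<close>
        define w where "w = \<rho> / (\<delta> * Q)"
        have w0: "w \<ge> 0" using \<rho>' \<delta>0 Q by (simp add: w_def)
        have w2: "w\<^sup>2 = \<theta> / (\<delta> * Q)" using \<delta>0 Q by (simp add: w_def power_divide \<rho>2) (simp add: power2_eq_square)
        also have "\<dots> \<le> 1 / (\<delta> * Q)" using \<theta> \<delta>0 Q by (intro divide_right_mono) auto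
        finally have w3: "w\<^sup>2 \<le> 1 / (\<delta> * Q)" .
        moreover have "1 / (\<delta> * Q) \<le> 1" using \<delta>QB B by simp
        ultimately have "w\<^sup>2 \<le> 1" by linarith
        then have w1: "w \<le> 1" using w0 by (simp add: power_le_one_iff abs_square_le_1)
        have "w ^ ?m \<le> w ^ 2" using w0 w1 m by (intro power_decreasing) auto
        also have "\<dots> \<le> 1 / Q powr \<epsilon>" using w3 \<delta>Q Q by (smt (verit) frac_le powr_gt_zero zero_le_one)
        finally have wm: "w ^ ?m \<le> 1 / Q powr \<epsilon>" .
        have e: "(1 / \<delta>1) ^ ?m = (4 / (\<eta> * c3)) ^ ?m * w ^ ?m * (c3 / \<tau>) ^ ?m"
        proof -
          have "1 / \<delta>1 = 4 / (\<eta> * c3) * w * (c3 / \<tau>)"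
            using \<eta> c3 \<delta>0 Q \<rho>' by (simp add: \<delta>1_def w_def \<tau>_def)
          then show ?thesis by (simp only: power_mult_distrib)
        qed
        have "C * ((1 / \<delta>1) ^ ?m * (1 / (\<delta>1 * X) + sqrt (1 / (\<delta>1 * X)) + (1 / \<delta>1) powr t))
          \<le> C * ((1 / \<delta>1) ^ ?m * (12 / \<eta>\<^sup>2 * Q powr t))"
          using C \<delta>1 tt by (intro mult_left_mono) auto
        also have "\<dots> = B4 * (w ^ ?m * Q powr t) * (c3 / \<tau>) ^ ?m" unfolding e by (simp add: B4_def)
        also have "\<dots> \<le> 1 * (c3 / \<tau>) ^ ?m"
        proof (intro mult_right_mono)
          have "w ^ ?m * Q powr t \<le> 1 / Q powr \<epsilon> * Q powr (\<epsilon> / 2)"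
            using wm t Q by (intro mult_mono powr_mono) auto
          also have "\<dots> = 1 / Q powr (\<epsilon> / 2)"
          proof -
            have "Q powr \<epsilon> = Q powr (\<epsilon> / 2) * Q powr (\<epsilon> / 2)" by (simp add: powr_add[symmetric])
            then show ?thesis using Q by simp
          qed
          also have "\<dots> \<le> 1 / B" using QB B by (intro frac_le) auto
          finally have "B4 * (w ^ ?m * Q powr t) \<le> B * (1 / B)"
            using B nn w0 by (intro mult_mono) auto
          then show "B4 * (w ^ ?m * Q powr t) \<le> 1" using B by simp
        qed (use c3 \<tau>0 in auto)
        also have "\<dots> \<le> real (card I)" using cI by simp
        finally show "C * ((1 / \<delta>1) ^ ?m * (1 / (\<delta>1 * X) + sqrt (1 / (\<delta>1 * X)) + (1 / \<delta>1) powr t)) \<le> real (card I)" .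
      qed (use K X \<rho>' \<delta>1 in auto)
      also have "\<dots> = c2 / 2 * Y * real (card I)"
        using K by (simp add: Y_def X_def \<eta>_def)
      finally show ?thesis .
    qed
    have split: "real (card (?P Q c)) \<le> real (card (?P X c)) + 2 * real (card (W c))" for c
    proof -
      have "?P Q c \<subseteq> ?P X c \<union> (W c \<union> uminus ` W c)"
      proof
        fix \<mu> assume \<mu>: "\<mu> \<in> ?P Q c"
        obtain q a b where e: "\<mu> = (q, a, b)" by (cases \<mu>)
        consider "\<bar>real_of_int q\<bar> \<le> X" | "real_of_int q > X" | "real_of_int (- q) > X" by fastforce
        then show "\<mu> \<in> ?P X c \<union> (W c \<union> uminus ` W c)"
        proof cases
          case 1
          then have "\<mu> \<in> ?P X c" using \<mu> by (simp add: e tbox_def lbox_def)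
          then show ?thesis by simp
        next
          case 2
          then have "\<mu> \<in> W c" using \<mu> by (simp add: e W_def)
          then show ?thesis by simp
        next
          case 3
          have "(- q, - a, - b) \<in> ?P Q c" using \<mu> lbox_uminus unfolding e tbox_def by blast
          then have "(- q, - a, - b) \<in> W c" using 3 by (simp add: W_def)
          then have "- (- q, - a, - b) \<in> uminus ` W c" by (rule imageI)
          then show ?thesis by (simp add: e)
        qed
      qed
      then have "card (?P Q c) \<le> card (?P X c \<union> (W c \<union> uminus ` W c))"
        using finP[of X c] finW X by (intro card_mono) auto
      also have "\<dots> \<le> card (?P X c) + (card (W c) + card (uminus ` W c))"
        by (rule order_trans[OF card_Un_le add_left_mono[OF card_Un_le]])
      also have "\<dots> \<le> card (?P X c) + 2 * card (W c)" using card_image_le[OF finW, of uminus c] by simp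
      finally have "real (card (?P Q c)) \<le> real (card (?P X c) + 2 * card (W c))" by (rule of_nat_mono)
      then show ?thesis by simp
    qed
    have "c2 * Y * real (card I) = (\<Sum>c\<in>I. c2 * Y)" by simp
    also have "\<dots> \<le> (\<Sum>c\<in>I. real (card (?P X c)) + 2 * real (card (W c)))"
      by (intro sum_mono order_trans[OF many split])
    also have "\<dots> = (\<Sum>c\<in>I. real (card (?P X c))) + 2 * (\<Sum>c\<in>I. real (card (W c)))"
      by (simp add: sum.distrib sum_distrib_left)
    finally have sumW: "c2 / 4 * Y * real (card I) \<le> (\<Sum>c\<in>I. real (card (W c)))"
      using few by simp
    define WW where "WW = (\<Union>c\<in>I. W c)"
    have near: "norm ((1 / real_of_int q) *\<^sub>R rvec a - r c) \<le> \<tau> / \<eta>" "X < real_of_int q" "real_of_int q \<le> Q"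
      "\<bar>real_of_int b - real_of_int q * f (r c) - grad f (r c) \<bullet> (rvec a - real_of_int q *\<^sub>R r c)\<bar> \<le> \<delta>1"
      "norm (rvec a - real_of_int q *\<^sub>R r c) \<le> \<rho>"
      if "(q, a, b) \<in> W c" for q a b c
    proof -
      have h: "X < real_of_int q" "\<bar>real_of_int q\<bar> \<le> Q" "norm (rvec a - real_of_int q *\<^sub>R r c) \<le> \<rho>"
        "\<bar>real_of_int b - real_of_int q * f (r c) - grad f (r c) \<bullet> (rvec a - real_of_int q *\<^sub>R r c)\<bar> \<le> \<delta>1"
        using that by (auto simp: W_def tbox_def lbox_def)
      show "X < real_of_int q" "norm (rvec a - real_of_int q *\<^sub>R r c) \<le> \<rho>"
        "\<bar>real_of_int b - real_of_int q * f (r c) - grad f (r c) \<bullet> (rvec a - real_of_int q *\<^sub>R r c)\<bar> \<le> \<delta>1" by fact+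
      show "real_of_int q \<le> Q" using h(2) by linarith
      have q0: "real_of_int q > 0" using h X by linarith
      have "(1 / real_of_int q) *\<^sub>R rvec a - r c = (1 / real_of_int q) *\<^sub>R (rvec a - real_of_int q *\<^sub>R r c)"
        using q0 by (simp add: scaleR_right_diff_distrib)
      then have "norm ((1 / real_of_int q) *\<^sub>R rvec a - r c) = norm (rvec a - real_of_int q *\<^sub>R r c) / real_of_int q"
        using q0 by simp
      also have "\<dots> \<le> \<rho> / X" using h q0 X \<rho>' by (intro frac_le) auto
      also have "\<dots> = \<tau> / \<eta>" by (simp add: X_def \<tau>_def)
      finally show "norm ((1 / real_of_int q) *\<^sub>R rvec a - r c) \<le> \<tau> / \<eta>" .
    qed
    \<comment> \<open>Since \<open>q > \<eta> * Q\<close>, the point \<open>a / q\<close> is within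
      \<open>\<tau> / \<eta>\<close> of every grid point whose box contains
      \<open>(q, a, b)\<close>; that leaves boundedly many grid points.\<close>
    have "(\<Sum>c\<in>I. real (card (W c))) \<le> (4 / \<eta>) ^ ?m * real (card WW)"
    proof (rule sum_card_le[OF finI])
      show "finite WW" unfolding WW_def using finI finW by auto
      show "W c \<subseteq> WW" if "c \<in> I" for c using that by (auto simp: WW_def)
      fix \<mu> assume "\<mu> \<in> WW"
      obtain q a b where e: "\<mu> = (q, a, b)" by (cases \<mu>)
      let ?J = "{c \<in> I. \<mu> \<in> W c}"
      have n: "norm (y - (1 / real_of_int q) *\<^sub>R rvec a) \<le> \<tau> / \<eta>" if "y \<in> r ` ?J" for y
        using that near(1)[of q a b] by (auto simp: e norm_minus_commute)
      have "\<tau> / \<eta> \<ge> 0" using \<tau>0 \<eta> by simp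
      from card_cells_ball(2)[OF \<tau>0 this n] have b: "real (card (cell \<tau> ` r ` ?J)) \<le> (2 * (\<tau> / \<eta>) / \<tau> + 2) ^ ?m" by simp
      have J: "cell \<tau> ` r ` ?J = ?J" by (simp add: image_image cell_r)
      have "(2 * (\<tau> / \<eta>) / \<tau> + 2) ^ ?m \<le> (4 / \<eta>) ^ ?m"
        using \<tau>0 \<eta> by (intro power_mono) (auto simp: field_simps)
      from order_trans[OF b this] show "real (card ?J) \<le> (4 / \<eta>) ^ ?m" unfolding J .
    qed
    also have "\<dots> \<le> (4 / \<eta>) ^ ?m * (real (N f \<delta> Q) * (2 / \<eta>))"
    proof (intro mult_left_mono card_le_rational_points)
      fix q a b assume "(q, a, b) \<in> WW"
      then obtain c where c: "c \<in> I" "(q, a, b) \<in> W c" by (auto simp: WW_def)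
      note n = near[OF c(2)]
      define p where "p = (1 / real_of_int q) *\<^sub>R rvec a"
      have q0: "real_of_int q > 0" using n X by linarith
      have "\<tau> / \<eta> \<le> r0 / 4" using \<tau> r1 \<eta> by (simp add: field_simps)
      moreover have "norm (p - z) \<le> norm (p - r c) + norm (r c - z)"
        using norm_triangle_ineq[of "p - r c" "r c - z"] by simp
      ultimately have pz: "norm (p - z) \<le> r0 / 2"
        using n(1)[folded p_def] rI[OF c(1)] by linarith
      then have pT: "p \<in> ?T" using r0 by (simp add: dist_norm norm_minus_commute)
      have p1: "norm p < 1" using pz z r0 norm_triangle_sub[of p z] by linarith
      have a: "rvec a = real_of_int q *\<^sub>R p" using q0 by (simp add: p_def)
      have qn: "real_of_int q * norm (p - r c) \<le> \<rho>"
      proof -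
        have "rvec a - real_of_int q *\<^sub>R r c = real_of_int q *\<^sub>R (p - r c)" by (simp add: a scaleR_right_diff_distrib)
        then show ?thesis using n(5) q0 by simp
      qed
      have "\<bar>real_of_int q * (f p - f (r c) - grad f (r c) \<bullet> (p - r c))\<bar> \<le> real_of_int q * (L * (norm (p - r c))\<^sup>2)"
        using taylor_u[OF pT rT[OF c(1)]] q0 by (simp add: abs_mult)
      also have "\<dots> = L * (real_of_int q * norm (p - r c))\<^sup>2 / real_of_int q" using q0 by (simp add: power2_eq_square)
      also have "\<dots> \<le> L * \<rho>\<^sup>2 / X" using qn n(2) X L q0 by (intro frac_le mult_left_mono power_mono) auto
      also have "\<dots> = \<eta> * \<delta> / 4" using Q \<eta> L by (simp add: \<rho>2 \<theta>_def X_def) (simp add: power2_eq_square)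
      finally have ty: "\<bar>real_of_int q * (f p - f (r c) - grad f (r c) \<bullet> (p - r c))\<bar> \<le> \<eta> * \<delta> / 4" .
      have "real_of_int b - real_of_int q * f p = (real_of_int b - real_of_int q * f (r c) - grad f (r c) \<bullet> (rvec a - real_of_int q *\<^sub>R r c))
         - real_of_int q * (f p - f (r c) - grad f (r c) \<bullet> (p - r c))"
        by (simp add: a inner_diff_right algebra_simps)
      then have "\<bar>real_of_int b - real_of_int q * f p\<bar> \<le> \<eta> * \<delta> / 2" using n(4) ty unfolding \<delta>1_def by linarith
      then show "\<eta> * Q < real_of_int q \<and> real_of_int q \<le> Q \<and> norm ((1 / real_of_int q) *\<^sub>R rvec a) < 1 \<and>
         \<bar>real_of_int b - real_of_int q * f ((1 / real_of_int q) *\<^sub>R rvec a)\<bar> \<le> \<eta> * \<delta> / 2"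
        using n(2,3) p1 unfolding p_def X_def by simp
    qed (use \<eta> Q \<delta> \<delta>0 in auto)
    finally have up: "c2 / 4 * Y * real (card I) \<le> (4 / \<eta>) ^ ?m * (real (N f \<delta> Q) * (2 / \<eta>))" using sumW by linarith
    have "c2 / 4 * Y * (c3 / \<tau>) ^ ?m \<le> c2 / 4 * Y * real (card I)" using cI c2 Y by (intro mult_left_mono) auto
    also have "c2 / 4 * Y * (c3 / \<tau>) ^ ?m = c2 * c3 ^ ?m * \<eta> / 16 * (\<delta> * Q ^ (?m + 1))"
      using \<rho>' Q by (simp add: Y_def \<tau>_def \<delta>1_def power_divide power_mult_distrib)
    finally have "c2 * c3 ^ ?m * \<eta> / 16 * (\<delta> * Q ^ (?m + 1)) \<le> (4 / \<eta>) ^ ?m * (real (N f \<delta> Q) * (2 / \<eta>))"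
      using up by linarith
    moreover have pos: "c2 * c3 ^ ?m * \<eta> / 16 > 0" using c2 c3 \<eta> by simp
    ultimately have "\<delta> * Q ^ (?m + 1) \<le> (4 / \<eta>) ^ ?m * (real (N f \<delta> Q) * (2 / \<eta>)) / (c2 * c3 ^ ?m * \<eta> / 16)"
      by (metis mult.commute pos_le_divide_eq)
    also have "\<dots> = C1 * real (N f \<delta> Q)" by (simp add: C1_def)
    finally show ?thesis .
  qed
  have "\<delta> * Q ^ (?m + 1) \<le> (C1 + Q0 ^ (?m + 1)) * real (N f \<delta> Q)"
    if Q: "1 \<le> Q" and \<delta>: "Q powr (\<epsilon> - 1) < \<delta>" "\<delta> < 1 / 2" for \<delta> Q
  proof (cases "Q powr (\<epsilon> / 2) \<ge> B")
    case True
    have "\<delta> * Q ^ (?m + 1) \<le> C1 * real (N f \<delta> Q)" by (rule main[OF Q \<delta> True])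
    also have "\<dots> \<le> (C1 + Q0 ^ (?m + 1)) * real (N f \<delta> Q)" using Q0 by (intro mult_right_mono) auto
    finally show ?thesis .
  next
    case False
    \<comment> \<open>Here \<open>Q \<le> Q0\<close> and the single point of \<open>N_ge_1\<close>
      suffices.\<close>
    have \<delta>0: "\<delta> > 0" using \<delta>(1) by (meson powr_ge_zero le_less_trans)
    have "Q = (Q powr (\<epsilon> / 2)) powr (2 / \<epsilon>)" using Q \<epsilon> by (simp add: powr_powr)
    also have "\<dots> \<le> Q0" unfolding Q0_def using False \<epsilon> by (intro powr_mono2) auto
    finally have "Q \<le> Q0" .
    then have "\<delta> * Q ^ (?m + 1) \<le> 1 * Q0 ^ (?m + 1)" using \<delta> \<delta>0 Q by (intro mult_mono power_mono) auto
    also have "\<dots> \<le> (C1 + Q0 ^ (?m + 1)) * 1" using C1 by simp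
    also have "\<dots> \<le> (C1 + Q0 ^ (?m + 1)) * real (N f \<delta> Q)"
      using N_ge_1[OF homogeneous_nondeg_C2(3)[OF f] Q, of \<delta>] \<delta>0 C1 Q0 by (intro mult_left_mono) auto
    finally show ?thesis .
  qed
  moreover have "C1 + Q0 ^ (?m + 1) > 0" using C1 Q0 by (simp add: add_pos_nonneg)
  ultimately show ?thesis by blast
qed

section \<open>Summation over the dyadic shells\<close>

lemma sum_geometric_le:
  fixes r :: real
  assumes "0 \<le> r" "r < 1"
  shows "(\<Sum>i<n. r ^ i) \<le> 1 / (1 - r)"
  using assms by (subst sum_gp_strict) (auto intro!: divide_right_mono)

lemma half_powr: "((1 / 2 :: real) ^ i) powr a = (2 ^ i) powr (- a)"
  by (simp add: power_one_over powr_divide powr_minus_divide)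

lemma half_power: "((1 / 2 :: real) ^ i) ^ m = (2 ^ i) powr (- real m)"
  by (subst half_powr[symmetric]) (simp add: powr_realpow)

text \<open>For \<open>\<beta>\<close> between \<open>0\<close> and \<open>1 / 2\<close> one has
  \<open>min 1 (sqrt \<theta>) \<le> \<theta> powr \<beta>\<close>. The value of
  \<open>\<beta>\<close> is the one for which \<open>\<delta> > Q powr (\<epsilon> - 1)\<close>
  yields \<open>(\<delta> / Q) powr \<beta> \<le> \<delta>\<close>. Being strictly below
  \<open>1 / 2\<close>, it leaves a convergent geometric series even for \<open>d = 2 * m\<close>,
  where \<open>1 / 2\<close> would cost a logarithm.\<close>

lemma cone_sum_le_small_degree:
  fixes d \<epsilon> :: real and m :: nat
  assumes d: "d > 0" "d \<le> 2 * real m" and \<epsilon>: "0 < \<epsilon>" "\<epsilon> < 1"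
  shows "\<exists>K>0. \<forall>\<delta> Q n. 1 \<le> Q \<and> Q powr (\<epsilon> - 1) < \<delta> \<longrightarrow>
    (\<Sum>i<n. ((1 / 2) ^ i) ^ m * min 1 (sqrt (\<delta> / Q * (2 ^ i) powr d))) \<le> K * \<delta>"
proof -
  define \<beta> where "\<beta> = (1 - \<epsilon>) / (2 - \<epsilon>)"
  have \<beta>: "0 < \<beta>" "\<beta> < 1 / 2" using \<epsilon> by (auto simp: \<beta>_def field_simps)
  define r where "r = (1 / 2 :: real) powr (real m - d * \<beta>)"
  have "d * \<beta> < d * (1 / 2)" using d \<beta> by (intro mult_strict_left_mono) auto
  then have "real m - d * \<beta> > 0" using d by linarith
  then have "r < (1 / 2) powr 0" unfolding r_def by (intro powr_less_mono') auto
  then have r: "0 < r" "r < 1" by (auto simp: r_def)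
  have "(\<Sum>i<n. ((1 / 2) ^ i) ^ m * min 1 (sqrt (\<delta> / Q * (2 ^ i) powr d))) \<le> 1 / (1 - r) * \<delta>"
    if Q: "1 \<le> Q" and \<delta>: "Q powr (\<epsilon> - 1) < \<delta>" for \<delta> Q n
  proof -
    have \<delta>0: "\<delta> > 0" using \<delta> by (meson powr_ge_zero le_less_trans)
    have A: "(\<delta> / Q) powr \<beta> \<le> \<delta>"
    proof -
      have "1 / Q = (Q powr (\<epsilon> - 1)) powr (1 / (1 - \<epsilon>))"
      proof -
        have "(\<epsilon> - 1) * (1 / (1 - \<epsilon>)) = - 1" using \<epsilon> by (simp add: field_simps)
        then show ?thesis using Q by (simp add: powr_powr powr_minus_divide)
      qed
      also have "\<dots> \<le> \<delta> powr (1 / (1 - \<epsilon>))" using \<delta> \<epsilon> by (intro powr_mono2) auto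
      finally have "1 / Q \<le> \<delta> powr (1 / (1 - \<epsilon>))" .
      then have "\<delta> * (1 / Q) \<le> \<delta> * \<delta> powr (1 / (1 - \<epsilon>))" using \<delta>0 by (intro mult_left_mono) auto
      also have "\<dots> = \<delta> powr (1 + 1 / (1 - \<epsilon>))" using \<delta>0 by (simp add: powr_add)
      also have "1 + 1 / (1 - \<epsilon>) = 1 / \<beta>" using \<epsilon> by (simp add: \<beta>_def field_simps)
      finally have "(\<delta> / Q) powr \<beta> \<le> (\<delta> powr (1 / \<beta>)) powr \<beta>" using \<beta> \<delta>0 Q by (intro powr_mono2) auto
      also have "\<dots> = \<delta>" using \<beta> \<delta>0 by (simp add: powr_powr)
      finally show ?thesis .
    qed
    have tm: "((1 / 2) ^ i) ^ m * min 1 (sqrt (\<delta> / Q * (2 ^ i) powr d)) \<le> \<delta> * r ^ i" for i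
    proof -
      define \<theta> where "\<theta> = \<delta> / Q * (2 ^ i) powr d"
      have \<theta>: "\<theta> > 0" using \<delta>0 Q by (simp add: \<theta>_def)
      have "min 1 (sqrt \<theta>) \<le> \<theta> powr \<beta>"
      proof (cases "\<theta> \<le> 1")
        case True
        have "sqrt \<theta> = \<theta> powr (1 / 2)" using \<theta> by (simp add: powr_half_sqrt)
        also have "\<dots> \<le> \<theta> powr \<beta>" using True \<theta> \<beta> by (intro powr_mono') auto
        finally show ?thesis by simp
      next
        case False
        then have "1 \<le> \<theta> powr \<beta>" using \<beta> by (intro ge_one_powr_ge_zero) auto
        then show ?thesis by simp
      qed
      also have "\<theta> powr \<beta> = (\<delta> / Q) powr \<beta> * (2 ^ i) powr (d * \<beta>)"
        unfolding \<theta>_def powr_mult by (simp add: powr_powr)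
      also have "\<dots> \<le> \<delta> * (2 ^ i) powr (d * \<beta>)" by (intro mult_right_mono A) simp
      finally have "((1 / 2) ^ i) ^ m * min 1 (sqrt \<theta>) \<le> ((1 / 2) ^ i) ^ m * (\<delta> * (2 ^ i) powr (d * \<beta>))"
        by (intro mult_left_mono) auto
      also have "\<dots> = \<delta> * (((1 / 2) ^ i) ^ m * (2 ^ i) powr (d * \<beta>))" by simp
      also have "((1 / 2 :: real) ^ i) ^ m * (2 ^ i) powr (d * \<beta>) = r ^ i"
      proof -
        have "((1 / 2 :: real) ^ i) ^ m * (2 ^ i) powr (d * \<beta>) = (2 ^ i) powr (d * \<beta> - real m)"
          unfolding half_power by (simp add: powr_add[symmetric])
        also have "\<dots> = ((1 / 2) ^ i) powr (real m - d * \<beta>)" unfolding half_powr by simp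
        also have "\<dots> = r ^ i" unfolding r_def by (simp add: powr_realpow[symmetric] powr_powr mult.commute)
        finally show ?thesis .
      qed
      finally show ?thesis by (simp add: \<theta>_def)
    qed
    have "(\<Sum>i<n. ((1 / 2) ^ i) ^ m * min 1 (sqrt (\<delta> / Q * (2 ^ i) powr d))) \<le> (\<Sum>i<n. \<delta> * r ^ i)"
      by (intro sum_mono tm)
    also have "\<dots> = \<delta> * (\<Sum>i<n. r ^ i)" by (simp add: sum_distrib_left)
    also have "\<dots> \<le> \<delta> * (1 / (1 - r))" using \<delta>0 r by (intro mult_left_mono sum_geometric_le) auto
    finally show ?thesis by simp
  qed
  moreover have "1 / (1 - r) > 0" using r by simp
  ultimately show ?thesis by blast
qed

text \<open>The terms grow geometrically until \<open>2 ^ i\<close> reaches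
  \<open>A powr (- (1 / d))\<close>, where the square root becomes \<open>1\<close>, and decay
  geometrically afterwards. The sum is governed by the peak, of size
  \<open>A powr (m / d)\<close>.\<close>

lemma cone_sum_le_large_degree:
  fixes d :: real and m :: nat
  assumes m: "m \<ge> 1" and d: "d > 2 * real m"
  shows "\<exists>K>0. \<forall>A n. 0 < A \<and> A \<le> 1 \<longrightarrow>
    (\<Sum>i<n. ((1 / 2) ^ i) ^ m * min 1 (sqrt (A * (2 ^ i) powr d))) \<le> K * A powr (real m / d)"
proof -
  define k where "k = d / 2 - real m"
  have k: "k > 0" using d by (simp add: k_def)
  have d0: "d > 0" using d m by linarith
  define r where "r = (1 / 2 :: real) powr k"
  have "r < (1 / 2) powr 0" unfolding r_def using k by (intro powr_less_mono') auto
  then have r: "0 < r" "r < 1" by (auto simp: r_def)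
  have "(\<Sum>i<n. ((1 / 2) ^ i) ^ m * min 1 (sqrt (A * (2 ^ i) powr d))) \<le> (1 / (1 - r) + 2) * A powr (real m / d)"
    if A: "0 < A" "A \<le> 1" for A n
  proof -
    define D where "D = A powr (- (1 / d))"
    have "A powr 0 \<le> D" unfolding D_def using A d0 by (intro powr_mono') auto
    then have D: "D \<ge> 1" using A by simp
    obtain J where J: "D < 2 ^ J" "\<And>i. i < J \<Longrightarrow> 2 ^ i \<le> D" using dyadic_exponent[OF D] by blast
    let ?t = "\<lambda>i. ((1 / 2) ^ i) ^ m * min 1 (sqrt (A * (2 ^ i) powr d))"
    let ?P = "A powr (real m / d)"
    have hi: "?t (J + i) \<le> (1 / 2) ^ i * ?P" for i
    proof -
      have "?t (J + i) \<le> ((1 / 2) ^ (J + i)) ^ m * 1" by (intro mult_left_mono) auto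
      also have "\<dots> = ((1 / 2) ^ i) ^ m * ((1 / 2) ^ J) ^ m" by (simp add: power_add power_mult_distrib)
      also have "\<dots> \<le> ((1 / 2) ^ i) ^ 1 * (1 / D) ^ m"
      proof (intro mult_mono power_decreasing power_mono)
        show "(1 / 2) ^ J \<le> 1 / D" using J(1) D by (simp add: power_divide frac_le)
      qed (use m D in \<open>auto simp: power_le_one\<close>)
      also have "(1 / D) ^ m = ?P"
      proof -
        have "1 / D = A powr (1 / d)" by (simp add: D_def powr_minus_divide)
        then show ?thesis using A by (simp add: powr_realpow[symmetric] powr_powr)
      qed
      finally show ?thesis by simp
    qed
    have lo: "?t i \<le> r ^ (J - Suc i) * ?P" if i: "i < J" for i
    proof -
      have "?t i \<le> ((1 / 2) ^ i) ^ m * sqrt (A * (2 ^ i) powr d)" by (intro mult_left_mono) auto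
      also have "\<dots> = sqrt A * (2 ^ i) powr k"
      proof -
        have e: "sqrt (A * (2 ^ i) powr d) = sqrt A * (2 ^ i) powr (d / 2)"
          by (simp add: real_sqrt_mult powr_half_sqrt[symmetric] powr_powr)
        have "(2 ^ i) powr (- real m) * (2 ^ i) powr (d / 2) = (2 ^ i :: real) powr k"
          unfolding powr_add[symmetric] by (simp add: k_def)
        then show ?thesis unfolding half_power e by (simp add: mult.left_commute)
      qed
      \<comment> \<open>The increasing part is measured backwards from \<open>2 ^ (J - 1)\<close>,
        the last power that is still at most \<open>D\<close>.\<close>
      also have "(2 ^ i :: real) powr k = r ^ (J - Suc i) * (2 ^ (J - 1)) powr k"
      proof -
        have "(2 :: real) ^ i = (1 / 2) ^ (J - Suc i) * 2 ^ (J - 1)"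
        proof -
          have "J - 1 = (J - Suc i) + i" using i by simp
          then have "(2 :: real) ^ (J - 1) = 2 ^ (J - Suc i) * 2 ^ i" by (simp add: power_add)
          then show ?thesis by (simp add: power_divide)
        qed
        then have "(2 ^ i :: real) powr k = ((1 / 2) ^ (J - Suc i)) powr k * (2 ^ (J - 1)) powr k" by (simp only: powr_mult)
        also have "((1 / 2 :: real) ^ (J - Suc i)) powr k = r ^ (J - Suc i)"
          unfolding r_def by (simp add: powr_realpow[symmetric] powr_powr mult.commute)
        finally show ?thesis .
      qed
      also have "sqrt A * (r ^ (J - Suc i) * (2 ^ (J - 1)) powr k) \<le> sqrt A * (r ^ (J - Suc i) * D powr k)"
        using J(2)[of "J - 1"] i k r A by (intro mult_left_mono powr_mono2) auto
      also have "\<dots> = r ^ (J - Suc i) * (A powr (1 / 2) * A powr (- (1 / d) * k))"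
        using A by (simp add: D_def powr_powr powr_half_sqrt)
      also have "A powr (1 / 2) * A powr (- (1 / d) * k) = ?P"
        unfolding powr_add[symmetric] using d0 by (simp add: k_def field_simps)
      finally show ?thesis .
    qed
    have "(\<Sum>i<n. ?t i) \<le> (\<Sum>i<J + n. ?t i)" using A by (intro sum_mono2) auto
    also have "\<dots> = (\<Sum>i<J. ?t i) + (\<Sum>i<n. ?t (J + i))" by (induction n) simp_all
    also have "\<dots> \<le> (\<Sum>i<J. r ^ (J - Suc i) * ?P) + (\<Sum>i<n. (1 / 2) ^ i * ?P)"
      by (intro add_mono sum_mono hi lo) auto
    also have "\<dots> = ((\<Sum>i<J. r ^ (J - Suc i)) + (\<Sum>i<n. (1 / 2) ^ i)) * ?P"
      by (simp add: sum_distrib_right distrib_right)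
    also have "(\<Sum>i<J. r ^ (J - Suc i)) = (\<Sum>i<J. r ^ i)" by (rule sum.nat_diff_reindex)
    also have "((\<Sum>i<J. r ^ i) + (\<Sum>i<n. (1 / 2) ^ i)) * ?P \<le> (1 / (1 - r) + 2) * ?P"
      using r by (intro mult_right_mono add_mono sum_geometric_le sum_half_powers_le) auto
    finally show ?thesis .
  qed
  moreover have "1 / (1 - r) + 2 > 0" using r by (simp add: add_pos_pos)
  ultimately show ?thesis by blast
qed

text \<open>The exponent in the theorem marks the balance of \<open>\<delta>\<close> with
  \<open>(\<delta> / Q) powr (m / d) * Q powr \<epsilon>\<close>. Cancelling
  \<open>\<delta> powr (m / d)\<close> leaves a comparison of powers with exponent
  \<open>(d - m) / d\<close>.\<close>

lemma threshold_iff: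
  fixes m d \<epsilon> Q \<delta> :: real
  assumes "0 < m" "m < d" "1 \<le> Q" "0 < \<delta>"
  shows "\<delta> \<le> Q powr (- ((m - \<epsilon> * d) / (d - m))) \<longleftrightarrow> \<delta> \<le> (\<delta> / Q) powr (m / d) * Q powr \<epsilon>" (is "_ \<le> ?thr \<longleftrightarrow> _")
    and "\<delta> \<ge> Q powr (- ((m - \<epsilon> * d) / (d - m))) \<longleftrightarrow> \<delta> \<ge> (\<delta> / Q) powr (m / d) * Q powr \<epsilon>"
proof -
  define e where "e = (d - m) / d"
  have e: "e > 0" using assms by (simp add: e_def)
  have T: "?thr powr e = Q powr (\<epsilon> - m / d)"
  proof -
    have "- ((m - \<epsilon> * d) / (d - m)) * e = - ((m - \<epsilon> * d) / d)" using assms by (simp add: e_def minus_divide_left)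
    also have "\<dots> = \<epsilon> - m / d" using assms by (simp add: field_simps)
    finally show ?thesis by (simp add: powr_powr)
  qed
  have 1: "(\<delta> / Q) powr (m / d) * Q powr \<epsilon> = \<delta> powr (m / d) * ?thr powr e"
    unfolding T using assms by (simp add: powr_divide powr_diff)
  have 2: "\<delta> = \<delta> powr (m / d) * \<delta> powr e"
  proof -
    have "m / d + e = 1" using assms by (simp add: e_def field_simps)
    then show ?thesis using assms by (simp add: powr_add[symmetric])
  qed
  have p: "\<delta> powr (m / d) > 0" using assms by simp
  have t0: "?thr > 0" using assms by simp
  have c: "a powr e \<le> b powr e \<longleftrightarrow> a \<le> b" if "a > 0" "b > 0" for a b :: real
    using that e powr_mono2[of e a b] powr_less_mono2[of e b a] by (meson less_imp_le not_less)
  have "\<delta> \<le> (\<delta> / Q) powr (m / d) * Q powr \<epsilon> \<longleftrightarrow> \<delta> powr (m / d) * \<delta> powr e \<le> \<delta> powr (m / d) * ?thr powr e"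
    unfolding 1 using 2 by simp
  then show "\<delta> \<le> ?thr \<longleftrightarrow> \<delta> \<le> (\<delta> / Q) powr (m / d) * Q powr \<epsilon>"
    using p c[OF assms(4) t0] by simp
  have "\<delta> \<ge> (\<delta> / Q) powr (m / d) * Q powr \<epsilon> \<longleftrightarrow> \<delta> powr (m / d) * \<delta> powr e \<ge> \<delta> powr (m / d) * ?thr powr e"
    unfolding 1 using 2 by simp
  then show "\<delta> \<ge> ?thr \<longleftrightarrow> \<delta> \<ge> (\<delta> / Q) powr (m / d) * Q powr \<epsilon>"
    using p c[OF t0 assms(4)] by simp
qed

section \<open>Points in the cone around the origin\<close>

lemma homogeneous_nondeg_bounded:
  fixes f :: "real ^ 'm::finite \<Rightarrow> real"
  assumes f: "f \<in> homogeneous_nondeg d" and d: "d > 0"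
  shows "\<exists>F\<ge>1. \<forall>x. \<bar>f x\<bar> \<le> F * norm x powr d"
proof -
  note C2 = homogeneous_nondeg_C2[OF f]
  have "continuous_on (sphere 0 1) f"
  proof (intro continuous_at_imp_continuous_on ballI)
    fix x :: "real ^ 'm" assume "x \<in> sphere 0 1"
    then have "x \<in> UNIV - {0}" by auto
    then show "isCont f x" using smooth_on_grad(1)[OF C2(2,1)] has_derivative_continuous by blast
  qed
  then have "compact (f ` sphere 0 1)" by (intro compact_continuous_image compact_sphere)
  then obtain F0 where F0: "\<And>y. y \<in> f ` sphere 0 1 \<Longrightarrow> norm y \<le> F0" using compact_imp_bounded bounded_iff by metis
  have "\<bar>f x\<bar> \<le> max 1 F0 * norm x powr d" for x
  proof (cases "x = 0")
    case True
    have "f (0 *\<^sub>R 0) = 0 powr d * f 0" using C2(3) unfolding homogeneous_def by blast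
    then show ?thesis using True by simp
  next
    case False
    have "f (norm x *\<^sub>R ((1 / norm x) *\<^sub>R x)) = norm x powr d * f ((1 / norm x) *\<^sub>R x)"
      using C2(3) unfolding homogeneous_def by (metis (mono_tags, lifting) mem_Collect_eq norm_ge_zero)
    then have "f x = norm x powr d * f ((1 / norm x) *\<^sub>R x)" using False by simp
    moreover have "\<bar>f ((1 / norm x) *\<^sub>R x)\<bar> \<le> max 1 F0"
      using F0[of "f ((1 / norm x) *\<^sub>R x)"] False by (auto simp: le_max_iff_disj)
    then have "norm x powr d * \<bar>f ((1 / norm x) *\<^sub>R x)\<bar> \<le> norm x powr d * max 1 F0" by (rule mult_left_mono) simp
    ultimately show ?thesis by (simp add: abs_mult mult.commute)
  qed
  then show ?thesis by (intro exI[of _ "max 1 F0"]) auto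
qed

text \<open>If \<open>norm (a / q) \<le> s\<close> with
  \<open>2 * Q * F * s powr d = \<delta>\<close>, then
  \<open>\<bar>q * f (a / q)\<bar> \<le> \<delta>\<close>, so \<open>0\<close> is an admissible
  nearby integer. All such pairs are counted.\<close>

lemma cone_lower:
  fixes f :: "real ^ 'm::finite \<Rightarrow> real"
  assumes f: "f \<in> homogeneous_nondeg d" and d: "d > 0"
  shows "\<exists>C>0. \<forall>\<delta> Q. 1 \<le> Q \<and> 0 < \<delta> \<and> \<delta> \<le> 1 \<longrightarrow>
     (\<delta> / Q) powr (real CARD('m) / d) * Q ^ (CARD('m) + 1) \<le> C * real (N f \<delta> Q)"
proof -
  let ?m = "CARD('m)"
  obtain F where F: "F \<ge> 1" "\<And>x. \<bar>f x\<bar> \<le> F * norm x powr d" using homogeneous_nondeg_bounded[OF f d] by blast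
  define m where "m = real ?m"
  have m: "m \<ge> 1" by (simp add: m_def Suc_le_eq)
  define C where "C = 2 * m ^ ?m * (2 * F) powr (m / d)"
  have C: "C > 0" using m F by (simp add: C_def)
  have "(\<delta> / Q) powr (real ?m / d) * Q ^ (?m + 1) \<le> C * real (N f \<delta> Q)" if Q: "1 \<le> Q" and \<delta>: "0 < \<delta>" "\<delta> \<le> 1" for \<delta> Q
  proof -
    define A where "A = \<delta> / (2 * Q * F)"
    have A: "A > 0" "A < 1"
    proof -
      have "Q * F \<ge> 1 * 1" using Q F by (intro mult_mono) auto
      then show "A > 0" "A < 1" using \<delta> by (auto simp: A_def field_simps)
    qed
    define s where "s = A powr (1 / d)"
    have s0: "s > 0" using A by (simp add: s_def)
    have "s < 1 powr (1 / d)" unfolding s_def using A d by (intro powr_less_mono2) auto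
    then have s1: "s < 1" by simp
    have sd: "s powr d = A" using A d by (simp add: s_def powr_powr)
    define w where "w = Q * s / m"
    have w: "w > 0" using Q s0 m by (simp add: w_def)
    let ?Z = "{\<lceil>Q\<rceil>..\<lceil>2 * Q\<rceil> - 1}"
    let ?J = "{j :: int. \<bar>real_of_int j - 0\<bar> \<le> w}"
    let ?B = "{a :: int ^ 'm. \<forall>i. a $ i \<in> ?J}"
    have sub: "?Z \<times> ?B \<subseteq> rational_points f \<delta> Q"
    proof clarify
      fix q and a :: "int ^ 'm" assume q: "q \<in> ?Z" and a: "\<forall>i. a $ i \<in> ?J"
      have "\<lceil>Q\<rceil> \<le> q" "q \<le> \<lceil>2 * Q\<rceil> - 1" using q by auto
      then have q1: "Q \<le> real_of_int q" "real_of_int q < 2 * Q" by linarith+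
      define x where "x = (1 / real_of_int q) *\<^sub>R rvec a"
      have "norm (rvec a) \<le> real ?m * w" by (rule norm_le_card_bound) (use a in simp)
      also have "\<dots> = Q * s" using m by (simp add: w_def m_def)
      finally have "norm (rvec a) \<le> Q * s" .
      also have "\<dots> \<le> real_of_int q * s" using q1 s0 by (intro mult_right_mono) auto
      finally have xs: "norm x \<le> s" using q1 Q by (simp add: x_def field_simps)
      have "\<bar>real_of_int q * f x\<bar> \<le> (2 * Q) * (F * A)"
      proof -
        have "\<bar>f x\<bar> \<le> F * norm x powr d" by (rule F)
        also have "\<dots> \<le> F * s powr d" using xs d F by (intro mult_left_mono powr_mono2) auto
        finally have "\<bar>f x\<bar> \<le> F * A" unfolding sd .
        then show ?thesis unfolding abs_mult using q1 Q by (intro mult_mono) auto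
      qed
      also have "\<dots> = \<delta>" using Q F by (simp add: A_def)
      finally have "int_dist (real_of_int q * f x) \<le> \<delta>" by (intro int_dist_le[of _ 0]) simp
      then show "(q, a) \<in> rational_points f \<delta> Q"
        unfolding rational_points_iff x_def[symmetric] using q1 Q xs s1 by (auto simp: field_simps)
    qed
    have "Q / 2 * w ^ ?m \<le> real (card ?Z) * real (card ?B)"
    proof (intro mult_mono)
      have "\<lceil>Q\<rceil> + 1 \<le> \<lceil>2 * Q\<rceil>" using Q by linarith
      then have "real (card ?Z) = real_of_int (\<lceil>2 * Q\<rceil> - \<lceil>Q\<rceil>)" by simp
      moreover have "Q / 2 \<le> real_of_int (\<lceil>2 * Q\<rceil> - \<lceil>Q\<rceil>)"
      proof (cases "Q \<le> 2")
        case True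
        have "(1 :: real) \<le> real_of_int (\<lceil>2 * Q\<rceil> - \<lceil>Q\<rceil>)" using \<open>\<lceil>Q\<rceil> + 1 \<le> \<lceil>2 * Q\<rceil>\<close> by linarith
        then show ?thesis using True by linarith
      next
        case False
        then show ?thesis by linarith
      qed
      ultimately show "Q / 2 \<le> real (card ?Z)" by simp
      have J: "w \<le> real (card ?J)"
      proof (cases "w \<ge> 1")
        case True
        then show ?thesis using int_interval_bounds(3)[of w 0] by linarith
      next
        case False
        \<comment> \<open>For \<open>w < 1\<close> the integer \<open>0\<close> alone already gives
          cardinality at least \<open>w\<close>, so the product bound holds for every size of the
          cube.\<close>
        have "0 \<in> ?J" using w by simp
        moreover have "finite ?J" using w by (intro int_interval_bounds) auto
        ultimately have "card ?J \<ge> 1" by (metis One_nat_def Suc_leI card_gt_0_iff empty_iff)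
        then show ?thesis using False by linarith
      qed
      have "w ^ ?m = (\<Prod>i\<in>(UNIV :: 'm set). w)" by simp
      also have "\<dots> \<le> (\<Prod>i\<in>(UNIV :: 'm set). real (card ?J))" using w by (intro prod_mono conjI J) auto
      also have "\<dots> = real (card ?B)" by (subst card_vec_set) simp
      finally show "w ^ ?m \<le> real (card ?B)" .
    qed (use w in auto)
    also have "\<dots> = real (card (?Z \<times> ?B))" by (simp add: card_cartesian_product)
    also have "\<dots> \<le> real (N f \<delta> Q)"
      unfolding N_def using Q by (intro of_nat_mono card_mono sub finite_rational_points) auto
    finally have "Q / 2 * w ^ ?m \<le> real (N f \<delta> Q)" .
    then have "C * (Q / 2 * w ^ ?m) \<le> C * real (N f \<delta> Q)" using C by (intro mult_left_mono) auto
    moreover have "C * (Q / 2 * w ^ ?m) = (\<delta> / Q) powr (real ?m / d) * Q ^ (?m + 1)"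
    proof -
      have "s ^ ?m = A powr (m / d)" using A by (simp add: s_def powr_realpow[symmetric] powr_powr m_def)
      moreover have "(2 * F) powr (m / d) * A powr (m / d) = (\<delta> / Q) powr (m / d)"
      proof -
        have "(2 * F) * A = \<delta> / Q" using F Q by (simp add: A_def)
        then show ?thesis by (simp only: powr_mult[symmetric])
      qed
      moreover have "C * (Q / 2 * w ^ ?m) = (2 * F) powr (m / d) * s ^ ?m * Q ^ (?m + 1)"
        using m by (simp add: C_def w_def power_mult_distrib power_divide)
      ultimately show ?thesis by (simp add: m_def)
    qed
    ultimately show ?thesis by (simp only:)
  qed
  then show ?thesis using C by blast
qed

section \<open>Assembly of the two ranges of the degree\<close>

lemma dominated_onI:
  assumes "C > 0" "\<And>\<delta> Q. (\<delta>, Q) \<in> S \<Longrightarrow> \<bar>A (\<delta>, Q)\<bar> \<le> C * \<bar>B (\<delta>, Q)\<bar>"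
  shows "dominated_on S A B"
  using assms unfolding dominated_on_def by auto

text \<open>With \<open>A = \<delta> / Q\<close> the peak of the shell sum sits at radius about
  \<open>(\<delta> / Q) powr (1 / d)\<close>, the same cone that \<open>cone_lower\<close> counts.
  Hence the second term has the true order.\<close>

lemma homogeneous_nondeg_upper_large_degree:
  fixes f :: "real ^ 'm::finite \<Rightarrow> real"
  assumes m: "CARD('m) \<ge> 2" and f: "f \<in> homogeneous_nondeg d" and d: "d > 2 * real CARD('m)" and \<epsilon>: "0 < \<epsilon>" "\<epsilon> < 1"
  shows "\<exists>C>0. \<forall>\<delta> Q. 1 \<le> Q \<and> Q powr (\<epsilon> - 1) < \<delta> \<and> \<delta> \<le> 1 \<longrightarrow>
     real (N f \<delta> Q) \<le> C * (Q ^ (CARD('m) + 1) * (\<delta> + (\<delta> / Q) powr (real CARD('m) / d)))"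
proof -
  let ?m = "CARD('m)"
  have d1: "d > 1" using d m by linarith
  obtain C where C: "C > 0" and up: "\<And>\<delta> Q. 1 \<le> Q \<and> Q powr (\<epsilon> - 1) < \<delta> \<and> \<delta> \<le> 1 \<Longrightarrow> (\<exists>n.
     real (N f \<delta> Q) \<le> C * (Q ^ (?m + 1) * (\<delta> + (\<Sum>i<n. ((1 / 2) ^ i) ^ ?m * min 1 (sqrt (\<delta> / Q * (2 ^ i) powr d))))))"
    using homogeneous_nondeg_upper[OF m f d1 \<epsilon>] by blast
  obtain K where K: "K > 0" and S: "\<And>A n. 0 < A \<and> A \<le> 1 \<Longrightarrow>
     (\<Sum>i<n. ((1 / 2) ^ i) ^ ?m * min 1 (sqrt (A * (2 ^ i) powr d))) \<le> K * A powr (real ?m / d)"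
    using cone_sum_le_large_degree[OF _ d] m by auto
  have "real (N f \<delta> Q) \<le> C * (1 + K) * (Q ^ (?m + 1) * (\<delta> + (\<delta> / Q) powr (real ?m / d)))"
    if Q: "1 \<le> Q" and \<delta>: "Q powr (\<epsilon> - 1) < \<delta>" "\<delta> \<le> 1" for \<delta> Q
  proof -
    have \<delta>0: "\<delta> > 0" using \<delta>(1) by (meson powr_ge_zero le_less_trans)
    let ?P = "(\<delta> / Q) powr (real ?m / d)"
    obtain j where "real (N f \<delta> Q) \<le> C * (Q ^ (?m + 1) * (\<delta> + (\<Sum>i<j. ((1 / 2) ^ i) ^ ?m * min 1 (sqrt (\<delta> / Q * (2 ^ i) powr d)))))"
      using up Q \<delta> by blast
    also have "\<dots> \<le> C * (Q ^ (?m + 1) * (\<delta> + K * ?P))"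
      using C Q \<delta> \<delta>0 by (intro mult_left_mono add_left_mono S) auto
    also have "\<dots> \<le> C * (Q ^ (?m + 1) * ((1 + K) * (\<delta> + ?P)))"
    proof (intro mult_left_mono)
      have "K * \<delta> \<ge> 0" "?P \<ge> 0" using K \<delta>0 by auto
      then show "\<delta> + K * ?P \<le> (1 + K) * (\<delta> + ?P)" unfolding distrib_left distrib_right by linarith
    qed (use C Q in auto)
    finally show ?thesis by (simp add: mult_ac)
  qed
  moreover have "C * (1 + K) > 0" using C K by simp
  ultimately show ?thesis by blast
qed

theorem corollary1p7:
  fixes n :: nat
  assumes "n \<ge> 3" and "CARD('m::finite) = n - 1"
  shows "\<exists>k::real. k > 0 \<and>
    (\<forall>d::real. d > 2 * (real n - 1) / (2 * real n - 3) \<longrightarrow>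
      (\<exists>\<epsilon>0::real. \<epsilon>0 > 0 \<and>
        (\<forall>f :: real ^ 'm \<Rightarrow> real. \<forall>\<epsilon>::real.
          f \<in> homogeneous_nondeg d \<and> 0 < \<epsilon> \<and> \<epsilon> < \<epsilon>0 \<longrightarrow>
          (d \<le> 2 * (real n - 1) \<longrightarrow>
            comparable_on {(\<delta>, Q). Q \<ge> 1 \<and> \<delta> \<in> {Q powr (\<epsilon> - 1)<..<1/2}}
              (\<lambda>(\<delta>, Q). real (N f \<delta> Q)) (\<lambda>(\<delta>, Q). \<delta> * Q ^ n)) \<and>
          (d > 2 * (real n - 1) \<longrightarrow>
            dominated_on
              {(\<delta>, Q). Q \<ge> 1 \<and>
                \<delta> \<in> {Q powr (\<epsilon> - 1)<..<Q powr (- ((real n - 1 - k * \<epsilon> * d) / (d - (real n - 1))))}}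
              (\<lambda>(\<delta>, Q). (\<delta> / Q) powr ((real n - 1) / d) * Q ^ n)
              (\<lambda>(\<delta>, Q). real (N f \<delta> Q)) \<and>
            dominated_on
              {(\<delta>, Q). Q \<ge> 1 \<and>
                \<delta> \<in> {Q powr (\<epsilon> - 1)<..<Q powr (- ((real n - 1 - k * \<epsilon> * d) / (d - (real n - 1))))}}
              (\<lambda>(\<delta>, Q). real (N f \<delta> Q))
              (\<lambda>(\<delta>, Q). (\<delta> / Q) powr ((real n - 1) / d) * Q ^ n * Q powr (k * \<epsilon>)) \<and>
            comparable_on
              {(\<delta>, Q). Q \<ge> 1 \<and>
                \<delta> \<in> {Q powr (- ((real n - 1 - k * \<epsilon> * d) / (d - (real n - 1))))..<1/2}}
              (\<lambda>(\<delta>, Q). real (N f \<delta> Q)) (\<lambda>(\<delta>, Q). \<delta> * Q ^ n)))))"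
proof -
  let ?m = "CARD('m)"
  define m where "m = real ?m"
  have n: "n = ?m + 1" and m2: "?m \<ge> 2" using assms by auto
  have rn: "real n - 1 = m" "2 * real n - 3 = 2 * m - 1" by (simp_all add: n m_def)
  have m: "m \<ge> 2" using m2 by (simp add: m_def)
  have "\<exists>\<epsilon>0>0. \<forall>(f :: real ^ 'm \<Rightarrow> real) \<epsilon>. f \<in> homogeneous_nondeg d \<and> 0 < \<epsilon> \<and> \<epsilon> < \<epsilon>0 \<longrightarrow>
      (d \<le> 2 * m \<longrightarrow>
        comparable_on {(\<delta>, Q). Q \<ge> 1 \<and> \<delta> \<in> {Q powr (\<epsilon> - 1)<..<1/2}}
          (\<lambda>(\<delta>, Q). real (N f \<delta> Q)) (\<lambda>(\<delta>, Q). \<delta> * Q ^ n)) \<and>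
      (d > 2 * m \<longrightarrow>
        dominated_on {(\<delta>, Q). Q \<ge> 1 \<and> \<delta> \<in> {Q powr (\<epsilon> - 1)<..<Q powr (- ((m - 1 * \<epsilon> * d) / (d - m)))}}
          (\<lambda>(\<delta>, Q). (\<delta> / Q) powr (m / d) * Q ^ n) (\<lambda>(\<delta>, Q). real (N f \<delta> Q)) \<and>
        dominated_on {(\<delta>, Q). Q \<ge> 1 \<and> \<delta> \<in> {Q powr (\<epsilon> - 1)<..<Q powr (- ((m - 1 * \<epsilon> * d) / (d - m)))}}
          (\<lambda>(\<delta>, Q). real (N f \<delta> Q)) (\<lambda>(\<delta>, Q). (\<delta> / Q) powr (m / d) * Q ^ n * Q powr (1 * \<epsilon>)) \<and>
        comparable_on {(\<delta>, Q). Q \<ge> 1 \<and> \<delta> \<in> {Q powr (- ((m - 1 * \<epsilon> * d) / (d - m)))..<1/2}}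
          (\<lambda>(\<delta>, Q). real (N f \<delta> Q)) (\<lambda>(\<delta>, Q). \<delta> * Q ^ n))"
    if d: "d > 2 * m / (2 * m - 1)" for d
  proof -
    \<comment> \<open>The lower bound on \<open>d\<close> enters as \<open>d > 1\<close>, which
      keeps the slope scale \<open>s powr (d - 1)\<close> of the shells at most
      \<open>1\<close>.\<close>
    have "1 < 2 * m / (2 * m - 1)" using m by simp
    then have d1: "d > 1" using d by linarith
    \<comment> \<open>The condition \<open>\<epsilon> < m / d\<close> makes the exponent of the
      threshold negative, so \<open>\<delta> \<le> 1\<close> below it; \<open>\<epsilon> < 1\<close>
      is what the upper and lower bounds ask for.\<close>
    show ?thesis
    proof (intro exI[of _ "min 1 (m / d)"] conjI allI impI)
      show "min 1 (m / d) > 0" using m d1 by simp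
    next
      fix f :: "real ^ 'm \<Rightarrow> real" and \<epsilon> :: real
      assume h: "f \<in> homogeneous_nondeg d \<and> 0 < \<epsilon> \<and> \<epsilon> < min 1 (m / d)" and dm: "d \<le> 2 * m"
      then have f: "f \<in> homogeneous_nondeg d" and \<epsilon>: "0 < \<epsilon>" "\<epsilon> < 1" by auto
      let ?S = "{(\<delta>, Q). Q \<ge> 1 \<and> \<delta> \<in> {Q powr (\<epsilon> - 1)<..<1/2}}"
      obtain C where C: "C > 0" and up: "\<And>\<delta> Q. 1 \<le> Q \<and> Q powr (\<epsilon> - 1) < \<delta> \<and> \<delta> \<le> 1 \<Longrightarrow> (\<exists>n.
         real (N f \<delta> Q) \<le> C * (Q ^ (?m + 1) * (\<delta> + (\<Sum>i<n. ((1 / 2) ^ i) ^ ?m * min 1 (sqrt (\<delta> / Q * (2 ^ i) powr d))))))"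
        using homogeneous_nondeg_upper[OF m2 f d1 \<epsilon>] by blast
      obtain K where K: "K > 0" and S: "\<And>\<delta> Q n. 1 \<le> Q \<and> Q powr (\<epsilon> - 1) < \<delta> \<Longrightarrow>
         (\<Sum>i<n. ((1 / 2) ^ i) ^ ?m * min 1 (sqrt (\<delta> / Q * (2 ^ i) powr d))) \<le> K * \<delta>"
        using cone_sum_le_small_degree[of d ?m, OF _ _ \<epsilon>] d1 dm by (auto simp: m_def)
      obtain C' where C': "C' > 0" and low: "\<And>\<delta> Q. 1 \<le> Q \<and> Q powr (\<epsilon> - 1) < \<delta> \<and> \<delta> < 1 / 2 \<Longrightarrow>
         \<delta> * Q ^ (?m + 1) \<le> C' * real (N f \<delta> Q)"
        using homogeneous_nondeg_lower[OF m2 f \<epsilon>] by blast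
      have pos: "\<delta> > 0" if "(\<delta>, Q) \<in> ?S" for \<delta> Q
      proof -
        have "Q powr (\<epsilon> - 1) < \<delta>" using that by auto
        then show ?thesis by (meson powr_ge_zero le_less_trans)
      qed
      show "comparable_on ?S (\<lambda>(\<delta>, Q). real (N f \<delta> Q)) (\<lambda>(\<delta>, Q). \<delta> * Q ^ n)"
        unfolding comparable_on_def
      proof
        show "dominated_on ?S (\<lambda>(\<delta>, Q). real (N f \<delta> Q)) (\<lambda>(\<delta>, Q). \<delta> * Q ^ n)"
        proof (rule dominated_onI[of "C * (1 + K)"])
          fix \<delta> Q assume s: "(\<delta>, Q) \<in> ?S"
          then obtain j where "real (N f \<delta> Q) \<le> C * (Q ^ (?m + 1) * (\<delta> + (\<Sum>i<j. ((1 / 2) ^ i) ^ ?m * min 1 (sqrt (\<delta> / Q * (2 ^ i) powr d)))))"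
            using up[of Q \<delta>] by auto
          also have "\<dots> \<le> C * (Q ^ (?m + 1) * (\<delta> + K * \<delta>))"
            using s C by (intro mult_left_mono add_left_mono S) auto
          finally show "\<bar>case (\<delta>, Q) of (\<delta>, Q) \<Rightarrow> real (N f \<delta> Q)\<bar> \<le> C * (1 + K) * \<bar>case (\<delta>, Q) of (\<delta>, Q) \<Rightarrow> \<delta> * Q ^ n\<bar>"
            using s pos[OF s] by (simp add: n abs_mult algebra_simps)
        qed (use C K in simp)
        show "dominated_on ?S (\<lambda>(\<delta>, Q). \<delta> * Q ^ n) (\<lambda>(\<delta>, Q). real (N f \<delta> Q))"
        proof (rule dominated_onI[OF C'])
          fix \<delta> Q assume s: "(\<delta>, Q) \<in> ?S"
          then show "\<bar>case (\<delta>, Q) of (\<delta>, Q) \<Rightarrow> \<delta> * Q ^ n\<bar> \<le> C' * \<bar>case (\<delta>, Q) of (\<delta>, Q) \<Rightarrow> real (N f \<delta> Q)\<bar>"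
            using low[of Q \<delta>] pos[OF s] by (simp add: n abs_mult)
        qed
      qed
    next
      fix f :: "real ^ 'm \<Rightarrow> real" and \<epsilon> :: real
      assume h: "f \<in> homogeneous_nondeg d \<and> 0 < \<epsilon> \<and> \<epsilon> < min 1 (m / d)" and dm: "2 * m < d"
      let ?thr = "\<lambda>Q. Q powr (- ((m - 1 * \<epsilon> * d) / (d - m)))"
      let ?S = "{(\<delta>, Q). Q \<ge> 1 \<and> \<delta> \<in> {Q powr (\<epsilon> - 1)<..<?thr Q}}"
      obtain C where C: "C > 0" and low: "\<And>\<delta> Q. 1 \<le> Q \<and> 0 < \<delta> \<and> \<delta> \<le> 1 \<Longrightarrow>
         (\<delta> / Q) powr (real ?m / d) * Q ^ (?m + 1) \<le> C * real (N f \<delta> Q)"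
        using cone_lower[of f d] h d1 by auto
      have \<epsilon>: "\<epsilon> * d < m" using h d1 by (simp add: field_simps)
      show "dominated_on ?S (\<lambda>(\<delta>, Q). (\<delta> / Q) powr (m / d) * Q ^ n) (\<lambda>(\<delta>, Q). real (N f \<delta> Q))"
      proof (rule dominated_onI[OF C])
        fix \<delta> Q assume s: "(\<delta>, Q) \<in> ?S"
        then have Q: "Q \<ge> 1" and \<delta>: "Q powr (\<epsilon> - 1) < \<delta>" "\<delta> < ?thr Q" by auto
        have \<delta>0: "\<delta> > 0" using \<delta>(1) by (meson powr_ge_zero le_less_trans)
        have "?thr Q \<le> Q powr 0" using Q \<epsilon> dm m by (intro powr_mono) auto
        then have "\<delta> \<le> 1" using \<delta> Q by simp
        then show "\<bar>case (\<delta>, Q) of (\<delta>, Q) \<Rightarrow> (\<delta> / Q) powr (m / d) * Q ^ n\<bar> \<le> C * \<bar>case (\<delta>, Q) of (\<delta>, Q) \<Rightarrow> real (N f \<delta> Q)\<bar>"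
          using low[of Q \<delta>] Q \<delta>0 by (simp add: n abs_mult m_def)
      qed
    next
      fix f :: "real ^ 'm \<Rightarrow> real" and \<epsilon> :: real
      assume h: "f \<in> homogeneous_nondeg d \<and> 0 < \<epsilon> \<and> \<epsilon> < min 1 (m / d)" and dm: "2 * m < d"
      then have f: "f \<in> homogeneous_nondeg d" and \<epsilon>: "0 < \<epsilon>" "\<epsilon> < 1" by auto
      have \<epsilon>d: "\<epsilon> * d < m" using h d1 by (simp add: field_simps)
      let ?thr = "\<lambda>Q. Q powr (- ((m - 1 * \<epsilon> * d) / (d - m)))"
      let ?S = "{(\<delta>, Q). Q \<ge> 1 \<and> \<delta> \<in> {Q powr (\<epsilon> - 1)<..<?thr Q}}"
      obtain C where C: "C > 0" and up: "\<And>\<delta> Q. 1 \<le> Q \<and> Q powr (\<epsilon> - 1) < \<delta> \<and> \<delta> \<le> 1 \<Longrightarrow>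
         real (N f \<delta> Q) \<le> C * (Q ^ n * (\<delta> + (\<delta> / Q) powr (m / d)))"
        using homogeneous_nondeg_upper_large_degree[OF m2 f _ \<epsilon>] dm unfolding n m_def by blast
      show "dominated_on ?S (\<lambda>(\<delta>, Q). real (N f \<delta> Q)) (\<lambda>(\<delta>, Q). (\<delta> / Q) powr (m / d) * Q ^ n * Q powr (1 * \<epsilon>))"
      proof (rule dominated_onI[of "C * 2"])
        fix \<delta> Q assume s: "(\<delta>, Q) \<in> ?S"
        then have Q: "Q \<ge> 1" and \<delta>: "Q powr (\<epsilon> - 1) < \<delta>" "\<delta> < ?thr Q" by auto
        have \<delta>0: "\<delta> > 0" using \<delta>(1) by (meson powr_ge_zero le_less_trans)
        have "?thr Q \<le> Q powr 0" using Q \<epsilon>d dm m by (intro powr_mono) auto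
        then have "\<delta> \<le> 1" using \<delta> Q by simp
        then have "real (N f \<delta> Q) \<le> C * (Q ^ n * (\<delta> + (\<delta> / Q) powr (m / d)))" using up Q \<delta> by auto
        also have "\<dots> \<le> C * (Q ^ n * ((\<delta> / Q) powr (m / d) * Q powr \<epsilon> + (\<delta> / Q) powr (m / d) * Q powr \<epsilon>))"
        proof (intro mult_left_mono add_mono)
          \<comment> \<open>Below the threshold the volume term is absorbed by the cone term at the
            cost of exactly \<open>Q powr \<epsilon>\<close>; this is the choice
            \<open>k = 1\<close>.\<close>
          show "\<delta> \<le> (\<delta> / Q) powr (m / d) * Q powr \<epsilon>"
            using threshold_iff(1)[of m d Q \<delta> \<epsilon>] \<delta> m dm Q \<delta>0 by simp
          have "1 \<le> Q powr \<epsilon>" using Q \<epsilon> by (intro ge_one_powr_ge_zero) auto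
          then show "(\<delta> / Q) powr (m / d) \<le> (\<delta> / Q) powr (m / d) * Q powr \<epsilon>" by (simp add: mult_le_cancel_left1)
        qed (use C Q in auto)
        finally show "\<bar>case (\<delta>, Q) of (\<delta>, Q) \<Rightarrow> real (N f \<delta> Q)\<bar> \<le> C * 2 * \<bar>case (\<delta>, Q) of (\<delta>, Q) \<Rightarrow> (\<delta> / Q) powr (m / d) * Q ^ n * Q powr (1 * \<epsilon>)\<bar>"
          using Q by (simp add: abs_mult algebra_simps)
      qed (use C in simp)
    next
      fix f :: "real ^ 'm \<Rightarrow> real" and \<epsilon> :: real
      assume h: "f \<in> homogeneous_nondeg d \<and> 0 < \<epsilon> \<and> \<epsilon> < min 1 (m / d)" and dm: "2 * m < d"
      then have f: "f \<in> homogeneous_nondeg d" and \<epsilon>: "0 < \<epsilon>" "\<epsilon> < 1" by auto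
      let ?thr = "\<lambda>Q. Q powr (- ((m - 1 * \<epsilon> * d) / (d - m)))"
      let ?S = "{(\<delta>, Q). Q \<ge> 1 \<and> \<delta> \<in> {?thr Q..<1/2}}"
      obtain C where C: "C > 0" and up: "\<And>\<delta> Q. 1 \<le> Q \<and> Q powr (\<epsilon> - 1) < \<delta> \<and> \<delta> \<le> 1 \<Longrightarrow>
         real (N f \<delta> Q) \<le> C * (Q ^ n * (\<delta> + (\<delta> / Q) powr (m / d)))"
        using homogeneous_nondeg_upper_large_degree[OF m2 f _ \<epsilon>] dm unfolding n m_def by blast
      obtain C' where C': "C' > 0" and low: "\<And>\<delta> Q. 1 \<le> Q \<and> Q powr (\<epsilon> - 1) < \<delta> \<and> \<delta> < 1 / 2 \<Longrightarrow>
         \<delta> * Q ^ n \<le> C' * real (N f \<delta> Q)"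
        using homogeneous_nondeg_lower[OF m2 f \<epsilon>] unfolding n by blast
      have range: "Q \<ge> 1" "Q powr (\<epsilon> - 1) < \<delta>" "\<delta> < 1 / 2" "\<delta> > 0" "?thr Q \<le> \<delta>" if s: "(\<delta>, Q) \<in> ?S" for \<delta> Q
      proof -
        show Q: "Q \<ge> 1" and t: "\<delta> < 1 / 2" "?thr Q \<le> \<delta>" using s by auto
        \<comment> \<open>At \<open>Q = 1\<close> the threshold equals \<open>1\<close> and the
          interval up to \<open>1 / 2\<close> is empty. Having \<open>Q > 1\<close> makes powers of
          \<open>Q\<close> strictly monotone.\<close>
        have "Q \<noteq> 1" using t by auto
        then have "Q > 1" using Q by simp
        \<comment> \<open>Above the threshold the condition
          \<open>\<delta> > Q powr (\<epsilon> - 1)\<close> is automatic: the difference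
          \<open>(1 - \<epsilon>) * (d - m) - (m - \<epsilon> * d)\<close> equals
          \<open>d - 2 * m + \<epsilon> * m\<close>, which is positive.\<close>
        moreover have "\<epsilon> - 1 < - ((m - 1 * \<epsilon> * d) / (d - m))"
        proof -
          have "m - \<epsilon> * d < (1 - \<epsilon>) * (d - m)"
          proof -
            have "\<epsilon> * m > 0" using \<epsilon> m by simp
            then show ?thesis using dm by (simp add: algebra_simps)
          qed
          then have "(m - 1 * \<epsilon> * d) / (d - m) < 1 - \<epsilon>" using dm m by (simp add: pos_divide_less_eq)
          then show ?thesis by linarith
        qed
        ultimately have "Q powr (\<epsilon> - 1) < ?thr Q" by (intro powr_less_mono)
        then show "Q powr (\<epsilon> - 1) < \<delta>" using t by linarith
        then show "\<delta> > 0" by (meson powr_ge_zero le_less_trans)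
      qed
      show "comparable_on ?S (\<lambda>(\<delta>, Q). real (N f \<delta> Q)) (\<lambda>(\<delta>, Q). \<delta> * Q ^ n)"
        unfolding comparable_on_def
      proof
        show "dominated_on ?S (\<lambda>(\<delta>, Q). real (N f \<delta> Q)) (\<lambda>(\<delta>, Q). \<delta> * Q ^ n)"
        proof (rule dominated_onI[of "C * 2"])
          fix \<delta> Q assume s: "(\<delta>, Q) \<in> ?S"
          note r = range[OF s]
          have "real (N f \<delta> Q) \<le> C * (Q ^ n * (\<delta> + (\<delta> / Q) powr (m / d)))" using up r by simp
          also have "\<dots> \<le> C * (Q ^ n * (\<delta> + \<delta>))"
          proof (intro mult_left_mono add_left_mono)
            have "1 \<le> Q powr \<epsilon>" using r \<epsilon> by (intro ge_one_powr_ge_zero) auto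
            then have "(\<delta> / Q) powr (m / d) \<le> (\<delta> / Q) powr (m / d) * Q powr \<epsilon>" by (simp add: mult_le_cancel_left1)
            also have "\<dots> \<le> \<delta>" using threshold_iff(2)[of m d Q \<delta> \<epsilon>] r m dm by simp
            finally show "(\<delta> / Q) powr (m / d) \<le> \<delta>" .
          qed (use C r in auto)
          finally show "\<bar>case (\<delta>, Q) of (\<delta>, Q) \<Rightarrow> real (N f \<delta> Q)\<bar> \<le> C * 2 * \<bar>case (\<delta>, Q) of (\<delta>, Q) \<Rightarrow> \<delta> * Q ^ n\<bar>"
            using r by (simp add: abs_mult algebra_simps)
        qed (use C in simp)
        show "dominated_on ?S (\<lambda>(\<delta>, Q). \<delta> * Q ^ n) (\<lambda>(\<delta>, Q). real (N f \<delta> Q))"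
        proof (rule dominated_onI[OF C'])
          fix \<delta> Q assume s: "(\<delta>, Q) \<in> ?S"
          note r = range[OF s]
          show "\<bar>case (\<delta>, Q) of (\<delta>, Q) \<Rightarrow> \<delta> * Q ^ n\<bar> \<le> C' * \<bar>case (\<delta>, Q) of (\<delta>, Q) \<Rightarrow> real (N f \<delta> Q)\<bar>"
            using low[of Q \<delta>] r by (simp add: abs_mult)
        qed
      qed
    qed
  qed
  then show ?thesis unfolding rn by (intro exI[of _ 1]) simp
qed

end
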